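(* The assignment $I\mapsto\tilde f_I$ induces an isomorphism of monoids $$\mathrm{Cl}(\mathfrak O)/\mathrm{Pic}(\mathfrak O)\xrightarrow{\ \simeq\ }\mathcal S^u_{0,b}(\mathfrak O;\widetilde V)/\mathcal S^u_{0,\mathrm{ref}}(\mathfrak O;\mathrm{val}),\qquad [I]\longmapsto \tilde f_I \bmod \mathcal S^u_{0,\mathrm{ref}}(\mathfrak O;\mathrm{val}).$$ Moreover, the image of the monoid $\mathrm{Reg}\,\mathrm{Cl}(\mathfrak O)/\mathrm{Pic}(\mathfrak O)$ under this isomorphism is $\mathcal S^u_{0,\mathrm{ref}}(\mathfrak O;\widetilde V)/\mathcal S^u_{0,\mathrm{ref}}(\mathfrak O;\mathrm{val})$.
   Context: Setting: $\mathfrak o$ is a Dedekind domain which is not a field, $K$ its fraction field, $L/K$ an algebraic extension of fields (possibly of infinite degree), and $\mathfrak O$ the integral closure of $\mathfrak o$ in $L$. Ideals: a fractional ideal of $\mathfrak O$ is a non-zero $\mathfrak O$-submodule $I\subseteq L$ with $dI\subseteq\mathfrak O$ for some $d\in L^\times$; it is invertible if $IJ=\mathfrak O$ for some fractional ideal $J$. $\mathcal F(\mathfrak O)$ is the commutative monoid of fractional ideals under multiplication, $\mathcal I(\mathfrak O)$ the group of invertible ones, $\mathcal P(\mathfrak O)$ the group of principal ones $a\mathfrak O$, $a\in L^\times$. $\mathrm{Cl}(\mathfrak O)=\mathcal F(\mathfrak O)/\mathcal P(\mathfrak O)$ is the ideal class semigroup, $\mathrm{Pic}(\mathfrak O)=\mathcal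 I(\mathfrak O)/\mathcal P(\mathfrak O)$ the Picard group, and $[I]$ is the class of $I$. For a commutative monoid $A$ and a submonoid $H$ that is a group, $A/H$ is the quotient monoid of $A$ by the relation: $a\sim b$ iff $a=hb$ for some $h\in H$. For a monoid $A$, $\mathrm{Reg}\,A$ is the set of $a\in A$ such that $a=aba$ for some $b\in A$. Topology: $\mathrm{mSpec}\,\mathfrak O$ is the set of maximal ideals of $\mathfrak O$ with the Krull-like topology, whose open base consists of the sets $\mathcal U(A)=\{\mathfrak P\in\mathrm{mSpec}\,\mathfrak O : A\subseteq\mathfrak P\}$ for $A$ a finite subset of $\mathfrak O$. The monoid $\widetilde{\mathbb R}$: $\widetilde{\mathbb R}=\mathbb R\times\{0,1\}$ with the lexicographic total order and addition $(\alpha,s)+(\beta,t)=(\alpha+\beta,\max\{s,t\})$; put $\iota(\alpha,s)=(-\alpha,s)$. Functions: a function $\tilde f\colon X\to\widetilde{\mathbb R}$ on a topological space $X$ is upper $\widetilde{\mathbb R}$-semicontinuous if $\{x\in X:\tilde f(x)<a\}$ is open for every $a\in\widetilde{\mathbb R}$; it is compactly supported if there is a compact $Y\subseteq X$ with $\tilde f=(0,0)$ on $X\setminus Y$; it is bounded if there are $a,b\in\widetilde{\mathbb R}$ with $a\le\tilde f(x)\le b$ for all $x$. $\mathcal S^u_{0,b}(X;\widetilde{\mathbb R})$ is the commutative monoid (under pointwise addition) of bounded, compactly supported, upper $\widetilde{\mathbb R}$-semicontinuous functions $X\to\widetilde{\mathbb R}$, and $\mathcal S^u_{0,\mathrm{ref}}(X;\widetilde{\mathbb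 R})$ is the submonoid of those $\tilde f$ with $\iota\circ\tilde f\in\mathcal S^u_{0,b}(X;\widetilde{\mathbb R})$. Valuations: for $\mathfrak P\in\mathrm{mSpec}\,\mathfrak O$, $v_{\mathfrak P}\colon L^\times\to\mathbb Q$ is the unique additive valuation corresponding to $\mathfrak P$ normalized by $v_{\mathfrak P}(K^\times)=\mathbb Z$; put $v_{\mathfrak P}(0)=+\infty$. $V_{\mathfrak P}$ is the closure of $v_{\mathfrak P}(L^\times)$ in $\mathbb R$. Put $\mathrm{val}_{\mathfrak P}=\{(\alpha,0):\alpha\in v_{\mathfrak P}(L^\times)\}$, and $\widetilde V_{\mathfrak P}=\mathrm{val}_{\mathfrak P}\sqcup\{(\beta,1):\beta\in\mathbb R\}$ if $V_{\mathfrak P}=\mathbb R$, $\widetilde V_{\mathfrak P}=\mathrm{val}_{\mathfrak P}$ if $V_{\mathfrak P}=v_{\mathfrak P}(L^\times)$ (exactly one of these cases occurs). $\mathcal S^u_{0,b}(\mathfrak O;\widetilde V)$ (resp. $\mathcal S^u_{0,\mathrm{ref}}(\mathfrak O;\widetilde V)$, resp. $\mathcal S^u_{0,\mathrm{ref}}(\mathfrak O;\mathrm{val})$) is the monoid of $\tilde f$ in $\mathcal S^u_{0,b}(\mathrm{mSpec}\,\mathfrak O;\widetilde{\mathbb R})$ (resp. in $\mathcal S^u_{0,\mathrm{ref}}(\mathrm{mSpec}\,\mathfrak O;\widetilde{\mathbb R})$ in the last two cases) with $\tilde f(\mathfrak P)\in\widetilde V_{\mathfrak P}$ (resp. $\widetilde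 V_{\mathfrak P}$, resp. $\mathrm{val}_{\mathfrak P}$) for all $\mathfrak P$; the last one is a group. For $I\in\mathcal F(\mathfrak O)$ put $f_I(\mathfrak P)=\inf\{v_{\mathfrak P}(x):x\in I\}$, let $\mathrm{Max}(I)$ be the set of $\mathfrak P$ for which this infimum is attained by some $x\in I$, and define $\tilde f_I\colon\mathrm{mSpec}\,\mathfrak O\to\widetilde{\mathbb R}$ by $\tilde f_I(\mathfrak P)=(f_I(\mathfrak P),0)$ if $\mathfrak P\in\mathrm{Max}(I)$ and $\tilde f_I(\mathfrak P)=(f_I(\mathfrak P),1)$ otherwise. *)

theory Defs
  imports
    "HOL-Analysis.Analysis"
    "HOL-Algebra.Ideal_Product"
    "HOL-Algebra.Ring_Divisibility"
    "HOL-Algebra.Subrings"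
    "HOL-Computational_Algebra.Polynomial"
begin

section \<open>Subrings of a field\<close>

text \<open>
  The big field $L$ is a type of class \<^class>\<open>field\<close>; its subrings $\mathfrak o$, $K$,
  $\mathfrak O$ are sets. \<open>ring_on S\<close> is such a subring as a ring record, so that the
  notions of HOL-Algebra apply to it.
\<close>

definition ring_on :: "'a::field set \<Rightarrow> 'a ring" where
  "ring_on S = \<lparr>carrier = S, monoid.mult = (*), one = 1, ring.zero = 0, add = (+)\<rparr>"

abbreviation ambient :: "'a::field ring" where
  "ambient \<equiv> ring_on UNIV"

definition frac_field :: "'a::field set \<Rightarrow> 'a set" where
  "frac_field R = {a / b | a b. a \<in> R \<and> b \<in> R \<and> b \<noteq> 0}"

definition algebraic_over :: "'a::field set \<Rightarrow> 'a \<Rightarrow> bool" where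
  "algebraic_over K x \<longleftrightarrow> (\<exists>p. p \<noteq> 0 \<and> (\<forall>i. poly.coeff p i \<in> K) \<and> poly p x = 0)"

definition integral_over :: "'a::field set \<Rightarrow> 'a \<Rightarrow> bool" where
  "integral_over R x \<longleftrightarrow> (\<exists>p. Polynomial.lead_coeff p = 1 \<and> (\<forall>i. poly.coeff p i \<in> R) \<and> poly p x = 0)"

definition integral_closure :: "'a::field set \<Rightarrow> 'a set" where
  "integral_closure R = {x. integral_over R x}"

definition dedekind_domain :: "'a::field set \<Rightarrow> bool" where
  "dedekind_domain R \<longleftrightarrow>
     subring R ambient \<and>
     noetherian_ring (ring_on R) \<and>
     (\<forall>x\<in>frac_field R. integral_over R x \<longrightarrow> x \<in> R) \<and>
     (\<forall>P. primeideal P (ring_on R) \<and> P \<noteq> {0} \<longrightarrow> maximalideal P (ring_on R))"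

section \<open>Quotient monoids and regular elements\<close>

text \<open>
  For a commutative monoid \<open>A\<close> and a submonoid \<open>H\<close> that is a group, the quotient \<open>A/H\<close> by the
  relation \<open>a = h \<otimes> b\<close> for some \<open>h \<in> H\<close> (\<open>quot_rel\<close> below) is the library's \<open>A Mod H\<close>: its elements are the
  cosets \<open>H #> b\<close>, multiplied as sets. The library states its facts about \<open>Mod\<close> for groups only;
  the two lemmas below confirm that the definition gives the intended monoid here too.
\<close>

definition quot_rel :: "('a, 'b) monoid_scheme \<Rightarrow> 'a set \<Rightarrow> ('a \<times> 'a) set" where
  "quot_rel A H = {(a, b). a \<in> carrier A \<and> b \<in> carrier A \<and> (\<exists>h\<in>H. a = h \<otimes>\<^bsub>A\<^esub> b)}"

lemma carrier_Mod_monoid: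
  fixes A (structure)
  assumes "comm_monoid A" "submonoid H A" "group (A\<lparr>carrier := H\<rparr>)"
  shows "equiv (carrier A) (quot_rel A H)"
    and "carrier (A Mod H) = carrier A // quot_rel A H"
proof -
  interpret comm_monoid A by fact
  interpret H: submonoid H A by fact
  interpret G: group "A\<lparr>carrier := H\<rparr>" by fact
  have sym: "\<exists>k\<in>H. b = k \<otimes> a" if ab: "a = h \<otimes> b" "h \<in> H" "b \<in> carrier A" for a b h
  proof -
    obtain k where k: "k \<in> H" "k \<otimes> h = \<one>" using G.l_inv_ex[of h] ab(2) by auto
    have "k \<otimes> a = b" using ab k H.subset by (metis l_one m_assoc subsetD)
    then show ?thesis using k by auto
  qed
  show eq: "equiv (carrier A) (quot_rel A H)"
  proof (rule equivI)
    show "quot_rel A H \<subseteq> carrier A \<times> carrier A" by (auto simp: quot_rel_def)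
    show "refl_on (carrier A) (quot_rel A H)"
      by (intro refl_onI) (auto simp: quot_rel_def intro!: bexI[of _ \<one>])
    show "sym (quot_rel A H)" using sym by (auto simp: quot_rel_def intro!: symI)
    show "trans (quot_rel A H)"
    proof (rule transI)
      fix a b c assume "(a, b) \<in> quot_rel A H" "(b, c) \<in> quot_rel A H"
      then obtain h k where *: "h \<in> H" "k \<in> H" "a = h \<otimes> b" "b = k \<otimes> c"
        "a \<in> carrier A" "c \<in> carrier A" by (auto simp: quot_rel_def)
      then have "a = (h \<otimes> k) \<otimes> c" using H.subset by (metis m_assoc subsetD)
      then show "(a, c) \<in> quot_rel A H" using * by (auto simp: quot_rel_def intro!: bexI[of _ "h \<otimes> k"])
    qed
  qed
  have cls: "H #> b = quot_rel A H `` {b}" if b: "b \<in> carrier A" for b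
  proof (intro Set.set_eqI iffI)
    fix a assume "a \<in> H #> b"
    then obtain h where h: "h \<in> H" "a = h \<otimes> b" by (auto simp: r_coset_def)
    have "a \<in> carrier A" using h b H.subset by auto
    moreover have "\<exists>k\<in>H. b = k \<otimes> a" using sym[OF h(2,1) b] .
    ultimately show "a \<in> quot_rel A H `` {b}" using b by (auto simp: quot_rel_def)
  next
    fix a assume "a \<in> quot_rel A H `` {b}"
    then obtain h where h: "h \<in> H" "b = h \<otimes> a" "a \<in> carrier A" by (auto simp: quot_rel_def)
    then show "a \<in> H #> b" using sym[OF h(2,1,3)] by (auto simp: r_coset_def)
  qed
  show "carrier (A Mod H) = carrier A // quot_rel A H"
    by (auto simp: FactGroup_def RCOSETS_def quotient_def cls)
qed

lemma mult_Mod_monoid: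
  fixes A (structure)
  assumes "comm_monoid A" "submonoid H A" "a \<in> carrier A" "b \<in> carrier A"
  shows "(H #> a) \<otimes>\<^bsub>A Mod H\<^esub> (H #> b) = H #> (a \<otimes> b)"
proof -
  interpret comm_monoid A by fact
  interpret H: submonoid H A by fact
  have *: "(h \<otimes> a) \<otimes> (k \<otimes> b) = (h \<otimes> k) \<otimes> (a \<otimes> b)" if "h \<in> H" "k \<in> H" for h k
    using that assms(3,4) H.subset by (auto simp: m_ac subset_iff)
  show ?thesis
  proof (intro Set.set_eqI iffI)
    fix x assume "x \<in> (H #> a) \<otimes>\<^bsub>A Mod H\<^esub> (H #> b)"
    then obtain h k where "h \<in> H" "k \<in> H" "x = (h \<otimes> a) \<otimes> (k \<otimes> b)"
      by (auto simp: FactGroup_def set_mult_def r_coset_def)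
    then show "x \<in> H #> (a \<otimes> b)" using * by (auto simp: r_coset_def)
  next
    fix x assume "x \<in> H #> (a \<otimes> b)"
    then obtain h where h: "h \<in> H" "x = h \<otimes> (a \<otimes> b)" by (auto simp: r_coset_def)
    then have "x = (h \<otimes> a) \<otimes> (\<one> \<otimes> b)" using *[of h \<one>] H.subset by (auto simp: subset_iff)
    then show "x \<in> (H #> a) \<otimes>\<^bsub>A Mod H\<^esub> (H #> b)"
      using h(1) H.one_closed unfolding FactGroup_def set_mult_def r_coset_def monoid.simps by blast
  qed
qed

definition Reg :: "('a, 'b) monoid_scheme \<Rightarrow> 'a set" where
  "Reg A = {a \<in> carrier A. \<exists>b\<in>carrier A. a = a \<otimes>\<^bsub>A\<^esub> b \<otimes>\<^bsub>A\<^esub> a}"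

section \<open>Fractional ideals, class semigroup, Picard group\<close>

definition fractional_ideal :: "'a::field set \<Rightarrow> 'a set \<Rightarrow> bool" where
  "fractional_ideal R I \<longleftrightarrow>
     0 \<in> I \<and> I \<noteq> {0} \<and>
     (\<forall>x\<in>I. \<forall>y\<in>I. x + y \<in> I) \<and> (\<forall>r\<in>R. \<forall>x\<in>I. r * x \<in> I) \<and>
     (\<exists>d. d \<noteq> 0 \<and> (\<forall>x\<in>I. d * x \<in> R))"

text \<open>
  \<^const>\<open>ideal_prod\<close>, taken in the ambient field, is the set of finite sums of products,
  so it is the product of arbitrary submodules of the field.
\<close>

definition Frac_Ideals :: "'a::field set \<Rightarrow> 'a set monoid" where
  "Frac_Ideals R =
     \<lparr>carrier = {I. fractional_ideal R I}, monoid.mult = ideal_prod ambient, one = R\<rparr>"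

definition Inv_Ideals :: "'a::field set \<Rightarrow> 'a set monoid" where
  "Inv_Ideals R = (Frac_Ideals R)\<lparr>carrier :=
     {I. fractional_ideal R I \<and> (\<exists>J. fractional_ideal R J \<and> ideal_prod ambient I J = R)}\<rparr>"

definition principal_ideals :: "'a::field set \<Rightarrow> 'a set set" where
  "principal_ideals R = {(\<lambda>x. a * x) ` R | a. a \<noteq> 0}"

definition Cl :: "'a::field set \<Rightarrow> 'a set set monoid" where
  "Cl R = Frac_Ideals R Mod principal_ideals R"

definition Pic :: "'a::field set \<Rightarrow> 'a set set monoid" where
  "Pic R = Inv_Ideals R Mod principal_ideals R"

definition ideal_class :: "'a::field set \<Rightarrow> 'a set \<Rightarrow> 'a set set" where
  "ideal_class R I = principal_ideals R #>\<^bsub>Frac_Ideals R\<^esub> I"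

section \<open>The maximal spectrum\<close>

definition max_ideals :: "'a::field set \<Rightarrow> 'a set set" where
  "max_ideals R = {P. maximalideal P (ring_on R)}"

text \<open>
  The sets \<open>U(A)\<close> are closed under finite intersections, \<open>U(A) \<inter> U(B) = U(A \<union> B)\<close>, and
  \<open>U({})\<close> is the whole spectrum: generating a topology from them makes them a base, and
  the \<^const>\<open>topspace\<close> is \<open>max_ideals R\<close>.
\<close>

definition mSpec :: "'a::field set \<Rightarrow> 'a set topology" where
  "mSpec R =
     topology_generated_by {{P \<in> max_ideals R. A \<subseteq> P} | A. finite A \<and> A \<subseteq> R}"

lemma topspace_mSpec: "topspace (mSpec R) = max_ideals R"
  unfolding mSpec_def topology_generated_by_topspace by auto

section \<open>The totally ordered monoid of real numbers with a flag\<close>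

text \<open>
  The flags 0 and 1 are the truth values \<^term>\<open>False\<close> and \<^term>\<open>True\<close>, with
  \<open>False < True\<close>. A new type is needed since HOL-Analysis orders pairs componentwise.
\<close>

datatype rtilde = RT real bool

instantiation rtilde :: linorder
begin

fun less_rtilde :: "rtilde \<Rightarrow> rtilde \<Rightarrow> bool" where
  "RT \<alpha> s < RT \<beta> t \<longleftrightarrow> \<alpha> < \<beta> \<or> (\<alpha> = \<beta> \<and> s < t)"

definition less_eq_rtilde :: "rtilde \<Rightarrow> rtilde \<Rightarrow> bool" where
  "a \<le> b \<longleftrightarrow> a < b \<or> a = (b::rtilde)"

instance
proof
  fix x y z :: rtilde
  show "(x < y) = (x \<le> y \<and> \<not> y \<le> x)"
    by (cases x; cases y) (auto simp: less_eq_rtilde_def)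
  show "x \<le> x" by (simp add: less_eq_rtilde_def)
  show "x \<le> z" if "x \<le> y" "y \<le> z"
    using that by (cases x; cases y; cases z) (auto simp: less_eq_rtilde_def)
  show "x = y" if "x \<le> y" "y \<le> x"
    using that by (cases x; cases y) (auto simp: less_eq_rtilde_def)
  show "x \<le> y \<or> y \<le> x"
    by (cases x; cases y) (auto simp: less_eq_rtilde_def)
qed

end

instantiation rtilde :: comm_monoid_add
begin

definition zero_rtilde :: rtilde where
  "0 = RT 0 False"

fun plus_rtilde :: "rtilde \<Rightarrow> rtilde \<Rightarrow> rtilde" where
  "RT \<alpha> s + RT \<beta> t = RT (\<alpha> + \<beta>) (max s t)"

instance
proof
  fix a b c :: rtilde
  show "a + b + c = a + (b + c)"
    by (cases a; cases b; cases c) (auto simp: max.assoc)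
  show "a + b = b + a"
    by (cases a; cases b) (auto simp: max.commute)
  show "0 + a = a"
    by (cases a) (auto simp: zero_rtilde_def max_def)
qed

end

fun rt_iota :: "rtilde \<Rightarrow> rtilde" where
  "rt_iota (RT \<alpha> s) = RT (- \<alpha>) s"

section \<open>Semicontinuous functions\<close>

definition upper_semicont :: "'x topology \<Rightarrow> ('x \<Rightarrow> rtilde) \<Rightarrow> bool" where
  "upper_semicont X f \<longleftrightarrow> (\<forall>a. openin X {x \<in> topspace X. f x < a})"

definition compactly_supported :: "'x topology \<Rightarrow> ('x \<Rightarrow> rtilde) \<Rightarrow> bool" where
  "compactly_supported X f \<longleftrightarrow> (\<exists>Y. compactin X Y \<and> (\<forall>x\<in>topspace X - Y. f x = 0))"

definition bounded_rt :: "'x topology \<Rightarrow> ('x \<Rightarrow> rtilde) \<Rightarrow> bool" where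
  "bounded_rt X f \<longleftrightarrow> (\<exists>a b. \<forall>x\<in>topspace X. a \<le> f x \<and> f x \<le> b)"

text \<open>
  Functions on \<open>X\<close> are represented by functions that are \<^const>\<open>undefined\<close> outside
  \<open>topspace X\<close>, so that equality of functions on \<open>X\<close> is equality in HOL.
\<close>

definition S_b :: "'x topology \<Rightarrow> ('x \<Rightarrow> rtilde) set" where
  "S_b X = {f \<in> topspace X \<rightarrow>\<^sub>E UNIV.
     bounded_rt X f \<and> compactly_supported X f \<and> upper_semicont X f}"

definition S_ref :: "'x topology \<Rightarrow> ('x \<Rightarrow> rtilde) set" where
  "S_ref X = {f \<in> S_b X. restrict (rt_iota \<circ> f) (topspace X) \<in> S_b X}"

definition fun_monoid :: "'x topology \<Rightarrow> ('x \<Rightarrow> rtilde) set \<Rightarrow> ('x \<Rightarrow> rtilde) monoid" where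
  "fun_monoid X S = \<lparr>carrier = S,
     monoid.mult = (\<lambda>f g. restrict (\<lambda>x. f x + g x) (topspace X)),
     one = restrict (\<lambda>x. 0) (topspace X)\<rparr>"

section \<open>Valuations\<close>

definition rat_valuation :: "('a::field \<Rightarrow> ereal) \<Rightarrow> bool" where
  "rat_valuation v \<longleftrightarrow>
     v 0 = \<infinity> \<and> (\<forall>x. x \<noteq> 0 \<longrightarrow> v x \<in> ereal ` \<rat>) \<and>
     (\<forall>x y. v (x * y) = v x + v y) \<and>
     (\<forall>x y. min (v x) (v y) \<le> v (x + y))"

definition localization :: "'a::field set \<Rightarrow> 'a set \<Rightarrow> 'a set" where
  "localization R P = {a / s | a s. a \<in> R \<and> s \<in> R - P}"

text \<open>
  The valuation corresponds to \<open>P\<close> in the sense that its valuation ring is the localization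
  at \<open>P\<close>; the last condition normalizes it on the base field \<open>K\<close>.
\<close>

definition val :: "'a::field set \<Rightarrow> 'a set \<Rightarrow> 'a set \<Rightarrow> 'a \<Rightarrow> ereal" where
  "val K R P = (THE v. rat_valuation v \<and> {x. 0 \<le> v x} = localization R P \<and>
     v ` (K - {0}) = ereal ` \<int>)"

definition value_group :: "'a::field set \<Rightarrow> 'a set \<Rightarrow> 'a set \<Rightarrow> real set" where
  "value_group K R P = real_of_ereal ` val K R P ` (UNIV - {0})"

definition val_tilde :: "'a::field set \<Rightarrow> 'a set \<Rightarrow> 'a set \<Rightarrow> rtilde set" where
  "val_tilde K R P = {RT \<alpha> False | \<alpha>. \<alpha> \<in> value_group K R P}"

definition V_tilde :: "'a::field set \<Rightarrow> 'a set \<Rightarrow> 'a set \<Rightarrow> rtilde set" where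
  "V_tilde K R P = (if closure (value_group K R P) = UNIV
     then val_tilde K R P \<union> {RT \<beta> True | \<beta>. True} else val_tilde K R P)"

definition S_b_V :: "'a::field set \<Rightarrow> 'a set \<Rightarrow> ('a set \<Rightarrow> rtilde) set" where
  "S_b_V K R = {f \<in> S_b (mSpec R). \<forall>P\<in>max_ideals R. f P \<in> V_tilde K R P}"

definition S_ref_V :: "'a::field set \<Rightarrow> 'a set \<Rightarrow> ('a set \<Rightarrow> rtilde) set" where
  "S_ref_V K R = {f \<in> S_ref (mSpec R). \<forall>P\<in>max_ideals R. f P \<in> V_tilde K R P}"

definition S_ref_val :: "'a::field set \<Rightarrow> 'a set \<Rightarrow> ('a set \<Rightarrow> rtilde) set" where
  "S_ref_val K R = {f \<in> S_ref (mSpec R). \<forall>P\<in>max_ideals R. f P \<in> val_tilde K R P}"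

definition f_ideal :: "'a::field set \<Rightarrow> 'a set \<Rightarrow> 'a set \<Rightarrow> 'a set \<Rightarrow> ereal" where
  "f_ideal K R I P = (INF x\<in>I. val K R P x)"

definition Max_ideal :: "'a::field set \<Rightarrow> 'a set \<Rightarrow> 'a set \<Rightarrow> 'a set set" where
  "Max_ideal K R I = {P \<in> max_ideals R. \<exists>x\<in>I. val K R P x = f_ideal K R I P}"

text \<open>For a fractional ideal the infimum is finite, so \<^const>\<open>real_of_ereal\<close> loses nothing.\<close>

definition f_tilde :: "'a::field set \<Rightarrow> 'a set \<Rightarrow> 'a set \<Rightarrow> 'a set \<Rightarrow> rtilde" where
  "f_tilde K R I = restrict
     (\<lambda>P. RT (real_of_ereal (f_ideal K R I P)) (P \<notin> Max_ideal K R I)) (max_ideals R)"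

end

theory Submission
  imports Defs "Jordan_Normal_Form.Char_Poly"
begin

text \<open>
  Write \<open>\<oo>\<close> for the base ring, \<open>\<OO>\<close> for its integral closure, \<open>v\<^sub>P\<close> for the valuation at a maximal
  ideal \<open>P\<close> of \<open>\<OO>\<close> and \<open>f\<^sub>I\<close> for the function of a fractional ideal \<open>I\<close>. The theorem follows from
  a statement without quotients: \<open>I \<mapsto> f\<^sub>I\<close> is an isomorphism from the monoid of all fractional
  ideals onto the monoid of admissible functions (\<open>f_tilde_prod\<close>, \<open>f_tilde_inj\<close>, \<open>f_tilde_surj\<close>).
  It carries the invertible ideals to the group \<open>S_ref_val\<close> (\<open>ft_inv_image\<close>). It carries the ideals
  \<open>I\<close> with \<open>I = I B I\<close> for some \<open>B\<close> to \<open>S_ref_V\<close> (\<open>ft_reg_image\<close>), because \<open>a = a + b + a\<close> implies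
  \<open>\<iota> a = a + b + b\<close> and, conversely, \<open>a + \<iota> a + a = a\<close>. What remains is bookkeeping with cosets.

  The localizations of \<open>\<OO>\<close> at maximal ideals are valuation rings with rational value groups
  (\<open>loc_total\<close>, \<open>loc_rational\<close>), and \<open>f\<^sub>I(P)\<close> is the greatest lower bound of the values \<open>(v\<^sub>P(x), 0)\<close>
  with \<open>x\<close> in \<open>I\<close> (\<open>is_glb_f_tilde\<close>): the flag 1 marks an infimum that is not attained. Such a bound
  determines the localization of \<open>I\<close> at \<open>P\<close>, and \<open>I\<close> is the intersection of its localizations, which
  gives injectivity; the bounds of a product are the sums of the bounds.

  For surjectivity, an admissible function \<open>g\<close> has to be the function of the ideal of all \<open>x\<close> with
  \<open>g(P) \<le> (v\<^sub>P(x), 0)\<close> for all \<open>P\<close>, so this ideal needs elements whose value at a given \<open>P\<close> is close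
  to \<open>g(P)\<close>. An element \<open>y\<close> of value \<open>\<alpha>\<close> with \<open>g(P) \<le> (\<alpha>, 0)\<close> satisfies the conditions at all points
  near \<open>P\<close>: the values of \<open>y\<close> are locally constant, and the condition \<open>g(Q) \<le> (\<alpha>, 0)\<close> is open since
  it means \<open>g(Q) < (\<alpha>, 1)\<close> and \<open>g\<close> is upper semicontinuous. The other points that matter lie over
  finitely many primes of \<open>\<oo>\<close>; for them \<open>y\<close> is multiplied by an element that is a unit at \<open>P\<close> and
  has large values there (\<open>separating_element\<close>). It exists because the maximal ideals over a prime of \<open>\<oo>\<close> form a compact set (\<open>compactin_fibre\<close>).
\<close>

section \<open>Subrings of a field\<close>

text \<open>
  Unlike \<open>subring R ambient\<close>, this is stated on elements, so that field arithmetic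
  applies directly.
\<close>

locale subring_of_field =
  fixes R :: "'a::field set"
  assumes zero_mem [simp, intro]: "0 \<in> R"
    and one_mem [simp, intro]: "1 \<in> R"
    and add_mem [intro]: "x \<in> R \<Longrightarrow> y \<in> R \<Longrightarrow> x + y \<in> R"
    and uminus_mem [intro]: "x \<in> R \<Longrightarrow> - x \<in> R"
    and mult_mem [intro]: "x \<in> R \<Longrightarrow> y \<in> R \<Longrightarrow> x * y \<in> R"
begin

lemma diff_mem [intro]: "x \<in> R \<Longrightarrow> y \<in> R \<Longrightarrow> x - y \<in> R"
  using add_mem[of x "- y"] uminus_mem[of y] by simp

lemma power_mem [intro]: "x \<in> R \<Longrightarrow> x ^ n \<in> R"
  by (induction n) auto

lemma sum_mem [intro]: "(\<And>i. i \<in> A \<Longrightarrow> f i \<in> R) \<Longrightarrow> sum f A \<in> R"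
  by (induction A rule: infinite_finite_induct) auto

end

section \<open>Integrality\<close>

lemma finite_range_coeff: "finite (range (poly.coeff p))"
proof (rule finite_subset)
  show "range (poly.coeff p) \<subseteq> insert 0 (poly.coeff p ` {..degree p})"
    by (auto simp: image_iff not_le intro!: coeff_eq_0)
qed auto

text \<open>
  Meant for finite \<open>B\<close>: sums over infinite sets are 0.
\<close>

definition rspan :: "'a::field set \<Rightarrow> 'a set \<Rightarrow> 'a set" where
  "rspan R B = {(\<Sum>b\<in>B. r b * b) | r. \<forall>b\<in>B. r b \<in> R}"

text \<open>
  The elements that map the span of \<open>B\<close> into itself. Integral elements are exactly those
  that occur in such a stabilizer for a finite \<open>B\<close> containing 1, and a stabilizer is a
  ring, so that closure properties of integrality become statements about finite generating sets.
\<close>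

definition stabilizer :: "'a::field set \<Rightarrow> 'a set \<Rightarrow> 'a set" where
  "stabilizer R B = {y. \<forall>b\<in>B. y * b \<in> rspan R B}"

context subring_of_field
begin

definition polys :: "'a poly set" where
  "polys = {p. \<forall>i. poly.coeff p i \<in> R}"

lemma polys_sum: "(\<And>i. i \<in> A \<Longrightarrow> f i \<in> polys) \<Longrightarrow> sum f A \<in> polys"
  by (auto simp: polys_def coeff_sum)

lemma polys_mult: "p \<in> polys \<Longrightarrow> q \<in> polys \<Longrightarrow> p * q \<in> polys"
  by (auto simp: polys_def coeff_mult)

lemma polys_prod: "(\<And>i. i \<in> A \<Longrightarrow> f i \<in> polys) \<Longrightarrow> prod f A \<in> polys"
proof (induction A rule: infinite_finite_induct)
  case (insert x F) then show ?case by (auto intro: polys_mult)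
qed (auto simp: polys_def coeff_1)

text \<open>
  The determinant is a sum of signed products of entries.
\<close>

lemma char_poly_in_polys:
  assumes A: "A \<in> carrier_mat n n" and AR: "\<And>i j. i < n \<Longrightarrow> j < n \<Longrightarrow> A $$ (i, j) \<in> R"
  shows "char_poly A \<in> polys"
proof -
  have entry: "char_poly_matrix A $$ (i, j) \<in> polys" if "i < n" "j < n" for i j
    using A that AR[OF that] unfolding char_poly_matrix_def
    by (auto simp: polys_def coeff_pCons split: nat.splits)
  have dims: "dim_row (char_poly_matrix A) = n" "dim_col (char_poly_matrix A) = n"
    using A by (auto simp: char_poly_matrix_def)
  show ?thesis
    unfolding char_poly_def Determinant.det_def dims
  proof (simp, intro polys_sum polys_mult polys_prod)
    fix p :: "nat \<Rightarrow> nat"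
    show "of_int (sign p) \<in> polys"
      by (auto simp: polys_def sign_def coeff_1 uminus_mem)
    fix i assume "p \<in> {p. p permutes {0..<n}}" "i \<in> {0..<n}"
    then show "char_poly_matrix A $$ (i, p i) \<in> polys"
      using permutes_in_image[of p "{0..<n}" i] by (intro entry) auto
  qed
qed

text \<open>
  Multiplication by \<open>x\<close> on the span of \<open>B\<close> is described by a matrix over
  \<open>R\<close> that has the vector of the elements of \<open>B\<close> as an eigenvector for
  \<open>x\<close>. So \<open>x\<close> is a root of its characteristic polynomial, which is monic.
\<close>

lemma integral_of_stabilizer:
  assumes "finite B" "b0 \<in> B" "b0 \<noteq> 0" "x \<in> stabilizer R B"
  shows "integral_over R x"
proof -
  obtain n e where e: "bij_betw e {0..<n::nat} B"
    using ex_bij_betw_nat_finite[OF \<open>finite B\<close>] by blast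
  have "\<forall>b\<in>B. \<exists>r. (\<forall>b'\<in>B. r b' \<in> R) \<and> x * b = (\<Sum>b'\<in>B. r b' * b')"
    using assms(4) by (auto simp: stabilizer_def rspan_def)
  then obtain r where r: "\<And>b b'. b \<in> B \<Longrightarrow> b' \<in> B \<Longrightarrow> r b b' \<in> R"
    and x: "\<And>b. b \<in> B \<Longrightarrow> x * b = (\<Sum>b'\<in>B. r b b' * b')" by metis
  define A where "A = Matrix.mat n n (\<lambda>(i, j). r (e i) (e j))"
  define v where "v = Matrix.vec n e"
  have eB: "e i \<in> B" if "i < n" for i using e that by (auto simp: bij_betw_def)
  have A: "A \<in> carrier_mat n n" by (simp add: A_def)
  obtain i0 where i0: "i0 < n" "e i0 = b0"
    using e assms(2) unfolding bij_betw_def by (metis atLeastLessThan_iff image_iff)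
  have "eigenvector A v x"
    unfolding eigenvector_def
  proof (intro conjI)
    show "v \<in> carrier_vec (dim_row A)" using A by (simp add: v_def)
    have "vec_index v i0 \<noteq> 0" using i0 assms(3) by (simp add: v_def)
    then show "v \<noteq> 0\<^sub>v (dim_row A)" using i0 A by auto
    show "A *\<^sub>v v = x \<cdot>\<^sub>v v"
    proof (rule eq_vecI)
      fix i assume "i < dim_vec (x \<cdot>\<^sub>v v)"
      then have i: "i < n" by (simp add: v_def)
      have "vec_index (A *\<^sub>v v) i = (\<Sum>j = 0..<n. r (e i) (e j) * e j)"
        using i by (simp add: A_def v_def scalar_prod_def)
      also have "\<dots> = x * e i"
        using x[OF eB[OF i]] sum.reindex_bij_betw[OF e, of "\<lambda>b. r (e i) b * b"] by simp
      finally show "vec_index (A *\<^sub>v v) i = vec_index (x \<cdot>\<^sub>v v) i" using i by (simp add: v_def)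
    qed (use A in \<open>simp_all add: v_def\<close>)
  qed
  then have "poly (char_poly A) x = 0"
    using eigenvalue_root_char_poly[OF A] by (auto simp: eigenvalue_def)
  moreover have "char_poly A \<in> polys"
    using A r eB by (intro char_poly_in_polys[OF A]) (auto simp: A_def)
  moreover have "lead_coeff (char_poly A) = 1"
    using degree_monic_char_poly[OF A] by simp
  ultimately show ?thesis
    by (auto simp: integral_over_def polys_def)
qed

lemma rspan_zero: "0 \<in> rspan R B"
  unfolding rspan_def by (auto intro!: exI[of _ "\<lambda>_. 0"])

lemma rspan_add: "x \<in> rspan R B \<Longrightarrow> y \<in> rspan R B \<Longrightarrow> x + y \<in> rspan R B"
  unfolding rspan_def
  by clarify (rule_tac x = "\<lambda>b. r b + ra b" in exI, auto simp: sum.distrib distrib_right)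

lemma rspan_scale: "x \<in> rspan R B \<Longrightarrow> r \<in> R \<Longrightarrow> r * x \<in> rspan R B"
  unfolding rspan_def
  by clarify (rule_tac x = "\<lambda>b. r * ra b" in exI, auto simp: sum_distrib_left mult.assoc)

lemma rspan_sum: "(\<And>i. i \<in> A \<Longrightarrow> f i \<in> rspan R B) \<Longrightarrow> sum f A \<in> rspan R B"
  by (induction A rule: infinite_finite_induct) (auto intro: rspan_zero rspan_add)

lemma rspan_base: "finite B \<Longrightarrow> b \<in> B \<Longrightarrow> b \<in> rspan R B"
  unfolding rspan_def
  by (auto intro!: exI[of _ "\<lambda>b'. if b' = b then 1 else 0"] simp: if_distrib[of "\<lambda>z. z * _"] cong: if_cong)

lemma rspan_mult_into:
  assumes "x \<in> rspan R B" "\<And>b. b \<in> B \<Longrightarrow> z * b \<in> rspan R B'"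
  shows "z * x \<in> rspan R B'"
proof -
  obtain r where r: "\<forall>b\<in>B. r b \<in> R" "x = (\<Sum>b\<in>B. r b * b)"
    using assms(1) by (auto simp: rspan_def)
  have "z * x = (\<Sum>b\<in>B. r b * (z * b))"
    by (simp add: r sum_distrib_left mult_ac)
  also have "\<dots> \<in> rspan R B'"
  proof (rule rspan_sum)
    fix b assume "b \<in> B"
    then show "r b * (z * b) \<in> rspan R B'" using r assms(2) by (intro rspan_scale[of "z * b"]) auto
  qed
  finally show ?thesis .
qed

lemma subring_stabilizer:
  assumes "finite B"
  shows "subring_of_field (stabilizer R B)" "R \<subseteq> stabilizer R B"
proof -
  show "R \<subseteq> stabilizer R B"
    using assms by (auto simp: stabilizer_def intro: rspan_scale rspan_base)
  then show "subring_of_field (stabilizer R B)"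
  proof unfold_locales
    fix x y assume xy: "x \<in> stabilizer R B" "y \<in> stabilizer R B"
    show "x + y \<in> stabilizer R B"
      using xy by (auto simp: stabilizer_def distrib_right intro: rspan_add)
    show "x * y \<in> stabilizer R B"
      using xy by (auto simp: stabilizer_def mult.assoc intro: rspan_mult_into)
  next
    fix x assume "x \<in> stabilizer R B"
    then show "- x \<in> stabilizer R B"
      using rspan_scale[of "x * _" B "-1"] by (auto simp: stabilizer_def)
  qed auto
qed

text \<open>
  If \<open>x\<close> has an equation of degree \<open>n\<close>, the products of the elements of
  \<open>B\<close> with \<open>1, x, \<dots>, x^(n - 1)\<close> span a module stable under
  \<open>x\<close>. Its coefficients need only stabilize the span of \<open>B\<close>; with
  coefficients in \<open>R\<close> this yields sums and products of integral elements, with integral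
  coefficients the transitivity of integrality.
\<close>

lemma stabilizer_adjoin_integral:
  assumes B: "finite B" "1 \<in> B" and x: "integral_over (stabilizer R B) x"
  obtains B' where "finite B'" "1 \<in> B'" "stabilizer R B \<subseteq> stabilizer R B'" "x \<in> stabilizer R B'"
proof -
  obtain p where p: "lead_coeff p = 1" "\<And>i. poly.coeff p i \<in> stabilizer R B" "poly p x = 0"
    using x by (auto simp: integral_over_def)
  define n where "n = degree p"
  have n: "n > 0"
  proof (rule ccontr)
    assume "\<not> n > 0"
    then have "p = [:1:]" using p(1) n_def degree_0_id[of p] by simp
    then show False using p(3) by simp
  qed
  define B' where "B' = (\<lambda>(i, b). x ^ i * b) ` ({..<n} \<times> B)"
  have fin: "finite B'" using B by (simp add: B'_def)
  have base: "x ^ i * b \<in> rspan R B'" if "i < n" "b \<in> B" for i b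
    using that by (intro rspan_base[OF fin]) (auto simp: B'_def)
  have pow: "x ^ i * y \<in> rspan R B'" if "i < n" "y \<in> rspan R B" for i y
    using that base by (intro rspan_mult_into[of y B]) auto
  have "stabilizer R B \<subseteq> stabilizer R B'"
  proof
    fix s assume s: "s \<in> stabilizer R B"
    have "s * (x ^ i * b) \<in> rspan R B'" if "i < n" "b \<in> B" for i b
      using pow[OF that(1), of "s * b"] s that by (simp add: stabilizer_def mult_ac)
    then show "s \<in> stabilizer R B'" by (auto simp: stabilizer_def B'_def)
  qed
  moreover have "x \<in> stabilizer R B'"
  proof -
    have "x * (x ^ i * b) \<in> rspan R B'" if ib: "i < n" "b \<in> B" for i b
    proof (cases "Suc i < n")
      case True
      then show ?thesis using base[OF True ib(2)] by (simp add: mult_ac)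
    next
      case False
      then have i: "Suc i = n" using ib by simp
      have "0 = (\<Sum>j\<le>n. poly.coeff p j * x ^ j)" using p(3) by (simp add: poly_altdef n_def)
      also have "\<dots> = x ^ n + (\<Sum>j<n. poly.coeff p j * x ^ j)"
        using p(1) by (simp add: lessThan_Suc_atMost[symmetric] n_def)
      finally have "x ^ n = - (\<Sum>j<n. poly.coeff p j * x ^ j)" by (simp add: eq_neg_iff_add_eq_0)
      then have "x ^ n * b = - (\<Sum>j<n. poly.coeff p j * x ^ j) * b" by simp
      also have "\<dots> = (\<Sum>j<n. (-1) * (x ^ j * (poly.coeff p j * b)))"
        by (simp add: sum_distrib_left sum_distrib_right sum_negf mult_ac)
      also have "\<dots> \<in> rspan R B'"
      proof (rule rspan_sum)
        fix j assume "j \<in> {..<n}"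
        moreover have "poly.coeff p j * b \<in> rspan R B" using p(2) ib(2) by (auto simp: stabilizer_def)
        ultimately show "(-1) * (x ^ j * (poly.coeff p j * b)) \<in> rspan R B'"
          by (intro rspan_scale[of "x ^ j * _"] pow) auto
      qed
      finally show ?thesis using i by (simp flip: mult.assoc power_Suc)
    qed
    then show ?thesis by (auto simp: stabilizer_def B'_def)
  qed
  moreover have "1 \<in> B'" using n B(2) by (auto simp: B'_def intro!: image_eqI[of _ _ "(0, 1)"])
  ultimately show ?thesis using that fin by blast
qed

lemma integral_over_mono: "integral_over S x \<Longrightarrow> S \<subseteq> T \<Longrightarrow> integral_over T x"
  unfolding integral_over_def by blast

lemma finite_integral_stabilizer:
  assumes "finite F" "F \<subseteq> integral_closure R"
  shows "\<exists>B. finite B \<and> 1 \<in> B \<and> F \<subseteq> stabilizer R B"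
  using assms
proof (induction F rule: finite_induct)
  case empty
  show ?case by (rule exI[of _ "{1}"]) auto
next
  case (insert x F)
  then obtain B where B: "finite B" "1 \<in> B" "F \<subseteq> stabilizer R B" by auto
  have "integral_over (stabilizer R B) x"
    using insert.prems subring_stabilizer(2)[OF B(1)]
    by (auto simp: integral_closure_def intro: integral_over_mono)
  from stabilizer_adjoin_integral[OF B(1,2) this] B(3) show ?case
    by (metis insert_subset subset_trans)
qed

lemma stabilizer_integral:
  assumes "finite B" "1 \<in> B" "x \<in> stabilizer R B"
  shows "x \<in> integral_closure R"
  using integral_of_stabilizer[OF assms(1,2) _ assms(3)] by (simp add: integral_closure_def)

lemma base_subset_integral_closure: "R \<subseteq> integral_closure R"
  using stabilizer_integral[of "{1}"] subring_stabilizer(2)[of "{1}"] by auto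

lemma subring_integral_closure: "subring_of_field (integral_closure R)"
proof
  show "0 \<in> integral_closure R" "1 \<in> integral_closure R"
    using base_subset_integral_closure by auto
next
  fix x y assume "x \<in> integral_closure R" "y \<in> integral_closure R"
  then obtain B where B: "finite B" "1 \<in> B" "{x, y} \<subseteq> stabilizer R B"
    using finite_integral_stabilizer[of "{x, y}"] by auto
  interpret S: subring_of_field "stabilizer R B" by (rule subring_stabilizer[OF B(1)])
  show "x + y \<in> integral_closure R" "x * y \<in> integral_closure R"
    using B by (auto intro!: stabilizer_integral[OF B(1,2)])
next
  fix x assume "x \<in> integral_closure R"
  then obtain B where B: "finite B" "1 \<in> B" "{x} \<subseteq> stabilizer R B"
    using finite_integral_stabilizer[of "{x}"] by auto
  interpret S: subring_of_field "stabilizer R B" by (rule subring_stabilizer[OF B(1)])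
  show "- x \<in> integral_closure R"
    using B by (auto intro!: stabilizer_integral[OF B(1,2)])
qed

lemma integral_closure_idem:
  assumes "integral_over (integral_closure R) x"
  shows "x \<in> integral_closure R"
proof -
  obtain p where p: "lead_coeff p = 1" "\<And>i. poly.coeff p i \<in> integral_closure R" "poly p x = 0"
    using assms by (auto simp: integral_over_def)
  have "finite (range (poly.coeff p))"
  by (rule finite_range_coeff)
  then obtain B where B: "finite B" "1 \<in> B" "range (poly.coeff p) \<subseteq> stabilizer R B"
    using finite_integral_stabilizer[of "range (poly.coeff p)"] p(2) by auto
  have "integral_over (stabilizer R B) x"
    using p B(3) by (auto simp: integral_over_def intro!: exI[of _ p])
  then show ?thesis
    using stabilizer_adjoin_integral[OF B(1,2)] stabilizer_integral by metis
qed

end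

section \<open>Ideals of subrings of a field\<close>

lemma ring_on_simps [simp]:
  "carrier (ring_on S) = S" "\<one>\<^bsub>ring_on S\<^esub> = 1" "\<zero>\<^bsub>ring_on S\<^esub> = 0"
  "x \<otimes>\<^bsub>ring_on S\<^esub> y = x * y" "x \<oplus>\<^bsub>ring_on S\<^esub> y = x + y"
  by (simp_all add: ring_on_def)

context subring_of_field
begin

lemma cring_ring_on: "Ring.cring (ring_on R)"
proof (rule cringI)
  show "abelian_group (ring_on R)"
  proof (rule abelian_groupI)
    fix x assume "x \<in> carrier (ring_on R)"
    then show "\<exists>y\<in>carrier (ring_on R). y \<oplus>\<^bsub>ring_on R\<^esub> x = \<zero>\<^bsub>ring_on R\<^esub>"
      by (auto intro!: bexI[of _ "- x"])
  qed (auto simp: algebra_simps)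
qed (auto intro!: comm_monoidI simp: algebra_simps)

end

lemma subring_of_field_UNIV: "subring_of_field UNIV"
  by unfold_locales auto

lemma subring_ambient_imp:
  assumes "subring R ambient"
  shows "subring_of_field R"
proof -
  interpret A: cring ambient
    by (rule subring_of_field.cring_ring_on[OF subring_of_field_UNIV])
  have um: "\<ominus>\<^bsub>ambient\<^esub> x = - x" for x
    by (rule A.minus_equality) auto
  note E = subringE[OF assms]
  show ?thesis
  proof
    show "0 \<in> R" "1 \<in> R" using E(2,3) by simp_all
    show "x + y \<in> R" "x * y \<in> R" if "x \<in> R" "y \<in> R" for x y
      using E(6)[of x y] E(7)[of x y] that by simp_all
    show "- x \<in> R" if "x \<in> R" for x using E(5)[OF that] by (simp only: um)
  qed
qed

context subring_of_field
begin

lemma ideal_iff: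
  "ideal I (ring_on R) \<longleftrightarrow>
     I \<subseteq> R \<and> 0 \<in> I \<and> (\<forall>x\<in>I. \<forall>y\<in>I. x + y \<in> I) \<and> (\<forall>r\<in>R. \<forall>x\<in>I. r * x \<in> I)" (is "?l \<longleftrightarrow> ?r")
proof
  assume ?l
  then interpret I: ideal I "ring_on R" .
  show ?r
    using I.a_subset additive_subgroup.zero_closed[OF I.is_additive_subgroup]
      additive_subgroup.a_closed[OF I.is_additive_subgroup] I.I_l_closed
    by (simp add: subset_iff)
next
  assume r: ?r
  interpret C: cring "ring_on R" by (rule cring_ring_on)
  show ?l
  proof (rule idealI)
    show "Ring.ring (ring_on R)" by (rule C.ring_axioms)
    have inv: "\<ominus>\<^bsub>ring_on R\<^esub> x = - x" if "x \<in> R" for x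
      by (rule C.minus_equality) (use that in auto)
    have neg: "- x \<in> I" if "x \<in> I" for x
      using r that uminus_mem[OF one_mem] by (metis mult_minus1)
    show "subgroup I (add_monoid (ring_on R))"
    proof (rule subgroup.intro)
      show "inv\<^bsub>add_monoid (ring_on R)\<^esub> x \<in> I" if "x \<in> I" for x
        using inv[of x] neg[OF that] that r by (auto simp: a_inv_def)
    qed (use r in auto)
    show "x \<otimes>\<^bsub>ring_on R\<^esub> a \<in> I" "a \<otimes>\<^bsub>ring_on R\<^esub> x \<in> I" if "a \<in> I" "x \<in> carrier (ring_on R)" for a x
      using r that by (simp_all add: mult.commute[of a x])
  qed
qed

lemma ideal_uminus:
  assumes "ideal I (ring_on R)" "x \<in> I"
  shows "- x \<in> I"
  using assms uminus_mem[OF one_mem] by (metis ideal_iff mult_minus1)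

lemma ideal_diff:
  assumes "ideal I (ring_on R)" "x \<in> I" "y \<in> I"
  shows "x - y \<in> I"
  using ideal_uminus[OF assms(1,3)] assms by (metis diff_conv_add_uminus ideal_iff)

lemma ideal_eq_carrier_iff:
  assumes "ideal I (ring_on R)"
  shows "I = R \<longleftrightarrow> 1 \<in> I"
  using assms by (auto simp: ideal_iff) (metis mult.right_neutral)

lemma prime_iff:
  "primeideal P (ring_on R) \<longleftrightarrow>
     ideal P (ring_on R) \<and> 1 \<notin> P \<and> (\<forall>x\<in>R. \<forall>y\<in>R. x * y \<in> P \<longrightarrow> x \<in> P \<or> y \<in> P)" (is "?l \<longleftrightarrow> ?r")
proof
  assume l: ?l
  then interpret P: primeideal P "ring_on R" .
  show ?r
    using P.ideal_axioms P.I_prime P.I_notcarr ideal_eq_carrier_iff[OF P.ideal_axioms] by auto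
next
  assume ?r
  then show ?l
    using ideal_eq_carrier_iff[of P] by (intro primeidealI cring_ring_on) auto
qed

lemma ideal_adjoin:
  assumes "ideal P (ring_on R)" "x \<in> R"
  shows "ideal {p + r * x | p r. p \<in> P \<and> r \<in> R} (ring_on R)" (is "ideal ?J _")
proof -
  have P: "P \<subseteq> R" "0 \<in> P" "\<And>x y. x \<in> P \<Longrightarrow> y \<in> P \<Longrightarrow> x + y \<in> P"
    "\<And>r x. r \<in> R \<Longrightarrow> x \<in> P \<Longrightarrow> r * x \<in> P"
    using assms(1) by (auto simp: ideal_iff)
  show ?thesis
    unfolding ideal_iff
  proof (intro conjI ballI)
    show "?J \<subseteq> R" using P assms(2) by auto
    show "0 \<in> ?J" using P by force
    show "a + b \<in> ?J" if ab: "a \<in> ?J" "b \<in> ?J" for a b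
    proof -
      from ab obtain p r p' r' where "p \<in> P" "p' \<in> P" "r \<in> R" "r' \<in> R" "a = p + r * x" "b = p' + r' * x"
        by blast
      then have "a + b = (p + p') + (r + r') * x" "p + p' \<in> P" "r + r' \<in> R"
        using P by (auto simp: algebra_simps)
      then show ?thesis by blast
    qed
    show "s * a \<in> ?J" if sa: "s \<in> R" "a \<in> ?J" for s a
    proof -
      from sa obtain p r where "p \<in> P" "r \<in> R" "a = p + r * x" by blast
      then have "s * a = s * p + (s * r) * x" by (simp add: algebra_simps)
      moreover have "s * p \<in> P \<and> s * r \<in> R" using P sa \<open>p \<in> P\<close> \<open>r \<in> R\<close> by auto
      ultimately show ?thesis by blast
    qed
  qed
qed

lemma ideal_adjoin_supset:
  assumes "ideal P (ring_on R)"
  shows "P \<subseteq> {p + r * x | p r. p \<in> P \<and> r \<in> R}" "x \<in> {p + r * x | p r. p \<in> P \<and> r \<in> R}"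
proof -
  show "P \<subseteq> {p + r * x | p r. p \<in> P \<and> r \<in> R}"
  proof
    fix y assume "y \<in> P"
    moreover have "y = y + 0 * x" by simp
    ultimately show "y \<in> {p + r * x | p r. p \<in> P \<and> r \<in> R}" by blast
  qed
  have "x = 0 + 1 * x" by simp
  then show "x \<in> {p + r * x | p r. p \<in> P \<and> r \<in> R}" using assms unfolding ideal_iff by blast
qed

text \<open>
  Maximality as invertibility modulo \<open>P\<close>.
\<close>

lemma maximal_iff:
  "maximalideal P (ring_on R) \<longleftrightarrow>
     ideal P (ring_on R) \<and> 1 \<notin> P \<and> (\<forall>x\<in>R - P. \<exists>r\<in>R. 1 - r * x \<in> P)" (is "?l \<longleftrightarrow> ?r")
proof
  assume l: ?l
  then interpret P: maximalideal P "ring_on R" .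
  have id: "ideal P (ring_on R)" by (rule P.ideal_axioms)
  show ?r
  proof (intro conjI ballI id)
    show "1 \<notin> P" using P.I_notcarr ideal_eq_carrier_iff[OF id] by auto
    fix x assume x: "x \<in> R - P"
    define J where "J = {p + r * x | p r. p \<in> P \<and> r \<in> R}"
    have J: "ideal J (ring_on R)" using ideal_adjoin[OF id, of x] x by (auto simp: J_def)
    have "P \<subseteq> J" "x \<in> J" using ideal_adjoin_supset[OF id, of x] by (auto simp: J_def)
    with P.I_maximal[OF J] x J have "J = R" by (auto simp: ideal_iff)
    then have "1 \<in> J" by simp
    then obtain p r where "p \<in> P" "r \<in> R" "1 = p + r * x" unfolding J_def by blast
    then show "\<exists>r\<in>R. 1 - r * x \<in> P" by (metis add_diff_cancel_right')
  qed
next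
  assume r: ?r
  show ?l
  proof (rule maximalidealI)
    show "ideal P (ring_on R)" using r by simp
    then show "carrier (ring_on R) \<noteq> P" using ideal_eq_carrier_iff[of P] r by auto
    fix J assume J: "ideal J (ring_on R)" "P \<subseteq> J" "J \<subseteq> carrier (ring_on R)"
    show "J = P \<or> J = carrier (ring_on R)"
    proof (rule disjCI)
      assume "J \<noteq> carrier (ring_on R)"
      then have 1: "1 \<notin> J" using ideal_eq_carrier_iff[OF J(1)] by simp
      show "J = P"
      proof (rule ccontr)
        assume "J \<noteq> P"
        then obtain x where x: "x \<in> J" "x \<notin> P" "x \<in> R" using J by auto
        then obtain s where s: "s \<in> R" "1 - s * x \<in> P" using r by blast
        have "(1 - s * x) + s * x \<in> J" using s x J unfolding ideal_iff by blast
        with 1 show False by simp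
      qed
    qed
  qed
qed

lemma maximal_imp_prime: "maximalideal P (ring_on R) \<Longrightarrow> primeideal P (ring_on R)"
  using cring.maximalideal_prime[OF cring_ring_on] .

lemma ideal_Union_chain:
  assumes C: "C \<noteq> {}" "subset.chain {I. ideal I (ring_on R)} C"
  shows "ideal (\<Union>C) (ring_on R)"
proof -
  have id: "I \<in> C \<Longrightarrow> ideal I (ring_on R)" for I using C by (auto simp: subset.chain_def)
  have lin: "I \<in> C \<Longrightarrow> J \<in> C \<Longrightarrow> I \<subseteq> J \<or> J \<subseteq> I" for I J
    using C by (auto simp: subset_chain_def)
  show ?thesis
    unfolding ideal_iff
  proof (intro conjI ballI)
    show "\<Union>C \<subseteq> R" using id unfolding ideal_iff by blast
    show "0 \<in> \<Union>C" using id C(1) unfolding ideal_iff by blast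
    show "x + y \<in> \<Union>C" if xy: "x \<in> \<Union>C" "y \<in> \<Union>C" for x y
    proof -
      from xy obtain I J where IJ: "I \<in> C" "J \<in> C" "x \<in> I" "y \<in> J" by auto
      then have "{x, y} \<subseteq> I \<or> {x, y} \<subseteq> J" using lin[OF IJ(1,2)] by auto
      then show ?thesis using IJ(1,2) id[of I] id[of J] unfolding ideal_iff by blast
    qed
    show "r * x \<in> \<Union>C" if "r \<in> R" "x \<in> \<Union>C" for r x
      using that id unfolding ideal_iff by blast
  qed
qed

lemma exists_maximal_ideal:
  assumes "ideal J (ring_on R)" "1 \<notin> J"
  obtains P where "maximalideal P (ring_on R)" "J \<subseteq> P"
proof -
  define S where "S = {I. ideal I (ring_on R) \<and> J \<subseteq> I \<and> 1 \<notin> I}"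
  have "\<exists>M\<in>S. \<forall>X\<in>S. M \<subseteq> X \<longrightarrow> X = M"
  proof (rule subset_Zorn_nonempty)
    show "S \<noteq> {}" using assms by (auto simp: S_def)
    fix C assume C: "C \<noteq> {}" "subset.chain S C"
    then have "subset.chain {I. ideal I (ring_on R)} C" by (auto simp: subset_chain_def S_def)
    from ideal_Union_chain[OF C(1) this] C show "\<Union>C \<in> S"
      by (auto simp: S_def subset_chain_def)
  qed
  then obtain M where M: "M \<in> S" "\<And>X. X \<in> S \<Longrightarrow> M \<subseteq> X \<Longrightarrow> X = M" by blast
  have "maximalideal M (ring_on R)"
  proof (rule maximalidealI)
    show "ideal M (ring_on R)" "carrier (ring_on R) \<noteq> M" using M(1) by (auto simp: S_def)
    fix X assume "ideal X (ring_on R)" "M \<subseteq> X" "X \<subseteq> carrier (ring_on R)"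
    then show "X = M \<or> X = carrier (ring_on R)"
      using M(1) M(2)[of X] ideal_eq_carrier_iff[of X] by (cases "1 \<in> X") (auto simp: S_def)
  qed
  then show thesis using that M(1) by (auto simp: S_def)
qed

lemma subring_localization:
  assumes "primeideal P (ring_on R)"
  shows "subring_of_field (localization R P)"
proof
  have P: "1 \<notin> P" "0 \<in> P" "\<And>x y. x \<in> R \<Longrightarrow> y \<in> R \<Longrightarrow> x * y \<in> P \<Longrightarrow> x \<in> P \<or> y \<in> P"
    using assms by (auto simp: prime_iff ideal_iff)
  show "0 \<in> localization R P"
    unfolding localization_def using P by (intro CollectI exI[of _ 0] exI[of _ 1]) auto
  show "1 \<in> localization R P"
    unfolding localization_def using P by (intro CollectI exI[of _ 1]) auto
  fix x assume "x \<in> localization R P"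
  then obtain a s where x: "a \<in> R" "s \<in> R - P" "x = a / s" by (auto simp: localization_def)
  show "- x \<in> localization R P"
    unfolding localization_def using x by (intro CollectI exI[of _ "- a"] exI[of _ s]) auto
  fix y assume "y \<in> localization R P"
  then obtain b t where y: "b \<in> R" "t \<in> R - P" "y = b / t" by (auto simp: localization_def)
  have "s \<noteq> 0" "t \<noteq> 0" "s * t \<in> R - P" using x y P by auto
  then have "x + y = (a * t + b * s) / (s * t)" "x * y = (a * b) / (s * t)"
    "a * t + b * s \<in> R" "a * b \<in> R" using x y by (auto simp: field_simps)
  then show "x + y \<in> localization R P" "x * y \<in> localization R P"
    unfolding localization_def using \<open>s * t \<in> R - P\<close> by blast+
qed

lemma subset_localization:
  assumes "primeideal P (ring_on R)"
  shows "R \<subseteq> localization R P"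
proof
  fix x assume "x \<in> R"
  moreover have "x = x / 1" "1 \<in> R - P" using assms by (auto simp: prime_iff)
  ultimately show "x \<in> localization R P" unfolding localization_def by blast
qed

end

section \<open>Valuation rings with rational value group\<close>

text \<open>
  A valuation ring \<open>V\<close> in which every non-zero \<open>x\<close> is, up to roots and
  units, a power of one element \<open>c\<close> outside \<open>V\<close>. The value of
  \<open>x\<close> is then forced by the value of \<open>c\<close>: with the normalization
  \<open>v c = - 1\<close>, it is \<open>m / n\<close> if \<open>x ^ n * c powi m\<close> is a unit.
\<close>

locale rational_valuation_ring = subring_of_field V for V :: "'a::field set" +
  fixes c :: 'a
  assumes total: "x \<in> V \<or> inverse x \<in> V"
    and c_nonzero: "c \<noteq> 0" and c_notin: "c \<notin> V"
    and rational: "x \<noteq> 0 \<Longrightarrow> \<exists>n m. n > (0::nat) \<and> x ^ n * c powi m \<in> V \<and> inverse (x ^ n * c powi m) \<in> V"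
begin

definition unit_grp :: "'a set" where
  "unit_grp = {x. x \<noteq> 0 \<and> x \<in> V \<and> inverse x \<in> V}"

lemma unit_mult: "x \<in> unit_grp \<Longrightarrow> y \<in> unit_grp \<Longrightarrow> x * y \<in> unit_grp"
  by (auto simp: unit_grp_def)

lemma unit_inverse: "x \<in> unit_grp \<Longrightarrow> inverse x \<in> unit_grp"
  by (auto simp: unit_grp_def)

lemma unit_power: "x \<in> unit_grp \<Longrightarrow> x ^ n \<in> unit_grp"
  by (induction n) (auto simp: unit_mult, auto simp: unit_grp_def)

text \<open>
  If \<open>x\<close> is not in \<open>V\<close>, then its inverse is, and \<open>x\<close> is
  \<open>x ^ n\<close> times a power of this inverse.
\<close>

lemma root_closed:
  assumes "n > 0" "x ^ n \<in> V"
  shows "x \<in> V"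
proof (rule ccontr)
  assume x: "x \<notin> V"
  then have ix: "inverse x \<in> V" "x \<noteq> 0" using total by auto
  have "x ^ n * inverse x ^ (n - 1) \<in> V" using assms ix by blast
  also have "x ^ n * inverse x ^ (n - 1) = x"
    using assms(1) ix(2) by (cases n) (auto simp: power_inverse field_simps)
  finally show False using x by simp
qed

lemma c_powi_unit:
  assumes "c powi k \<in> unit_grp"
  shows "k = 0"
proof -
  have no: "c powi int n \<notin> V" if "n > 0" for n
    using root_closed[OF that] c_notin by (auto simp: power_int_def)
  show ?thesis
  proof (rule ccontr)
    assume "k \<noteq> 0"
    then consider n where "n > 0" "k = int n" | n where "n > 0" "k = - int n"
      by (metis int_cases2 of_nat_0 of_nat_0_less_iff neg_equal_0_iff_equal bot_nat_0.not_eq_extremum)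
    then show False
    proof cases
      case 1 then show False using no assms by (auto simp: unit_grp_def)
    next
      case 2 then show False
        using no[OF 2(1)] assms by (auto simp: unit_grp_def power_int_minus)
    qed
  qed
qed

definition is_value :: "'a \<Rightarrow> real \<Rightarrow> bool" where
  "is_value x q \<longleftrightarrow> (\<exists>n m. n > (0::nat) \<and> q = of_int m / of_nat n \<and> x ^ n * c powi m \<in> unit_grp)"

lemma is_value_unique:
  assumes "x \<noteq> 0" "is_value x q" "is_value x q'"
  shows "q = q'"
proof -
  obtain n m n' m' where
    *: "n > (0::nat)" "q = of_int m / of_nat n" "x ^ n * c powi m \<in> unit_grp"
       "n' > (0::nat)" "q' = of_int m' / of_nat n'" "x ^ n' * c powi m' \<in> unit_grp"
    using assms by (auto simp: is_value_def)
  have "(x ^ n * c powi m) ^ n' * inverse ((x ^ n' * c powi m') ^ n) \<in> unit_grp"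
    using * by (meson unit_mult unit_power unit_inverse)
  also have "(x ^ n * c powi m) ^ n' * inverse ((x ^ n' * c powi m') ^ n)
      = c powi (m * int n' - m' * int n)"
    using assms(1) c_nonzero
    by (simp add: power_mult_distrib power_int_diff power_int_mult field_simps flip: power_mult)
  finally have "m * int n' = m' * int n" using c_powi_unit by fastforce
  then have "of_int m * real n' = of_int m' * real n" by (metis of_int_mult of_int_of_nat_eq)
  then show ?thesis using *(1,2,4,5) by (simp add: frac_eq_eq)
qed

definition v :: "'a \<Rightarrow> real" where "v x = (THE q. is_value x q)"

lemma v_eqI: "x \<noteq> 0 \<Longrightarrow> is_value x q \<Longrightarrow> v x = q"
  unfolding v_def using is_value_unique by blast

lemma is_value_v: "x \<noteq> 0 \<Longrightarrow> is_value x (v x)"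
proof -
  assume x: "x \<noteq> 0"
  obtain n m where nm: "n > (0::nat)" "x ^ n * c powi m \<in> V \<and> inverse (x ^ n * c powi m) \<in> V"
    using rational[OF x] by blast
  have "x ^ n * c powi m \<noteq> 0" using x c_nonzero by simp
  with nm have "is_value x (of_int m / of_nat n)"
    unfolding is_value_def by (intro exI[of _ n] exI[of _ m]) (simp add: unit_grp_def)
  then show ?thesis using v_eqI[OF x] by simp
qed

lemma v_mult:
  assumes "x \<noteq> 0" "y \<noteq> 0"
  shows "v (x * y) = v x + v y"
proof -
  obtain n m n' m' where
    *: "n > (0::nat)" "v x = of_int m / of_nat n" "x ^ n * c powi m \<in> unit_grp"
       "n' > (0::nat)" "v y = of_int m' / of_nat n'" "y ^ n' * c powi m' \<in> unit_grp"
    using assms is_value_v[of x] is_value_v[of y] by (auto simp: is_value_def)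
  have "(x ^ n * c powi m) ^ n' * (y ^ n' * c powi m') ^ n \<in> unit_grp"
    using * by (meson unit_mult unit_power)
  also have "(x ^ n * c powi m) ^ n' * (y ^ n' * c powi m') ^ n =
      (x * y) ^ (n * n') * c powi (m * int n' + m' * int n)"
    using assms(1) c_nonzero
    by (simp add: power_mult_distrib power_int_add power_int_mult mult_ac flip: power_mult)
  finally have "is_value (x * y) (of_int (m * int n' + m' * int n) / of_nat (n * n'))"
    unfolding is_value_def using * by (metis nat_0_less_mult_iff)
  moreover have "of_int (m * int n' + m' * int n) / of_nat (n * n') = v x + v y"
    using * by (simp add: field_simps)
  ultimately show ?thesis using v_eqI assms by simp
qed

lemma v_c: "v c = - 1"
proof (rule v_eqI[OF c_nonzero])
  have "1 \<in> unit_grp" by (simp add: unit_grp_def)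
  then show "is_value c (- 1)"
    unfolding is_value_def using c_nonzero
    by (intro exI[of _ 1] exI[of _ "-1"]) (simp add: power_int_minus)
qed

lemma v_one: "v 1 = 0"
  using v_mult[of 1 1] by simp

lemma v_power: "x \<noteq> 0 \<Longrightarrow> v (x ^ n) = n * v x"
  by (induction n) (simp_all add: v_mult v_one distrib_right)

lemma v_inverse: "x \<noteq> 0 \<Longrightarrow> v (inverse x) = - v x"
  using v_mult[of x "inverse x"] v_one by simp

lemma v_powi: "x \<noteq> 0 \<Longrightarrow> v (x powi n) = n * v x"
  by (simp add: power_int_def v_power v_inverse)

lemma v_unit: "x \<in> unit_grp \<Longrightarrow> v x = 0"
proof (rule v_eqI)
  assume x: "x \<in> unit_grp"
  then show "x \<noteq> 0" by (simp add: unit_grp_def)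
  show "is_value x 0"
    unfolding is_value_def using x by (intro exI[of _ 1] exI[of _ 0]) simp
qed

lemma inverse_c_mem: "inverse c \<in> V" using total c_notin by blast

lemma v_nonneg_iff:
  assumes "x \<noteq> 0"
  shows "0 \<le> v x \<longleftrightarrow> x \<in> V"
proof
  obtain n m where *: "n > (0::nat)" "v x = of_int m / of_nat n" "x ^ n * c powi m \<in> unit_grp"
    using is_value_v[OF assms] by (auto simp: is_value_def)
  show "x \<in> V" if "0 \<le> v x"
  proof -
    have "m \<ge> 0" using that * by (simp add: field_simps)
    then have "inverse c ^ nat m \<in> V" using inverse_c_mem by auto
    with * have "(x ^ n * c powi m) * inverse c ^ nat m \<in> V" by (auto simp: unit_grp_def)
    also have "(x ^ n * c powi m) * inverse c ^ nat m = x ^ n"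
      using \<open>m \<ge> 0\<close> c_nonzero by (simp add: power_int_def power_inverse)
    finally show ?thesis using root_closed * by blast
  qed
  show "0 \<le> v x" if x: "x \<in> V"
  proof (rule ccontr)
    assume "\<not> 0 \<le> v x"
    then have "m < 0" using * by (simp add: field_simps zero_le_divide_iff)
    then obtain k where k: "m = - int k" "k > 0" by (metis neg_int_cases)
    have "x ^ n * inverse (x ^ n * c powi m) \<in> V" using * x by (auto simp: unit_grp_def)
    also have "x ^ n * inverse (x ^ n * c powi m) = c ^ k"
      using assms by (simp add: k power_int_minus)
    finally show False using root_closed[OF k(2)] c_notin by blast
  qed
qed

text \<open>
  After division by the summand of smaller value this says that \<open>V\<close> is closed under
  addition.
\<close>

lemma v_add:
  assumes "x \<noteq> 0" "y \<noteq> 0" "x + y \<noteq> 0"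
  shows "min (v x) (v y) \<le> v (x + y)"
proof -
  have *: "v y \<le> v (x + y)" if "v y \<le> v x" "y \<noteq> 0" "x \<noteq> 0" "x + y \<noteq> 0" for x y
  proof -
    have "x * inverse y \<in> V" using that v_mult[of x "inverse y"] v_inverse[of y]
        v_nonneg_iff[of "x * inverse y"] by simp
    then have "(x + y) * inverse y \<in> V" using that(2) by (auto simp: distrib_right)
    then show ?thesis
      using that v_mult[of "x + y" "inverse y"] v_inverse[of y] v_nonneg_iff[of "(x + y) * inverse y"] by simp
  qed
  show ?thesis
    using *[of y x] *[of x y] assms by (cases "v x \<le> v y") (auto simp: add.commute min_def)
qed

lemma v_rat: "x \<noteq> 0 \<Longrightarrow> v x \<in> \<rat>"
  using is_value_v[of x] by (auto simp: is_value_def)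

definition vext :: "'a \<Rightarrow> ereal" where "vext x = (if x = 0 then \<infinity> else ereal (v x))"

lemma rat_valuation_vext: "rat_valuation vext"
  unfolding rat_valuation_def
proof (intro conjI allI impI)
  show "vext x \<in> ereal ` \<rat>" if "x \<noteq> 0" for x using v_rat that by (auto simp: vext_def)
  show "vext (x * y) = vext x + vext y" for x y by (auto simp: vext_def v_mult)
  show "min (vext x) (vext y) \<le> vext (x + y)" for x y
    using v_add[of x y] by (auto simp: vext_def min_def split: if_splits)
qed (simp add: vext_def)

lemma vext_ring: "{x. 0 \<le> vext x} = V"
  using v_nonneg_iff by (auto simp: vext_def)

text \<open>
  A valuation \<open>w\<close> with the same ring has the same units, so it is a multiple of
  \<open>v\<close>, by the factor \<open>- w c > 0\<close>. Both have integral values on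
  \<open>F\<close> and \<open>w\<close> attains 1 there, so the factor is 1.
\<close>

lemma vext_unique:
  assumes w: "rat_valuation w" "{x. 0 \<le> w x} = V" "w ` (F - {0}) = ereal ` \<int>"
    and F: "\<And>x. x \<in> F - {0} \<Longrightarrow> v x \<in> \<int>" "c \<in> F"
  shows "w = vext"
proof -
  define u where "u x = real_of_ereal (w x)" for x
  have wu: "w x = ereal (u x)" if "x \<noteq> 0" for x
    using w(1) that unfolding rat_valuation_def u_def by fastforce
  have mult: "u (x * y) = u x + u y" if "x \<noteq> 0" "y \<noteq> 0" for x y
  proof -
    have "w (x * y) = w x + w y" using w(1) by (simp add: rat_valuation_def)
    then show ?thesis using that by (simp add: wu)
  qed
  have one: "u 1 = 0" using mult[of 1 1] by simp
  have pow: "u (x ^ n) = n * u x" if "x \<noteq> 0" for x n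
    using that by (induction n) (simp_all add: mult one distrib_right)
  have inv: "u (inverse x) = - u x" if "x \<noteq> 0" for x
    using mult[of x "inverse x"] one that by simp
  have powi: "u (x powi n) = n * u x" if "x \<noteq> 0" for x n
    using that by (simp add: power_int_def pow inv)
  have nonneg: "0 \<le> u x \<longleftrightarrow> x \<in> V" if "x \<noteq> 0" for x
  proof -
    have "0 \<le> w x \<longleftrightarrow> x \<in> V" using w(2) by blast
    then show ?thesis using wu[OF that] by simp
  qed
  have scale: "u x = - u c * v x" if x: "x \<noteq> 0" for x
  proof -
    obtain n m where *: "n > (0::nat)" "v x = of_int m / of_nat n" "x ^ n * c powi m \<in> unit_grp"
      using is_value_v[OF x] by (auto simp: is_value_def)
    have nz: "x ^ n * c powi m \<noteq> 0" using x c_nonzero by simp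
    have "u (x ^ n * c powi m) = 0"
      using nonneg[OF nz] nonneg[of "inverse (x ^ n * c powi m)"] inv[OF nz] * nz
      by (simp add: unit_grp_def del: inverse_mult_distrib)
    then have "n * u x + m * u c = 0"
      using x c_nonzero by (simp add: mult pow powi)
    moreover have "of_int m = n * v x" using * by simp
    ultimately have "n * (u x + u c * v x) = 0" by (simp add: algebra_simps)
    then show ?thesis using * by simp
  qed
  have "1 \<in> ereal ` \<int>" by (auto simp: image_iff one_ereal_def intro!: bexI[of _ 1])
  then obtain y where y: "y \<in> F - {0}" "w y = 1" using w(3) by (metis (no_types, lifting) imageE)
  then have "u y = 1" by (simp add: u_def)
  then have "- u c * v y = 1" using scale y by simp
  moreover have "v y \<in> \<int>" using F y by blast
  moreover have uc: "u c \<in> \<int>"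
  proof -
    have "w c \<in> ereal ` \<int>" using w(3) F(2) c_nonzero by blast
    then show ?thesis by (auto simp: u_def)
  qed
  moreover have "u c < 0" using nonneg[OF c_nonzero] c_notin by simp
  ultimately have "u c = - 1"
  proof -
    obtain i j where ij: "u c = of_int i" "v y = of_int j"
      using \<open>v y \<in> \<int>\<close> uc by (auto elim!: Ints_cases)
    have "of_int (- i * j) = (1::real)" using \<open>- u c * v y = 1\<close> ij by simp
    then have "- i * j = 1" by (metis of_int_eq_1_iff)
    moreover have "i < 0" using \<open>u c < 0\<close> ij by simp
    ultimately have "i = -1" using zmult_eq_1_iff[of "-i" j] by auto
    then show ?thesis using ij by simp
  qed
  then have "u x = v x" if "x \<noteq> 0" for x using scale[OF that] by simp
  then have "w x = vext x" for x
    using wu[of x] w(1) by (cases "x = 0") (auto simp: vext_def rat_valuation_def)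
  then show ?thesis by blast
qed

end

section \<open>Polynomial relations\<close>

context subring_of_field
begin

text \<open>
  Multiplying \<open>p(x) = 0\<close> by the power \<open>a ^ (n - 1)\<close> of the leading
  coefficient turns it into a monic equation for \<open>a * x\<close>.
\<close>

lemma lead_coeff_root_integral:
  assumes p: "p \<in> polys" "poly p x = 0"
  shows "lead_coeff p * x \<in> integral_closure R"
proof (cases "p = 0")
  case True
  then show ?thesis using base_subset_integral_closure by auto
next
  case False
  define n where "n = degree p"
  define a where "a = lead_coeff p"
  have n: "n > 0"
  proof (rule ccontr)
    assume "\<not> n > 0"
    then obtain b where "p = [:b:]" by (metis degree_eq_zeroE n_def gr0I)
    with p(2) False show False by simp
  qed
  have aR: "poly.coeff p i \<in> R" for i using p(1) by (simp add: polys_def)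
  define r where "r = (\<Sum>i<n. Polynomial.monom (poly.coeff p i * a ^ (n - 1 - i)) i)"
  define q where "q = Polynomial.monom 1 n + r"
  have coeff_r: "poly.coeff r i = (if i < n then poly.coeff p i * a ^ (n - 1 - i) else 0)" for i
    by (simp add: r_def coeff_sum if_distrib cong: if_cong)
  have deg: "degree q = n"
    unfolding q_def using n
    by (subst degree_add_eq_left) (auto simp: degree_monom_eq coeff_r intro!: degree_lessI)
  then have lead: "lead_coeff q = 1" by (simp add: q_def coeff_r)
  have coeffs: "poly.coeff q i \<in> R" for i
    using aR by (auto simp: q_def coeff_r a_def)
  have "poly q (a * x) = a ^ n * x ^ n + (\<Sum>i<n. a ^ (n - 1) * (poly.coeff p i * x ^ i))"
  proof -
    have "b * a ^ (n - 1 - i) * (a * x) ^ i = a ^ (n - 1) * (b * x ^ i)" if "i < n" for b i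
    proof -
      have "a ^ (n - 1) = a ^ (n - 1 - i) * a ^ i" using that by (simp flip: power_add)
      then show ?thesis by (simp add: power_mult_distrib mult_ac)
    qed
    then have "poly r (a * x) = (\<Sum>i<n. a ^ (n - 1) * (poly.coeff p i * x ^ i))"
      unfolding r_def poly_sum poly_monom by (intro sum.cong) auto
    then show ?thesis
      by (simp add: q_def poly_monom power_mult_distrib)
  qed
  also have "\<dots> = a ^ (n - 1) * (\<Sum>i\<le>n. poly.coeff p i * x ^ i)"
    using n by (cases n) (simp_all add: lessThan_Suc_atMost[symmetric] a_def n_def[symmetric] sum_distrib_left algebra_simps)
  also have "\<dots> = 0" using p(2) by (simp add: poly_altdef n_def)
  finally show ?thesis
    using lead coeffs by (auto simp: integral_closure_def integral_over_def a_def intro!: exI[of _ q])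
qed

end

locale integrally_closed_subring = subring_of_field +
  assumes integrally_closed: "integral_over R x \<Longrightarrow> x \<in> R"
begin

text \<open>
  Let \<open>a\<close> be the leading coefficient; \<open>a * x\<close> is in \<open>R\<close>. If
  \<open>a\<close> is outside \<open>P\<close>, then \<open>x = (a * x) / a\<close> is in the
  localization. Otherwise the leading term is absorbed into the next one, which lowers the degree.
  Should this move the last coefficient outside \<open>P\<close> into \<open>P\<close>, then
  \<open>a * x\<close> itself is outside \<open>P\<close>, and the inverse \<open>a / (a * x)\<close>
  of \<open>x\<close> is in the localization.
\<close>

lemma localization_dichotomy:
  assumes P: "primeideal P (ring_on R)"
    and "p \<in> polys" "poly p x = 0" "\<exists>i. poly.coeff p i \<notin> P"
  shows "x \<in> localization R P \<or> inverse x \<in> localization R P"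
  using assms(2-)
proof (induction "degree p" arbitrary: p rule: less_induct)
  case less
  have pr: "1 \<notin> P" "0 \<in> P" "ideal P (ring_on R)" using P by (auto simp: prime_iff ideal_iff)
  define n where "n = degree p"
  define a where "a = lead_coeff p"
  have aR: "poly.coeff p i \<in> R" for i using less.prems by (simp add: polys_def)
  have ax: "a * x \<in> R"
    using lead_coeff_root_integral[OF less.prems(1,2)] integrally_closed
    by (auto simp: integral_closure_def a_def)
  show ?case
  proof (cases "a \<in> P")
    case False
    then have "a \<noteq> 0" "a \<in> R - P" using pr aR by (auto simp: a_def)
    then have "x = (a * x) / a" by simp
    then have "x \<in> localization R P"
      unfolding localization_def using ax \<open>a \<in> R - P\<close> by blast
    then show ?thesis ..
  next
    case True
    have n: "n > 0"
    proof (rule ccontr)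
      assume "\<not> n > 0"
      then obtain b where b: "p = [:b:]" by (metis degree_eq_zeroE n_def gr0I)
      then have "p = 0" using less.prems(2) by simp
      then show False using less.prems(3) pr by simp
    qed
    then obtain m where m: "n = Suc m" by (cases n) auto
    define q where "q = p - Polynomial.monom a n + Polynomial.monom (a * x) m"
    have coeff_q: "poly.coeff q i = (if i = n then 0 else if i = m then poly.coeff p m + a * x else poly.coeff p i)" for i
      using m by (auto simp: q_def a_def n_def)
    have qR: "q \<in> polys" using aR ax by (auto simp: polys_def coeff_q)
    have root: "poly q x = 0"
      using less.prems(2) by (simp add: q_def poly_monom m)
    have "degree q < degree p"
    proof (rule degree_lessI)
      show "q \<noteq> 0 \<or> 0 < degree p" using n by (simp add: n_def)
      show "\<forall>k\<ge>degree p. poly.coeff q k = 0"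
        using m by (auto simp: coeff_q n_def intro: coeff_eq_0)
    qed
    note IH = less.hyps[OF this qR root]
    show ?thesis
    proof (cases "\<exists>i. poly.coeff q i \<notin> P")
      case True then show ?thesis using IH by blast
    next
      case False
      then have q: "poly.coeff q i \<in> P" for i by blast
      obtain i where i: "poly.coeff p i \<notin> P" using less.prems(3) by blast
      have "i \<noteq> n" using i True by (auto simp: a_def n_def)
      then have "i = m" using q[of i] i by (auto simp: coeff_q split: if_splits)
      then have "poly.coeff p m \<notin> P" using i by simp
      moreover have "poly.coeff p m + a * x \<in> P" using q[of m] by (auto simp: coeff_q m)
      ultimately have "a * x \<notin> P" using ideal_diff[OF pr(3), of "poly.coeff p m + a * x" "a * x"] by auto
      then have "inverse x = a / (a * x)" "a * x \<in> R - P" using pr ax by (auto simp: divide_simps)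
      moreover have "a \<in> R" using aR by (simp add: a_def)
      ultimately show ?thesis unfolding localization_def by blast
    qed
  qed
qed

end

section \<open>Integral closures of Dedekind domains\<close>

locale dedekind_extension =
  fixes \<oo> :: "'a::field set"
  assumes dedekind: "dedekind_domain \<oo>"
    and not_field: "\<not> field (ring_on \<oo>)"
    and algebraic: "\<And>x::'a. algebraic_over (frac_field \<oo>) x"
begin

abbreviation K where "K \<equiv> frac_field \<oo>"
abbreviation \<OO> where "\<OO> \<equiv> integral_closure \<oo>"

sublocale base: subring_of_field \<oo>
  using dedekind by (auto simp: dedekind_domain_def intro: subring_ambient_imp)

sublocale big: integrally_closed_subring \<OO>
proof (intro integrally_closed_subring.intro base.subring_integral_closure)
  show "integrally_closed_subring_axioms \<OO>"
    by unfold_locales (rule base.integral_closure_idem)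
qed

lemma base_subset: "\<oo> \<subseteq> \<OO>" by (rule base.base_subset_integral_closure)

lemma base_integrally_closed: "x \<in> K \<Longrightarrow> integral_over \<oo> x \<Longrightarrow> x \<in> \<oo>"
  using dedekind by (auto simp: dedekind_domain_def)

lemma base_subset_K: "\<oo> \<subseteq> K"
proof
  fix x assume "x \<in> \<oo>"
  moreover have "x = x / 1" by simp
  ultimately have "x = x / 1 \<and> x \<in> \<oo> \<and> 1 \<in> \<oo> \<and> (1::'a) \<noteq> 0" by simp
  then show "x \<in> K" unfolding frac_field_def by blast
qed

lemma base_prime_maximal:
  "primeideal p (ring_on \<oo>) \<Longrightarrow> p \<noteq> {0} \<Longrightarrow> maximalideal p (ring_on \<oo>)"
  using dedekind by (auto simp: dedekind_domain_def)

lemma noetherian: "noetherian_ring (ring_on \<oo>)"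
  using dedekind by (auto simp: dedekind_domain_def)

lemma noetherian_max:
  assumes "S \<noteq> {}" "\<And>I. I \<in> S \<Longrightarrow> ideal I (ring_on \<oo>)"
  shows "\<exists>M\<in>S. \<forall>X\<in>S. M \<subseteq> X \<longrightarrow> X = M"
proof (rule subset_Zorn_nonempty[OF assms(1)])
  fix C assume C: "C \<noteq> {}" "subset.chain S C"
  have "subset.chain {I. ideal I (ring_on \<oo>)} C"
    using C(2) assms(2) by (auto simp: subset_chain_def)
  from noetherian_ring.ideal_chain_is_trivial[OF noetherian C(1) this] C(2)
  show "\<Union>C \<in> S" by (auto simp: subset_chain_def)
qed

lemma finitely_generated:
  assumes "ideal I (ring_on \<oo>)"
  obtains A where "finite A" "A \<subseteq> I" "\<And>J. ideal J (ring_on \<oo>) \<Longrightarrow> A \<subseteq> J \<Longrightarrow> I \<subseteq> J"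
proof -
  interpret R: noetherian_ring "ring_on \<oo>" by (rule noetherian)
  obtain A where A: "A \<subseteq> \<oo>" "finite A" "I = Idl\<^bsub>ring_on \<oo>\<^esub> A" 
    using R.finetely_gen[OF assms] by auto
  show thesis
    using that[OF A(2)] R.genideal_self[of A] R.genideal_minimal[of _ A] A by simp
qed

lemma clear_denominators:
  assumes "finite F" "F \<subseteq> K"
  shows "\<exists>d\<in>\<oo>. d \<noteq> 0 \<and> (\<forall>f\<in>F. d * f \<in> \<oo>)"
  using assms
proof (induction F rule: finite_induct)
  case empty
  show ?case by (intro bexI[of _ 1]) auto
next
  case (insert f F)
  then obtain d where d: "d \<in> \<oo>" "d \<noteq> 0" "\<forall>f\<in>F. d * f \<in> \<oo>" by auto
  obtain a b where ab: "a \<in> \<oo>" "b \<in> \<oo>" "b \<noteq> 0" "f = a / b" using insert.prems by (auto simp: frac_field_def)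
  have "d * b * g \<in> \<oo>" if "g \<in> insert f F" for g
  proof (cases "g = f")
    case True then show ?thesis using ab d by auto
  next
    case False
    then have "b * (d * g) \<in> \<oo>" using that d ab by auto
    then show ?thesis by (simp add: mult_ac)
  qed
  then show ?case using d ab by (intro bexI[of _ "d * b"]) auto
qed

lemma base_relation:
  obtains p where "p \<in> base.polys" "p \<noteq> 0" "poly p x = 0"
proof -
  obtain p where p: "p \<noteq> 0" "\<And>i. poly.coeff p i \<in> K" "poly p x = 0"
    using algebraic[of x] by (auto simp: algebraic_over_def)
  have "finite (range (poly.coeff p))"
  by (rule finite_range_coeff)
  moreover have "range (poly.coeff p) \<subseteq> K" using p(2) by auto
  ultimately have "\<exists>d\<in>\<oo>. d \<noteq> 0 \<and> (\<forall>f\<in>range (poly.coeff p). d * f \<in> \<oo>)"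
    by (rule clear_denominators)
  then obtain d where d: "d \<in> \<oo>" "d \<noteq> 0" "\<forall>f\<in>range (poly.coeff p). d * f \<in> \<oo>" by blast
  show thesis
    using that[of "Polynomial.smult d p"] d p by (auto simp: base.polys_def)
qed

lemma ex_denominator: "\<exists>d\<in>\<oo>. d \<noteq> 0 \<and> d * x \<in> \<OO>"
proof -
  obtain p where p: "p \<in> base.polys" "p \<noteq> 0" "poly p x = 0" by (rule base_relation)
  have "lead_coeff p \<in> \<oo>" using p by (auto simp: base.polys_def)
  then show ?thesis
    using base.lead_coeff_root_integral[OF p(1,3)] p(2)
    by (intro bexI[of _ "lead_coeff p"]) auto
qed

text \<open>
  The lowest non-zero coefficient of an integral equation is a multiple of \<open>x\<close>.
\<close>

lemma multiple_in_base:
  assumes "x \<in> \<OO>" "x \<noteq> 0"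
  obtains y where "y \<in> \<OO>" "x * y \<in> \<oo>" "x * y \<noteq> 0"
proof -
  have "\<exists>y\<in>\<OO>. x * y \<in> \<oo> \<and> x * y \<noteq> 0"
    if "p \<in> base.polys" "lead_coeff p = 1" "poly p x = 0" for p
    using that
  proof (induction p)
    case 0 then show ?case by simp
  next
    case (pCons a q)
    have q: "q \<in> base.polys" "a \<in> \<oo>"
      using pCons.prems(1) by (auto simp: base.polys_def) (metis coeff_pCons_Suc, metis coeff_pCons_0)
    have q0: "q \<noteq> 0" using pCons.prems by (cases "q = 0") auto
    then have lead: "lead_coeff q = 1" using pCons.prems(2) by simp
    show ?case
    proof (cases "a = 0")
      case True
      then show ?thesis using pCons.prems(3) pCons.IH[OF q(1) lead] assms(2) by simp
    next
      case False
      have "poly q x \<in> \<OO>"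
        using q(1) assms(1) base_subset by (auto simp: poly_altdef base.polys_def intro!: big.sum_mem)
      moreover have "x * (- poly q x) = a" using pCons.prems(3) by (simp add: add_eq_0_iff)
      ultimately show ?thesis using q(2) False by (metis big.uminus_mem)
    qed
  qed
  moreover obtain p where "p \<in> base.polys" "lead_coeff p = 1" "poly p x = 0"
    using assms(1) by (auto simp: integral_closure_def integral_over_def base.polys_def)
  ultimately show thesis using that by blast
qed

subsection \<open>Local structure of the base ring\<close>

text \<open>
  The ideals generated by \<open>x, x * c, \<dots>, x * c ^ (n - 1)\<close> form an ascending chain.
  Where it becomes stationary, \<open>x * c ^ n\<close> is a combination of the generators, and
  cancelling \<open>x\<close> leaves an integral equation of \<open>c\<close>.
\<close>

lemma powers_bounded_imp_integral:
  assumes x: "x \<noteq> 0" "\<And>n. x * c ^ n \<in> \<oo>"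
  shows "integral_over \<oo> c"
proof -
  define I where "I n = {x * poly q c | q. q \<in> base.polys \<and> (\<forall>i\<ge>n. poly.coeff q i = 0)}" for n
  have ideal: "ideal (I n) (ring_on \<oo>)" for n
    unfolding base.ideal_iff
  proof (intro conjI ballI subsetI)
    fix y assume "y \<in> I n"
    then obtain q where q: "q \<in> base.polys" "y = x * poly q c" by (auto simp: I_def)
    have "y = (\<Sum>i\<le>degree q. poly.coeff q i * (x * c ^ i))"
      by (simp add: q(2) poly_altdef sum_distrib_left mult_ac)
    also have "\<dots> \<in> \<oo>" using q(1) x(2) by (auto simp: base.polys_def)
    finally show "y \<in> \<oo>" .
  next
    show "0 \<in> I n" unfolding I_def by (auto simp: base.polys_def intro!: exI[of _ 0])
  next
    fix y z assume "y \<in> I n" "z \<in> I n"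
    then obtain q r where "q \<in> base.polys" "r \<in> base.polys" "\<forall>i\<ge>n. poly.coeff q i = 0" "\<forall>i\<ge>n. poly.coeff r i = 0"
      "y = x * poly q c" "z = x * poly r c" by (auto simp: I_def)
    then show "y + z \<in> I n"
      unfolding I_def by (intro CollectI exI[of _ "q + r"]) (auto simp: base.polys_def algebra_simps)
  next
    fix s y assume "s \<in> \<oo>" "y \<in> I n"
    moreover from this obtain q where "q \<in> base.polys" "\<forall>i\<ge>n. poly.coeff q i = 0" "y = x * poly q c"
      by (auto simp: I_def)
    ultimately show "s * y \<in> I n"
      unfolding I_def by (intro CollectI exI[of _ "Polynomial.smult s q"]) (auto simp: base.polys_def)
  qed
  have "\<exists>M\<in>range I. \<forall>X\<in>range I. M \<subseteq> X \<longrightarrow> X = M"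
    by (rule noetherian_max) (use ideal in auto)
  then obtain n where n: "\<And>m. I n \<subseteq> I m \<Longrightarrow> I m = I n" by auto
  have "I n \<subseteq> I (Suc n)" unfolding I_def by auto
  then have "I (Suc n) = I n" by (rule n)
  moreover have "x * c ^ n \<in> I (Suc n)"
    unfolding I_def by (auto simp: base.polys_def poly_monom intro!: exI[of _ "Polynomial.monom 1 n"])
  ultimately obtain q where q: "x * c ^ n = x * poly q c" "q \<in> base.polys" "\<forall>i\<ge>n. poly.coeff q i = 0"
    by (auto simp: I_def)
  define p where "p = Polynomial.monom 1 n - q"
  have coeff: "poly.coeff p i = (if i = n then 1 else 0) - poly.coeff q i" for i
    by (simp add: p_def)
  have "degree p = n"
  proof (rule antisym)
    show "degree p \<le> n" using q(3) by (intro degree_le) (auto simp: coeff)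
    show "n \<le> degree p" using q(3) by (intro le_degree) (auto simp: coeff)
  qed
  then have "lead_coeff p = 1" using q(3) by (simp add: coeff)
  moreover have "poly p c = 0" using q(1) x(1) by (simp add: p_def poly_monom)
  moreover have "\<forall>i. poly.coeff p i \<in> \<oo>" using q(2) by (auto simp: coeff base.polys_def)
  ultimately show ?thesis by (auto simp: integral_over_def)
qed

text \<open>
  Take a non-zero \<open>a\<close> in \<open>p\<close> and consider the colon ideals
  \<open>(a : b)\<close>. One that is maximal among those contained in \<open>p\<close> is prime and
  contains \<open>a\<close>, so it is maximal and equal to \<open>p\<close>, and
  \<open>c = b / a\<close> is as required. Without the restriction to colon ideals inside
  \<open>p\<close> the argument would yield some prime over \<open>a\<close>, not the given one.
\<close>

lemma ex_pole:
  assumes p: "maximalideal p (ring_on \<oo>)" "p \<noteq> {0}"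
  shows "\<exists>c. c \<in> K \<and> c \<notin> \<oo> \<and> (\<forall>x\<in>p. c * x \<in> \<oo>)"
proof -
  have pI: "p \<subseteq> \<oo>" "0 \<in> p" "1 \<notin> p" "\<And>r x. r \<in> \<oo> \<Longrightarrow> x \<in> p \<Longrightarrow> r * x \<in> p" "ideal p (ring_on \<oo>)"
    using p(1) by (auto simp: base.maximal_iff base.ideal_iff)
  have prime: "\<And>x y. x \<in> \<oo> \<Longrightarrow> y \<in> \<oo> \<Longrightarrow> x * y \<in> p \<Longrightarrow> x \<in> p \<or> y \<in> p"
    using base.maximal_imp_prime[OF p(1)] by (auto simp: base.prime_iff)
  obtain a where a: "a \<in> p" "a \<noteq> 0" using p(2) pI by auto
  define col where "col b = {r \<in> \<oo>. r * (b / a) \<in> \<oo>}" for b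
  have col: "ideal (col b) (ring_on \<oo>)" for b
    unfolding base.ideal_iff col_def
    by (auto simp: distrib_right mult.assoc simp del: times_divide_eq_left times_divide_eq_right)
  define S where "S = {col b | b. b \<in> \<oo> \<and> col b \<subseteq> p}"
  have "col 1 \<subseteq> p"
  proof
    fix r assume "r \<in> col 1"
    then have "r / a \<in> \<oo>" by (simp add: col_def)
    then have "r / a * a \<in> p" using pI a by blast
    then show "r \<in> p" using a by simp
  qed
  then have "S \<noteq> {}" by (auto simp: S_def)
  then have "\<exists>M\<in>S. \<forall>X\<in>S. M \<subseteq> X \<longrightarrow> X = M"
    by (rule noetherian_max) (auto simp: S_def col)
  then obtain M where M: "M \<in> S" "\<And>X. X \<in> S \<Longrightarrow> M \<subseteq> X \<Longrightarrow> X = M" by blast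
  then obtain b where b: "b \<in> \<oo>" "col b \<subseteq> p" and Mb: "M = col b" unfolding S_def by blast
  have bmax: "col b' = col b" if "b' \<in> \<oo>" "col b' \<subseteq> p" "col b \<subseteq> col b'" for b'
  proof -
    have "col b' \<in> S" using that unfolding S_def by blast
    then show ?thesis using M(2) that(3) unfolding Mb by blast
  qed
  have mem: "z \<in> col (y * b) \<longleftrightarrow> z * y \<in> col b" if "z \<in> \<oo>" "y \<in> \<oo>" for y z
    using that by (auto simp: col_def mult_ac)
  have same: "col (y * b) = col b" if y: "y \<in> \<oo>" "col (y * b) \<subseteq> p" for y
  proof (rule bmax)
    show "col b \<subseteq> col (y * b)"
    proof
      fix z assume z: "z \<in> col b"
      then have "z \<in> \<oo>" by (simp add: col_def)
      moreover have "y * z \<in> col b" using z y(1) col[of b] by (auto simp: base.ideal_iff)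
      ultimately show "z \<in> col (y * b)" using mem[of z y] y(1) by (metis mult.commute)
    qed
  qed (use b y in auto)
  have "primeideal (col b) (ring_on \<oo>)"
    unfolding base.prime_iff
  proof (intro conjI ballI impI)
    show "ideal (col b) (ring_on \<oo>)" by (rule col)
    show "1 \<notin> col b" using b pI by auto
    fix x y assume xy: "x \<in> \<oo>" "y \<in> \<oo>" "x * y \<in> col b"
    show "x \<in> col b \<or> y \<in> col b"
    proof (cases "col (y * b) \<subseteq> p")
      case True
      then show ?thesis using same[OF xy(2)] xy mem by blast
    next
      case False
      then obtain s where s: "s \<in> col (y * b)" "s \<notin> p" by auto
      then have so: "s \<in> \<oo>" by (simp add: col_def)
      have "col (s * b) \<subseteq> p"
      proof
        fix z assume z: "z \<in> col (s * b)"
        then have "z \<in> \<oo>" by (simp add: col_def)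
        then have "z * s \<in> p" using z mem so b by blast
        then show "z \<in> p" using prime \<open>z \<in> \<oo>\<close> so s by blast
      qed
      then have "col (s * b) = col b" using same so by blast
      moreover have "y * s \<in> col b" using s mem so xy by (metis mult.commute)
      ultimately show ?thesis using mem xy so by blast
    qed
  qed
  moreover have "a \<in> col b" using a b pI by (auto simp: col_def)
  ultimately have "maximalideal (col b) (ring_on \<oo>)" using base_prime_maximal a by blast
  then have "col b = p"
    using maximalideal.I_maximal[of "col b" "ring_on \<oo>" p] pI b by auto
  then have "b / a \<notin> \<oo>" "\<forall>x\<in>p. b / a * x \<in> \<oo>"
    using pI by (auto simp: col_def mult.commute)
  moreover have "b / a \<in> K" using a b pI by (auto simp: frac_field_def)
  ultimately show ?thesis by blast
qed

text \<open>
  An inverse of a uniformizer at \<open>p\<close>: its value at \<open>p\<close> will be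
  \<open>- 1\<close>.
\<close>

definition pole :: "'a set \<Rightarrow> 'a" where
  "pole p = (SOME c. c \<in> K \<and> c \<notin> \<oo> \<and> (\<forall>x\<in>p. c * x \<in> \<oo>))"

lemma pole:
  assumes "maximalideal p (ring_on \<oo>)" "p \<noteq> {0}"
  shows "pole p \<in> K" "pole p \<notin> \<oo>" "\<And>x. x \<in> p \<Longrightarrow> pole p * x \<in> \<oo>" "pole p \<noteq> 0"
  using someI_ex[OF ex_pole[OF assms]] unfolding pole_def[symmetric] by auto

text \<open>
  The exponent is the value of \<open>x\<close> at \<open>p\<close>. It exists because otherwise all
  \<open>x * pole p ^ n\<close> would stay in \<open>p\<close> and the pole would be integral.
\<close>

lemma pole_power:
  assumes p: "maximalideal p (ring_on \<oo>)" "p \<noteq> {0}" and x: "x \<in> \<oo>" "x \<noteq> 0"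
  shows "\<exists>n. x * pole p ^ n \<in> \<oo> - p"
proof (rule ccontr)
  assume no: "\<not> ?thesis"
  have "x * pole p ^ n \<in> p" for n
  proof (induction n)
    case 0
    then show ?case using no x by (metis DiffI mult.right_neutral power_0)
  next
    case (Suc n)
    have "x * pole p ^ Suc n \<in> \<oo>" using pole(3)[OF p Suc] by (simp add: mult_ac)
    then show ?case using no by blast
  qed
  moreover have "p \<subseteq> \<oo>" using p by (auto simp: base.maximal_iff base.ideal_iff)
  ultimately have "integral_over \<oo> (pole p)"
    using powers_bounded_imp_integral[OF x(2)] by blast
  then show False using base_integrally_closed pole[OF p] by blast
qed

text \<open>
  Noetherian induction: a maximal counterexample \<open>M\<close> is not prime, say
  \<open>x * y\<close> is in \<open>M\<close>, and every prime over \<open>M\<close> contains one of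
  the two larger ideals generated by \<open>M\<close> and \<open>x\<close> or \<open>y\<close>.
\<close>

lemma finite_primes_containing:
  assumes "ideal I (ring_on \<oo>)" "I \<noteq> {0}"
  shows "finite {p. maximalideal p (ring_on \<oo>) \<and> I \<subseteq> p}"
proof (rule ccontr)
  define mx where "mx I = {p. maximalideal p (ring_on \<oo>) \<and> I \<subseteq> p}" for I
  define S where "S = {I. ideal I (ring_on \<oo>) \<and> I \<noteq> {0} \<and> infinite (mx I)}"
  assume "infinite {p. maximalideal p (ring_on \<oo>) \<and> I \<subseteq> p}"
  then have "S \<noteq> {}" using assms by (auto simp: S_def mx_def)
  then have "\<exists>M\<in>S. \<forall>X\<in>S. M \<subseteq> X \<longrightarrow> X = M"
    by (rule noetherian_max) (auto simp: S_def)
  then obtain M where M: "M \<in> S" "\<And>X. X \<in> S \<Longrightarrow> M \<subseteq> X \<Longrightarrow> X = M" by blast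
  have Mi: "ideal M (ring_on \<oo>)" "M \<noteq> {0}" "infinite (mx M)" using M by (auto simp: S_def)
  have "\<not> primeideal M (ring_on \<oo>)"
  proof
    assume "primeideal M (ring_on \<oo>)"
    then have "maximalideal M (ring_on \<oo>)" using base_prime_maximal Mi by blast
    then have "mx M \<subseteq> {M}"
      using maximalideal.I_maximal[of M "ring_on \<oo>"]
      unfolding mx_def base.maximal_iff base.ideal_iff by auto
    then show False using Mi finite_subset by blast
  qed
  moreover have "1 \<notin> M"
  proof
    assume "1 \<in> M"
    then have "mx M = {}" by (auto simp: mx_def base.maximal_iff)
    then show False using Mi by simp
  qed
  ultimately obtain x y where xy: "x \<in> \<oo>" "y \<in> \<oo>" "x * y \<in> M" "x \<notin> M" "y \<notin> M"
    using Mi by (auto simp: base.prime_iff)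
  define J where "J z = {m + r * z | m r. m \<in> M \<and> r \<in> \<oo>}" for z
  have fin: "finite (mx (J z))" if "z \<in> \<oo>" "z \<notin> M" for z
  proof (rule ccontr)
    assume inf: "infinite (mx (J z))"
    have "M \<subseteq> J z" "z \<in> J z" using base.ideal_adjoin_supset[OF Mi(1), of z] by (auto simp: J_def)
    moreover have "ideal (J z) (ring_on \<oo>)" using base.ideal_adjoin[OF Mi(1) that(1)] by (simp add: J_def)
    ultimately have "J z \<in> S" using inf Mi unfolding S_def base.ideal_iff by blast
    then show False using M(2)[of "J z"] \<open>M \<subseteq> J z\<close> \<open>z \<in> J z\<close> that by blast
  qed
  have "mx M \<subseteq> mx (J x) \<union> mx (J y)"
  proof
    fix p assume p: "p \<in> mx M"
    then have pp: "primeideal p (ring_on \<oo>)" "M \<subseteq> p" "maximalideal p (ring_on \<oo>)"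
      using base.maximal_imp_prime by (auto simp: mx_def)
    then have "x \<in> p \<or> y \<in> p" using xy by (auto simp: base.prime_iff)
    moreover have "J z \<subseteq> p" if "z \<in> p" for z
      using pp(1,2) that by (auto simp: J_def base.prime_iff base.ideal_iff)
    ultimately show "p \<in> mx (J x) \<union> mx (J y)" using pp by (auto simp: mx_def)
  qed
  then show False using fin xy Mi finite_subset by blast
qed

end

text \<open>
  Divisibility is a total preorder on the non-zero elements, so a finite set has a least one.
\<close>

lemma valuation_ring_min:
  fixes f :: "'i \<Rightarrow> 'a::field"
  assumes V: "subring_of_field V" "\<And>x. x \<in> V \<or> inverse x \<in> V"
    and S: "finite S" "S \<noteq> {}" "\<And>i. i \<in> S \<Longrightarrow> f i \<noteq> 0"
  shows "\<exists>i\<in>S. \<forall>j\<in>S. f j / f i \<in> V"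
  using S
proof (induction S rule: finite_ne_induct)
  interpret subring_of_field V by fact
  case (singleton i)
  then show ?case by simp
next
  interpret subring_of_field V by fact
  case (insert k S)
  then obtain i where i: "i \<in> S" "\<And>j. j \<in> S \<Longrightarrow> f j / f i \<in> V" by auto
  consider "f k / f i \<in> V" | "f i / f k \<in> V" using V(2)[of "f k / f i"] by auto
  then show ?case
  proof cases
    case 1 then show ?thesis using i by auto
  next
    case 2
    have "f j / f k \<in> V" if "j \<in> insert k S" for j
    proof (cases "j = k")
      case True then show ?thesis using insert.prems by simp
    next
      case False
      then have "(f j / f i) * (f i / f k) \<in> V" using i(2)[of j] that 2 by blast
      then show ?thesis using insert.prems i(1) by simp
    qed
    then show ?thesis by blast
  qed
qed

text \<open>
  Divide by a summand of least value. If no other had the same value, \<open>- 1\<close> would be a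
  sum of nonunits.
\<close>

lemma valuation_ring_two_equal:
  fixes f :: "'i \<Rightarrow> 'a::field"
  assumes V: "subring_of_field V" "\<And>x. x \<in> V \<or> inverse x \<in> V"
    and S: "finite S" "S \<noteq> {}" "\<And>i. i \<in> S \<Longrightarrow> f i \<noteq> 0" "sum f S = 0"
  obtains i j where "i \<in> S" "j \<in> S" "i \<noteq> j" "f j / f i \<in> V" "f i / f j \<in> V"
proof -
  interpret subring_of_field V by fact
  have "\<exists>i\<in>S. \<forall>j\<in>S. f j / f i \<in> V"
    by (rule valuation_ring_min[OF V S(1-3)])
  then obtain i where i: "i \<in> S" "\<And>j. j \<in> S \<Longrightarrow> f j / f i \<in> V" by auto
  have "\<exists>j\<in>S - {i}. f i / f j \<in> V"
  proof (rule ccontr)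
    assume no: "\<not> ?thesis"
    \<comment> \<open>Nonunits are closed under addition.\<close>
    have nonunit: "sum g T \<in> V \<and> (sum g T = 0 \<or> inverse (sum g T) \<notin> V)"
      if "finite T" "\<And>j. j \<in> T \<Longrightarrow> g j \<noteq> 0 \<and> g j \<in> V \<and> inverse (g j) \<notin> V" for T and g :: "'i \<Rightarrow> 'a"
      using that
    proof (induction T rule: finite_induct)
      case (insert k T)
      define y where "y = sum g T"
      have gk: "g k \<noteq> 0" "g k \<in> V" "inverse (g k) \<notin> V" and y: "y \<in> V" "y = 0 \<or> inverse y \<notin> V"
        using insert by (auto simp: y_def)
      have "inverse (g k + y) \<notin> V" if nz: "g k + y \<noteq> 0" "y \<noteq> 0"
      proof
        assume u: "inverse (g k + y) \<in> V"
        have "g k / y \<in> V \<or> y / g k \<in> V" using V(2)[of "g k / y"] by auto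
        then consider "1 + g k / y \<in> V" | "1 + y / g k \<in> V" by auto
        then show False
        proof cases
          case 1
          then have "(1 + g k / y) * inverse (g k + y) \<in> V" using u by blast
          also have "(1 + g k / y) * inverse (g k + y) = inverse y" using nz by (simp add: field_simps)
          finally show False using y nz by simp
        next
          case 2
          then have "(1 + y / g k) * inverse (g k + y) \<in> V" using u by blast
          also have "(1 + y / g k) * inverse (g k + y) = inverse (g k)" using nz gk by (simp add: field_simps)
          finally show False using gk by simp
        qed
      qed
      then have "g k + y = 0 \<or> inverse (g k + y) \<notin> V" using gk(3) by (cases "y = 0") auto
      moreover have "g k + y \<in> V" using gk y by blast
      ultimately show ?case using insert.hyps by (simp add: y_def)
    qed simp
    define g where "g j = f j / f i" for j
    have "sum g (S - {i}) \<in> V \<and> (sum g (S - {i}) = 0 \<or> inverse (sum g (S - {i})) \<notin> V)"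
      using no i S by (intro nonunit) (auto simp: g_def)
    moreover have "sum g (S - {i}) = -1"
    proof -
      have "sum g S = 0" using S(4) by (simp add: g_def flip: sum_divide_distrib)
      moreover have "sum g S = g i + sum g (S - {i})" using S(1) i(1) by (rule sum.remove)
      moreover have "g i = 1" using S(3) i(1) by (simp add: g_def)
      ultimately show ?thesis by (simp add: add_eq_0_iff)
    qed
    ultimately show False by auto
  qed
  then show thesis using that i by blast
qed

context dedekind_extension
begin

subsection \<open>Maximal ideals of the integral closure\<close>

text \<open>
  Induction on a monic \<open>f\<close> with \<open>f(x)\<close> in \<open>Q\<close>. If the constant
  term is in \<open>Q\<close>, a factor \<open>x\<close> can be cancelled; if not, the constant term
  is invertible modulo \<open>Q\<close>, and so is \<open>x\<close>.
\<close>

lemma prime_over_maximal: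
  assumes Q: "primeideal Q (ring_on \<OO>)" and p: "maximalideal (Q \<inter> \<oo>) (ring_on \<oo>)"
  shows "maximalideal Q (ring_on \<OO>)"
proof -
  have Qp: "ideal Q (ring_on \<OO>)" "1 \<notin> Q" "\<And>x y. x \<in> \<OO> \<Longrightarrow> y \<in> \<OO> \<Longrightarrow> x * y \<in> Q \<Longrightarrow> x \<in> Q \<or> y \<in> Q"
    "Q \<subseteq> \<OO>" "0 \<in> Q" "\<And>x y. x \<in> Q \<Longrightarrow> y \<in> Q \<Longrightarrow> x + y \<in> Q" "\<And>r x. r \<in> \<OO> \<Longrightarrow> x \<in> Q \<Longrightarrow> r * x \<in> Q"
    using Q by (auto simp: big.prime_iff big.ideal_iff)
  have pp: "\<And>x. x \<in> \<oo> \<Longrightarrow> x \<notin> Q \<Longrightarrow> \<exists>r\<in>\<oo>. 1 - r * x \<in> Q"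
    using p by (auto simp: base.maximal_iff)
  have "\<exists>r\<in>\<OO>. 1 - r * x \<in> Q" if x: "x \<in> \<OO>" "x \<notin> Q" for x
  proof -
    have "\<exists>r\<in>\<OO>. 1 - r * x \<in> Q"
      if "f \<in> base.polys" "lead_coeff f = 1" "poly f x \<in> Q" for f
      using that
    proof (induction f)
      case 0 then show ?case by simp
    next
      case (pCons a g)
      have g: "g \<in> base.polys" "a \<in> \<oo>"
        using pCons.prems(1) by (auto simp: base.polys_def) (metis coeff_pCons_Suc, metis coeff_pCons_0)
      have g0: "g \<noteq> 0"
      proof
        assume "g = 0"
        then have "a = 1" using pCons.prems(2) by simp
        then show False using \<open>g = 0\<close> pCons.prems(3) Qp(2) by simp
      qed
      then have lead: "lead_coeff g = 1" using pCons.prems(2) by simp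
      have gx: "poly g x \<in> \<OO>"
        using g(1) x base_subset by (auto simp: poly_altdef base.polys_def intro!: big.sum_mem)
      have eq: "poly (pCons a g) x = a + x * poly g x" by simp
      show ?case
      proof (cases "a \<in> Q")
        case True
        then have "x * poly g x \<in> Q"
          using big.ideal_diff[OF Qp(1) pCons.prems(3) True] unfolding eq by simp
        then have "poly g x \<in> Q" using Qp(3) x gx by blast
        then show ?thesis using pCons.IH g lead by blast
      next
        case False
        then obtain r where r: "r \<in> \<oo>" "1 - r * a \<in> Q" using pp g by blast
        have "r * poly (pCons a g) x \<in> Q" using r(1) base_subset Qp(7) pCons.prems(3) by blast
        then have "(1 - r * a) + r * poly (pCons a g) x \<in> Q" using Qp(6) r(2) by blast
        also have "(1 - r * a) + r * poly (pCons a g) x = 1 - (- (r * poly g x)) * x"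
          by (simp add: algebra_simps)
        finally show ?thesis
          using r(1) base_subset gx by (intro bexI[of _ "- (r * poly g x)"]) auto
      qed
    qed
    moreover obtain f where "f \<in> base.polys" "lead_coeff f = 1" "poly f x = 0"
      using x by (auto simp: integral_closure_def integral_over_def base.polys_def)
    ultimately show ?thesis using Qp(5) by metis
  qed
  then show ?thesis using Qp(1,2) by (auto simp: big.maximal_iff)
qed

text \<open>
  The point is that \<open>P\<close> is not 0: otherwise \<open>\<OO>\<close> would be a field, and
  inverses of elements of \<open>\<oo>\<close>, being integral and in \<open>K\<close>, would lie in
  \<open>\<oo>\<close>.
\<close>

lemma maximal_below:
  assumes P: "maximalideal P (ring_on \<OO>)"
  shows "maximalideal (P \<inter> \<oo>) (ring_on \<oo>)" "P \<inter> \<oo> \<noteq> {0}"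
proof -
  have prime: "primeideal P (ring_on \<OO>)" using big.maximal_imp_prime[OF P] .
  have PI: "P \<subseteq> \<OO>" "0 \<in> P" "\<And>x y. x \<in> P \<Longrightarrow> y \<in> P \<Longrightarrow> x + y \<in> P" "\<And>r x. r \<in> \<OO> \<Longrightarrow> x \<in> P \<Longrightarrow> r * x \<in> P"
    "1 \<notin> P" "\<And>x y. x \<in> \<OO> \<Longrightarrow> y \<in> \<OO> \<Longrightarrow> x * y \<in> P \<Longrightarrow> x \<in> P \<or> y \<in> P"
    using prime by (auto simp: big.prime_iff big.ideal_iff)
  have "P \<noteq> {0}"
  proof
    assume P0: "P = {0}"
    have inv: "inverse x \<in> \<oo>" if "x \<in> \<oo>" "x \<noteq> 0" for x
    proof -
      have "x \<in> \<OO> - P" using that base_subset P0 by auto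
      then obtain r where r: "r \<in> \<OO>" "1 - r * x = 0" using P P0 by (auto simp: big.maximal_iff)
      then have "inverse x = r" using that by (simp add: field_simps)
      moreover have "inverse x = 1 / x" by (simp add: divide_inverse)
      moreover have "1 / x \<in> K" using that unfolding frac_field_def by blast
      ultimately show ?thesis using base_integrally_closed r(1) by (auto simp: integral_closure_def)
    qed
    have "maximalideal {0} (ring_on \<oo>)"
      unfolding base.maximal_iff base.ideal_iff
    proof (intro conjI ballI)
      fix x assume "x \<in> \<oo> - {0}"
      then show "\<exists>r\<in>\<oo>. 1 - r * x \<in> {0}"
        using inv[of x] by (intro bexI[of _ "inverse x"]) auto
    qed auto
    then have "field (ring_on \<oo>)"
      using cring.zeromaximalideal_eq_field[OF base.cring_ring_on] by simp
    then show False using not_field by simp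
  qed
  then obtain x where x: "x \<in> P" "x \<noteq> 0" using PI(2) by auto
  then obtain y where "y \<in> \<OO>" "x * y \<in> \<oo>" "x * y \<noteq> 0" using multiple_in_base PI(1) by blast
  moreover from this x have "y * x \<in> P" using PI(4) by blast
  ultimately have "x * y \<in> P \<inter> \<oo>" by (simp add: mult.commute)
  with \<open>x * y \<noteq> 0\<close> show ne: "P \<inter> \<oo> \<noteq> {0}" by blast
  have "primeideal (P \<inter> \<oo>) (ring_on \<oo>)"
    unfolding base.prime_iff base.ideal_iff
  proof (intro conjI ballI impI)
    show "r * x \<in> P \<inter> \<oo>" if "r \<in> \<oo>" "x \<in> P \<inter> \<oo>" for r x
      using that PI(4)[of r x] base_subset by auto
    show "x \<in> P \<inter> \<oo> \<or> y \<in> P \<inter> \<oo>" if "x \<in> \<oo>" "y \<in> \<oo>" "x * y \<in> P \<inter> \<oo>" for x y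
      using that PI(6)[of x y] base_subset by auto
  qed (use PI in auto)
  then show "maximalideal (P \<inter> \<oo>) (ring_on \<oo>)" using base_prime_maximal ne by blast
qed

abbreviation loc where "loc \<equiv> localization \<OO>"
abbreviation spec where "spec \<equiv> max_ideals \<OO>"

lemma max_ideals_iff: "P \<in> spec \<longleftrightarrow> maximalideal P (ring_on \<OO>)"
  by (simp add: max_ideals_def)

text \<open>
  It depends only on the prime below \<open>P\<close>, so one element normalizes the valuations of a
  whole fibre.
\<close>

abbreviation spole :: "'a set \<Rightarrow> 'a" where "spole P \<equiv> pole (P \<inter> \<oo>)"

lemma K_mult: "x \<in> K \<Longrightarrow> y \<in> K \<Longrightarrow> x * y \<in> K"
  unfolding frac_field_def
  by clarify (metis base.mult_mem mult_eq_0_iff times_divide_times_eq)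

context
  fixes P assumes P: "maximalideal P (ring_on \<OO>)"
begin

lemma maximal_prime: "primeideal P (ring_on \<OO>)" using big.maximal_imp_prime[OF P] .

lemma maximal_simps:
  "P \<subseteq> \<OO>" "0 \<in> P" "\<And>x y. x \<in> P \<Longrightarrow> y \<in> P \<Longrightarrow> x + y \<in> P" "\<And>r x. r \<in> \<OO> \<Longrightarrow> x \<in> P \<Longrightarrow> r * x \<in> P"
  "1 \<notin> P" "\<And>x y. x \<in> \<OO> \<Longrightarrow> y \<in> \<OO> \<Longrightarrow> x * y \<in> P \<Longrightarrow> x \<in> P \<or> y \<in> P"
  using maximal_prime by (auto simp: big.prime_iff big.ideal_iff)

lemma subring_loc: "subring_of_field (loc P)"
  by (rule big.subring_localization[OF maximal_prime])

lemma inverse_in_loc: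
  assumes "s \<in> \<OO> - P" shows "inverse s \<in> loc P"
proof -
  have "inverse s = 1 / s" by (simp add: divide_inverse)
  then show ?thesis unfolding localization_def using assms big.one_mem by blast
qed

lemma not_inverse_in_loc:
  assumes "x \<in> P" "x \<noteq> 0" shows "inverse x \<notin> loc P"
proof
  assume "inverse x \<in> loc P"
  then obtain a s where "a \<in> \<OO>" "s \<in> \<OO> - P" "inverse x = a / s" by (auto simp: localization_def)
  moreover from this have "s = a * x" using assms maximal_simps(2) by (auto simp: field_simps)
  ultimately show False using assms maximal_simps(4) by auto
qed

text \<open>
  An equation of \<open>x\<close> over \<open>\<oo>\<close> is multiplied by the least power of the
  pole that moves some coefficient out of \<open>P\<close>; up to that power all coefficients stay in
  \<open>\<oo>\<close>.
\<close>

lemma loc_total: "x \<in> loc P \<or> inverse x \<in> loc P"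
proof -
  obtain f where f: "f \<in> base.polys" "f \<noteq> 0" "poly f x = 0" by (rule base_relation)
  define c where "c = spole P"
  note pl = pole[OF maximal_below[OF P], folded c_def]
  have fo: "poly.coeff f i \<in> \<oo>" for i using f(1) by (simp add: base.polys_def)
  define S where "S n \<longleftrightarrow> (\<exists>i. poly.coeff f i * c ^ n \<notin> P \<inter> \<oo>)" for n
  have "lead_coeff f \<noteq> 0" using f by simp
  then obtain n0 where "S n0"
    using pole_power[OF maximal_below[OF P] fo, of "degree f"] unfolding S_def c_def by blast
  define n where "n = (LEAST n. S n)"
  have "S n" using \<open>S n0\<close> unfolding n_def by (rule LeastI)
  have coeffs: "poly.coeff f i * c ^ n \<in> \<oo>" for i
  proof (cases n)
    case 0 then show ?thesis using fo by simp
  next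
    case (Suc m)
    then have "\<not> S m" using not_less_Least[of m S] unfolding n_def by simp
    then have "poly.coeff f i * c ^ m \<in> P \<inter> \<oo>" unfolding S_def by blast
    then show ?thesis using pl(3)[of "poly.coeff f i * c ^ m"] Suc by (simp add: mult_ac)
  qed
  show ?thesis
  proof (rule big.localization_dichotomy[OF maximal_prime])
    show "Polynomial.smult (c ^ n) f \<in> big.polys"
      using coeffs base_subset by (auto simp: big.polys_def mult.commute)
    show "poly (Polynomial.smult (c ^ n) f) x = 0" using f by simp
    obtain i where "poly.coeff f i * c ^ n \<notin> P" using \<open>S n\<close> coeffs unfolding S_def by blast
    then have "poly.coeff (Polynomial.smult (c ^ n) f) i \<notin> P" by (simp add: mult.commute)
    then show "\<exists>i. poly.coeff (Polynomial.smult (c ^ n) f) i \<notin> P" by blast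
  qed
qed

lemma spole_notin_loc: "spole P \<notin> loc P"
proof
  assume "spole P \<in> loc P"
  then obtain a s where as: "a \<in> \<OO>" "s \<in> \<OO> - P" "spole P = a / s" by (auto simp: localization_def)
  then have s0: "s \<noteq> 0" using maximal_simps(2) by auto
  obtain x where x: "x \<in> P \<inter> \<oo>" "x \<noteq> 0"
    using maximal_below(2)[OF P] maximal_simps(2) base.zero_mem by blast
  obtain n where n: "x * spole P ^ n \<in> \<oo> - (P \<inter> \<oo>)"
    using pole_power[OF maximal_below[OF P]] x by blast
  have "x * a ^ n = (x * spole P ^ n) * s ^ n"
    using s0 by (simp add: as(3) power_divide)
  moreover have "x * a ^ n \<in> P" using x as maximal_simps(4)[of "a ^ n" x] by (auto simp: mult.commute)
  moreover have "s ^ n \<notin> P" for n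
  proof (induction n)
    case 0 then show ?case using maximal_simps by simp
  next
    case (Suc n) then show ?case using maximal_simps(6)[of s "s ^ n"] as by auto
  qed
  moreover have "x * spole P ^ n \<in> \<OO>" "x * spole P ^ n \<notin> P" "s ^ n \<in> \<OO>"
    using n as(2) base_subset by auto
  ultimately show False using maximal_simps(6)[of "x * spole P ^ n" "s ^ n"] by metis
qed

lemma K_value:
  assumes "x \<in> K" "x \<noteq> 0"
  obtains m where "x * spole P powi m \<in> loc P" "inverse (x * spole P powi m) \<in> loc P"
proof -
  interpret L: subring_of_field "loc P" by (rule subring_loc)
  note pl = pole[OF maximal_below[OF P]]
  have *: "\<exists>n. a * spole P ^ n \<in> \<OO> - P" if "a \<in> \<oo>" "a \<noteq> 0" for a
    using pole_power[OF maximal_below[OF P] that] base_subset by blast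
  obtain a b where ab: "a \<in> \<oo>" "b \<in> \<oo>" "b \<noteq> 0" "x = a / b" using assms by (auto simp: frac_field_def)
  then have "a \<noteq> 0" using assms by auto
  obtain n k where nk: "a * spole P ^ n \<in> \<OO> - P" "b * spole P ^ k \<in> \<OO> - P"
    using *[OF ab(1) \<open>a \<noteq> 0\<close>] *[OF ab(2,3)] by blast
  define u w where "u = a * spole P ^ n" and "w = b * spole P ^ k"
  have uw: "u \<in> loc P" "w \<in> loc P" "inverse u \<in> loc P" "inverse w \<in> loc P"
    using nk[folded u_def w_def] inverse_in_loc big.subset_localization[OF maximal_prime] by auto
  have "x * spole P powi (int n - int k) = u * inverse w"
    using pl(4) by (simp add: ab u_def w_def power_int_diff field_simps)
  then show thesis using uw that[of "int n - int k"] by (auto simp: mult.commute)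
qed

text \<open>
  In an equation of \<open>x\<close> over \<open>\<oo>\<close>, two terms of degrees
  \<open>i < j\<close> have the same value. So \<open>x ^ (j - i)\<close> has the value of an element
  of \<open>K\<close>, which is that of a power of the pole.
\<close>

lemma loc_rational:
  assumes x: "x \<noteq> 0"
  shows "\<exists>n m. n > (0::nat) \<and> x ^ n * spole P powi m \<in> loc P \<and>
           inverse (x ^ n * spole P powi m) \<in> loc P"
proof -
  interpret L: subring_of_field "loc P" by (rule subring_loc)
  let ?V = "loc P" and ?c = "spole P"
  have c0: "?c \<noteq> 0" by (rule pole(4)[OF maximal_below[OF P]])
  obtain f where f: "f \<in> base.polys" "f \<noteq> 0" "poly f x = 0" by (rule base_relation)
  define t where "t i = poly.coeff f i * x ^ i" for i
  define S where "S = {i. i \<le> degree f \<and> poly.coeff f i \<noteq> 0}"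
  have "0 = (\<Sum>i\<le>degree f. t i)" using f(3) by (simp add: poly_altdef t_def)
  also have "\<dots> = sum t S" by (rule sum.mono_neutral_right) (auto simp: S_def t_def)
  finally have sum0: "sum t S = 0" by simp
  have "degree f \<in> S" using f by (simp add: S_def)
  then have "S \<noteq> {}" by blast
  moreover have "finite S" by (simp add: S_def)
  moreover have "t i \<noteq> 0" if "i \<in> S" for i using that x by (simp add: S_def t_def)
  ultimately obtain i j where "i \<in> S" "j \<in> S" "i \<noteq> j" "t j / t i \<in> ?V" "t i / t j \<in> ?V"
    using valuation_ring_two_equal[OF subring_loc loc_total _ _ _ sum0] by metis
  then have "\<exists>i j. i \<in> S \<and> j \<in> S \<and> i < j \<and> t j / t i \<in> ?V \<and> t i / t j \<in> ?V"
    by (metis linorder_neqE_nat)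
  then obtain i j where ij: "i \<in> S" "j \<in> S" "i < j" "t j / t i \<in> ?V" "t i / t j \<in> ?V"
    by blast
  define a where "a = poly.coeff f j / poly.coeff f i"
  have a: "a \<in> K" "a \<noteq> 0"
    using f(1) ij by (auto simp: a_def frac_field_def base.polys_def S_def)
  obtain m where m: "a * ?c powi m \<in> ?V" "inverse (a * ?c powi m) \<in> ?V" using K_value[OF a] .
  have tt: "t j / t i = a * x ^ (j - i)" "t i / t j = inverse (a * x ^ (j - i))"
    using ij x by (simp_all add: t_def a_def power_diff field_simps)
  have "inverse (a * ?c powi m) * (t j / t i) \<in> ?V" "(a * ?c powi m) * (t i / t j) \<in> ?V"
    using m ij by blast+
  moreover have "inverse (a * ?c powi m) * (t j / t i) = x ^ (j - i) * ?c powi (- m)"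
    "(a * ?c powi m) * (t i / t j) = inverse (x ^ (j - i) * ?c powi (- m))"
    unfolding tt using a c0 x by (simp_all add: power_int_minus field_simps)
  ultimately show ?thesis using ij(3) by (metis zero_less_diff)
qed

lemma rational_valuation_ring_loc: "rational_valuation_ring (loc P) (spole P)"
  using loc_total pole(4)[OF maximal_below[OF P]] spole_notin_loc loc_rational
  by (intro rational_valuation_ring.intro subring_loc rational_valuation_ring_axioms.intro) auto

end

text \<open>
  The values of non-zero elements; at 0 the number has no meaning.
\<close>

definition vv :: "'a set \<Rightarrow> 'a \<Rightarrow> real" where
  "vv P = rational_valuation_ring.v (loc P) (spole P)"

context
  fixes P assumes P: "P \<in> spec"
begin

lemma max_ideal_maximal: "maximalideal P (ring_on \<OO>)" using P by (simp add: max_ideals_iff)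

interpretation rational_valuation_ring "loc P" "spole P"
  rewrites "v = vv P"
  using rational_valuation_ring_loc[OF max_ideal_maximal] by (simp_all add: vv_def)

lemmas vv_mult = v_mult
lemmas vv_add = v_add
lemmas vv_power = v_power
lemmas vv_powi = v_powi
lemmas vv_one = v_one
lemmas vv_inverse = v_inverse
lemmas vv_spole = v_c
lemmas vv_nonneg_iff = v_nonneg_iff

lemma vv_rational:
  assumes "x \<noteq> 0"
  shows "\<exists>n m. n > (0::nat) \<and> vv P x = of_int m / of_nat n"
  using is_value_v[OF assms] by (auto simp: is_value_def)

lemma vv_pos_iff:
  assumes "x \<in> \<OO>" "x \<noteq> 0"
  shows "0 < vv P x \<longleftrightarrow> x \<in> P"
proof -
  have x: "0 \<le> vv P x"
    using vv_nonneg_iff[OF assms(2)] big.subset_localization[OF maximal_prime[OF max_ideal_maximal]] assms(1) by blast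
  show ?thesis
  proof (cases "x \<in> P")
    case True
    then have "\<not> 0 \<le> vv P (inverse x)"
      using not_inverse_in_loc[OF max_ideal_maximal] vv_nonneg_iff[of "inverse x"] assms(2) by simp
    then show ?thesis using True vv_inverse assms(2) by simp
  next
    case False
    then have "0 \<le> vv P (inverse x)"
      using inverse_in_loc[OF max_ideal_maximal, of x] vv_nonneg_iff[of "inverse x"] assms by simp
    then show ?thesis using False x vv_inverse assms(2) by simp
  qed
qed

lemma vv_nonneg: "x \<in> \<OO> \<Longrightarrow> x \<noteq> 0 \<Longrightarrow> 0 \<le> vv P x"
  using vv_nonneg_iff[of x] big.subset_localization[OF maximal_prime[OF max_ideal_maximal]] by blast

lemma vv_K_Ints:
  assumes "x \<in> K" "x \<noteq> 0"
  shows "vv P x \<in> \<int>"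
proof -
  obtain m where m: "x * spole P powi m \<in> loc P" "inverse (x * spole P powi m) \<in> loc P"
    using K_value[OF max_ideal_maximal assms] .
  have nz: "x * spole P powi m \<noteq> 0" using assms c_nonzero by simp
  have "vv P (x * spole P powi m) = 0"
    using v_unit[of "x * spole P powi m"] m nz by (auto simp: unit_grp_def)
  then have "vv P x = of_int m" using assms c_nonzero by (simp add: v_mult v_powi v_c)
  then show ?thesis by simp
qed

lemma val_eq: "val K \<OO> P x = (if x = 0 then \<infinity> else ereal (vv P x))"
proof -
  note pl = pole[OF maximal_below[OF max_ideal_maximal]]
  have img: "vext ` (K - {0}) = ereal ` \<int>"
  proof
    show "vext ` (K - {0}) \<subseteq> ereal ` \<int>" using vv_K_Ints by (auto simp: vext_def)
    have powK: "spole P powi m \<in> K" for m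
    proof -
      have 1: "x ^ n \<in> K" if "x \<in> K" for x and n :: nat
        using that by (induction n) (use base_subset_K base.one_mem K_mult in auto)
      have "inverse (spole P) \<in> K"
        using pl(1,4) unfolding frac_field_def by (auto simp: inverse_eq_divide) (metis divide_eq_0_iff)
      then show ?thesis using 1 pl(1) by (auto simp: power_int_def)
    qed
    show "ereal ` \<int> \<subseteq> vext ` (K - {0})"
    proof
      fix y assume "y \<in> ereal ` \<int>"
      then obtain m where m: "y = ereal (of_int m)" by (auto elim!: Ints_cases)
      have "vext (spole P powi (- m)) = y"
        using c_nonzero by (simp add: vext_def m v_powi v_c)
      then show "y \<in> vext ` (K - {0})" using powK c_nonzero by (metis DiffI imageI power_int_not_zero singletonD)
    qed
  qed
  have "val K \<OO> P = vext"
    unfolding val_def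
  proof (rule the_equality)
    show "rat_valuation vext \<and> {x. 0 \<le> vext x} = loc P \<and> vext ` (K - {0}) = ereal ` \<int>"
      using rat_valuation_vext vext_ring img by blast
    fix w assume w: "rat_valuation w \<and> {x. 0 \<le> w x} = loc P \<and> w ` (K - {0}) = ereal ` \<int>"
    show "w = vext"
      by (rule vext_unique[of w K]) (use w vv_K_Ints pl in auto)
  qed
  then show ?thesis by (simp add: vext_def)
qed

lemma value_group_eq: "value_group K \<OO> P = vv P ` (UNIV - {0})"
  unfolding value_group_def image_image by (intro image_cong) (auto simp: val_eq)

end

end

section \<open>The maximal spectrum\<close>

context dedekind_extension
begin

abbreviation \<X> where "\<X> \<equiv> mSpec \<OO>"

abbreviation basic_open :: "'a set \<Rightarrow> 'a set set" where
  "basic_open A \<equiv> {P \<in> spec. A \<subseteq> P}"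

text \<open>
  The valuations at the points of a fibre share the pole.
\<close>

definition fibre :: "'a set \<Rightarrow> 'a set set" where
  "fibre p = {P \<in> spec. P \<inter> \<oo> = p}"

definition base_primes :: "'a set set" where
  "base_primes = {p. maximalideal p (ring_on \<oo>) \<and> p \<noteq> {0}}"

lemma below_base_primes: "P \<in> spec \<Longrightarrow> P \<inter> \<oo> \<in> base_primes"
  using maximal_below by (auto simp: base_primes_def max_ideals_iff)

lemma openin_basic: "finite A \<Longrightarrow> A \<subseteq> \<OO> \<Longrightarrow> openin \<X> (basic_open A)"
  unfolding mSpec_def by (rule topology_generated_by_Basis) blast

lemma openin_mSpec_iff:
  "openin \<X> S \<longleftrightarrow>
     S \<subseteq> spec \<and> (\<forall>P\<in>S. \<exists>A. finite A \<and> A \<subseteq> P \<and> basic_open A \<subseteq> S)" (is "?l \<longleftrightarrow> ?r")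
proof
  assume l: ?l
  have "P \<in> S \<Longrightarrow> \<exists>A. finite A \<and> A \<subseteq> P \<and> basic_open A \<subseteq> S" for P
  proof -
    have "generate_topology_on {basic_open A | A. finite A \<and> A \<subseteq> \<OO>} S"
      using l unfolding mSpec_def openin_topology_generated_by_iff .
    then show "P \<in> S \<Longrightarrow> \<exists>A. finite A \<and> A \<subseteq> P \<and> basic_open A \<subseteq> S"
    proof (induction arbitrary: P rule: generate_topology_on.induct)
      case (Int a b)
      then have "P \<in> a" "P \<in> b" by auto
      from Int.IH(1)[OF this(1)] Int.IH(2)[OF this(2)]
      obtain A B where "finite A" "A \<subseteq> P" "basic_open A \<subseteq> a" "finite B" "B \<subseteq> P" "basic_open B \<subseteq> b"
        by (elim exE conjE) auto
      then show ?case by (intro exI[of _ "A \<union> B"]) auto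
    next
      case (UN K)
      then obtain k where k: "k \<in> K" "P \<in> k" by auto
      from UN.IH[OF this] obtain A where "finite A" "A \<subseteq> P" "basic_open A \<subseteq> k"
        by (elim exE conjE) auto
      then show ?case using k(1) by (intro exI[of _ A]) auto
    qed auto
  qed
  then show ?r using l openin_subset[of "\<X>" S] by (auto simp: topspace_mSpec)
next
  assume r: ?r
  show ?l
    unfolding openin_subopen[of _ S]
  proof
    fix P assume P: "P \<in> S"
    then obtain A where A: "finite A" "A \<subseteq> P" "basic_open A \<subseteq> S" using r by blast
    have "P \<in> spec" using r P by blast
    then have "A \<subseteq> \<OO>" using maximal_simps(1) A by (auto simp: max_ideals_iff)
    then show "\<exists>T. openin \<X> T \<and> P \<in> T \<and> T \<subseteq> S"
      using openin_basic A \<open>P \<in> spec\<close> by (intro exI[of _ "basic_open A"]) auto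
  qed
qed

text \<open>
  The basic open sets are closed as well: if \<open>s\<close> is not in \<open>P\<close>, then
  \<open>P\<close> contains some \<open>1 - r * s\<close>, and no maximal ideal contains both
  elements.
\<close>

lemma openin_notin:
  assumes s: "s \<in> \<OO>"
  shows "openin \<X> {P \<in> spec. s \<notin> P}"
  unfolding openin_mSpec_iff
proof (intro conjI ballI)
  fix P assume P: "P \<in> {P \<in> spec. s \<notin> P}"
  then obtain r where r: "r \<in> \<OO>" "1 - r * s \<in> P"
    using s by (auto simp: max_ideals_iff big.maximal_iff)
  have "s \<notin> Q" if Q: "Q \<in> spec" "1 - r * s \<in> Q" for Q
  proof
    assume "s \<in> Q"
    moreover have Qm: "maximalideal Q (ring_on \<OO>)" using Q by (simp add: max_ideals_iff)
    ultimately have "(1 - r * s) + r * s \<in> Q"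
      using maximal_simps(3)[OF Qm Q(2)] maximal_simps(4)[OF Qm r(1)] by blast
    then show False using maximal_simps(5) Q by (simp add: max_ideals_iff)
  qed
  then show "\<exists>A. finite A \<and> A \<subseteq> P \<and> basic_open A \<subseteq> {P \<in> spec. s \<notin> P}"
    using r by (intro exI[of _ "{1 - r * s}"]) auto
qed auto

lemma fibre_eq_contains:
  assumes p: "p \<in> base_primes"
  shows "fibre p = basic_open p"
proof
  show "fibre p \<subseteq> basic_open p" by (auto simp: fibre_def)
  show "basic_open p \<subseteq> fibre p"
  proof
    fix P assume P: "P \<in> basic_open p"
    then have m: "maximalideal (P \<inter> \<oo>) (ring_on \<oo>)" using maximal_below by (auto simp: max_ideals_iff)
    moreover have "p \<subseteq> P \<inter> \<oo>" using P p by (auto simp: base_primes_def base.maximal_iff base.ideal_iff)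
    moreover have "1 \<notin> P \<inter> \<oo>" "ideal (P \<inter> \<oo>) (ring_on \<oo>)" using m by (auto simp: base.maximal_iff)
    ultimately have "P \<inter> \<oo> = p"
      using p maximalideal.I_maximal[of p "ring_on \<oo>" "P \<inter> \<oo>"] by (auto simp: base_primes_def)
    then show "P \<in> fibre p" using P by (simp add: fibre_def)
  qed
qed

text \<open>
  As \<open>p\<close> is finitely generated, the fibre is a basic open set.
\<close>

lemma openin_fibre:
  assumes p: "p \<in> base_primes"
  shows "openin \<X> (fibre p)"
proof -
  have id: "ideal p (ring_on \<oo>)" using p by (auto simp: base_primes_def base.maximal_iff)
  obtain A where A: "finite A" "A \<subseteq> p" "\<And>J. ideal J (ring_on \<oo>) \<Longrightarrow> A \<subseteq> J \<Longrightarrow> p \<subseteq> J"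
    by (rule finitely_generated[OF id], rule that, assumption, assumption, blast)
  have po: "p \<subseteq> \<oo>" using id by (auto simp: base.ideal_iff)
  have "basic_open A = basic_open p"
  proof (intro equalityI subsetI)
    fix P assume P: "P \<in> basic_open A"
    then have "ideal (P \<inter> \<oo>) (ring_on \<oo>)" using maximal_below by (auto simp: max_ideals_iff base.maximal_iff)
    moreover have "A \<subseteq> P \<inter> \<oo>" using A(2) P po by auto
    ultimately have "p \<subseteq> P \<inter> \<oo>" by (rule A(3))
    then show "P \<in> basic_open p" using P by auto
  qed (use A in auto)
  then show ?thesis
    using openin_basic[OF A(1)] A(2) po base_subset fibre_eq_contains[OF p] by auto
qed

text \<open>
  Suppose a cover has no finite subcover. By Zorn's lemma there is a maximal set \<open>M\<close> such
  that, for every finite subset \<open>A\<close> of \<open>M\<close>, the points of the fibre that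
  contain \<open>A\<close> are not covered finitely. Maximality makes \<open>M\<close> a prime ideal
  over \<open>p\<close>, so \<open>M\<close> is itself a point of the fibre. It lies in a member of
  the cover, hence so do all points that contain a suitable finite \<open>A\<close> of its elements, a
  contradiction.
\<close>

lemma compactin_fibre:
  assumes p: "p \<in> base_primes"
  shows "compactin \<X> (fibre p)"
  unfolding compactin_def
proof (intro conjI allI impI)
  show "fibre p \<subseteq> topspace \<X>" by (auto simp: topspace_mSpec fibre_def)
  fix \<U> assume U: "Ball \<U> (openin \<X>) \<and> fibre p \<subseteq> \<Union>\<U>"
  have pm: "maximalideal p (ring_on \<oo>)" using p by (simp add: base_primes_def)
  then have po: "p \<subseteq> \<oo>" "1 \<notin> p" by (auto simp: base.maximal_iff base.ideal_iff)
  define cov where "cov Z \<longleftrightarrow> (\<exists>\<F>. finite \<F> \<and> \<F> \<subseteq> \<U> \<and> Z \<subseteq> \<Union>\<F>)" for Z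
  have cov_mono: "cov Z'" if "cov Z" "Z' \<subseteq> Z" for Z Z' using that unfolding cov_def by blast
  have cov_un: "cov (Z \<union> Z')" if "cov Z" "cov Z'" for Z Z'
  proof -
    obtain F F' where "finite F" "F \<subseteq> \<U>" "Z \<subseteq> \<Union>F" "finite F'" "F' \<subseteq> \<U>" "Z' \<subseteq> \<Union>F'"
      using \<open>cov Z\<close> \<open>cov Z'\<close> unfolding cov_def by blast
    then show ?thesis unfolding cov_def by (intro exI[of _ "F \<union> F'"]) auto
  qed
  have cov_empty: "cov {}" unfolding cov_def by (intro exI[of _ "{}"]) auto
  define W where "W A = fibre p \<inter> basic_open A" for A
  have "cov (fibre p)"
  proof (rule ccontr)
    assume ncov: "\<not> cov (fibre p)"
    define \<G> where "\<G> = {M. M \<subseteq> \<OO> \<and> (\<forall>A. finite A \<longrightarrow> A \<subseteq> M \<longrightarrow> \<not> cov (W A))}"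
    have "\<exists>M\<in>\<G>. \<forall>X\<in>\<G>. M \<subseteq> X \<longrightarrow> X = M"
    proof (rule subset_Zorn_nonempty)
      have "W {} = fibre p" by (auto simp: W_def fibre_def)
      then show "\<G> \<noteq> {}" using ncov unfolding \<G>_def by (auto intro!: exI[of _ "{}"])
      fix C assume C: "C \<noteq> {}" "subset.chain \<G> C"
      have "\<not> cov (W A)" if A: "finite A" "A \<subseteq> \<Union>C" for A
      proof -
        obtain M where "M \<in> C" "A \<subseteq> M"
          using finite_subset_Union_chain[OF A C] by blast
        then show ?thesis using C(2) A(1) by (auto simp: subset_chain_def \<G>_def)
      qed
      moreover have "\<Union>C \<subseteq> \<OO>" using C(2) by (auto simp: subset_chain_def \<G>_def)
      ultimately show "\<Union>C \<in> \<G>" by (simp add: \<G>_def)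
    qed
    then obtain M where M: "M \<in> \<G>" "\<And>X. X \<in> \<G> \<Longrightarrow> M \<subseteq> X \<Longrightarrow> X = M" by blast
    have MO: "M \<subseteq> \<OO>" and Mn: "\<And>A. finite A \<Longrightarrow> A \<subseteq> M \<Longrightarrow> \<not> cov (W A)" using M(1) by (auto simp: \<G>_def)
    have outside: "\<exists>A. finite A \<and> A \<subseteq> M \<and> cov (W (insert z A))" if z: "z \<in> \<OO>" "z \<notin> M" for z
    proof -
      have "insert z M \<notin> \<G>" using M(2)[of "insert z M"] z by blast
      then obtain A where A: "finite A" "A \<subseteq> insert z M" "cov (W A)" using MO z by (auto simp: \<G>_def)
      have "W (insert z (A - {z})) \<subseteq> W A" by (auto simp: W_def)
      then have "cov (W (insert z (A - {z})))" using cov_mono A(3) by blast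
      then show ?thesis using A by (intro exI[of _ "A - {z}"]) auto
    qed
    have inside: "z \<in> M" if z: "z \<in> \<OO>" "finite A" "A \<subseteq> M" "\<And>P. P \<in> W A \<Longrightarrow> z \<in> P" for z A
    proof (rule ccontr)
      assume "z \<notin> M"
      then obtain B where B: "finite B" "B \<subseteq> M" "cov (W (insert z B))" using outside z(1) by blast
      have "W (A \<union> B) \<subseteq> W (insert z B)" using z(4) by (auto simp: W_def)
      then have "cov (W (A \<union> B))" using cov_mono B(3) by blast
      then show False using Mn[of "A \<union> B"] B z by auto
    qed
    have PI: "P \<in> W A \<Longrightarrow> maximalideal P (ring_on \<OO>)" for P A by (auto simp: W_def max_ideals_iff)
    have idl: "ideal M (ring_on \<OO>)"
      unfolding big.ideal_iff
    proof (intro conjI ballI MO)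
      show "0 \<in> M" by (rule inside[of _ "{}"]) (use PI maximal_simps(2) in auto)
      show "x + y \<in> M" if "x \<in> M" "y \<in> M" for x y
      proof (rule inside[of _ "{x, y}"])
        show "x + y \<in> \<OO>" using that MO by blast
        fix P assume P: "P \<in> W {x, y}"
        then have "x \<in> P" "y \<in> P" by (auto simp: W_def)
        then show "x + y \<in> P" using maximal_simps(3)[OF PI[OF P]] by blast
      qed (use that in auto)
      show "r * x \<in> M" if "r \<in> \<OO>" "x \<in> M" for r x
      proof (rule inside[of _ "{x}"])
        show "r * x \<in> \<OO>" using that MO by blast
        fix P assume P: "P \<in> W {x}"
        then have "x \<in> P" by (auto simp: W_def)
        then show "r * x \<in> P" using maximal_simps(4)[OF PI[OF P]] that by blast
      qed (use that in auto)
    qed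
    have prime: "primeideal M (ring_on \<OO>)"
      unfolding big.prime_iff
    proof (intro conjI ballI impI idl)
      show "1 \<notin> M"
      proof
        assume "1 \<in> M"
        moreover have "W {1} = {}" using PI maximal_simps(5) by (auto simp: W_def max_ideals_iff)
        ultimately show False using Mn[of "{1}"] cov_empty by simp
      qed
      fix x y assume xy: "x \<in> \<OO>" "y \<in> \<OO>" "x * y \<in> M"
      show "x \<in> M \<or> y \<in> M"
      proof (rule ccontr)
        assume "\<not> (x \<in> M \<or> y \<in> M)"
        then obtain A B where AB: "finite A" "A \<subseteq> M" "cov (W (insert x A))"
          "finite B" "B \<subseteq> M" "cov (W (insert y B))"
          using outside xy by meson
        have "W (insert (x * y) (A \<union> B)) \<subseteq> W (insert x A) \<union> W (insert y B)"
        proof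
          fix P assume P: "P \<in> W (insert (x * y) (A \<union> B))"
          then have "x \<in> P \<or> y \<in> P" using maximal_simps(6)[OF PI[OF P] xy(1,2)] by (auto simp: W_def)
          then show "P \<in> W (insert x A) \<union> W (insert y B)" using P by (auto simp: W_def)
        qed
        then have "cov (W (insert (x * y) (A \<union> B)))" using cov_mono cov_un AB by blast
        then show False using Mn[of "insert (x * y) (A \<union> B)"] AB xy by auto
      qed
    qed
    have "p \<subseteq> M"
    proof
      fix x assume x: "x \<in> p"
      show "x \<in> M" by (rule inside[of _ "{}"]) (use x po base_subset in \<open>auto simp: W_def fibre_def\<close>)
    qed
    have "ideal (M \<inter> \<oo>) (ring_on \<oo>)"
      unfolding base.ideal_iff using idl base_subset by (auto simp: big.ideal_iff)
    then have "M \<inter> \<oo> = p"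
      using maximalideal.I_maximal[OF pm, of "M \<inter> \<oo>"] \<open>p \<subseteq> M\<close> po prime by (auto simp: big.prime_iff)
    then have "M \<in> fibre p"
      using prime_over_maximal[OF prime] pm by (simp add: fibre_def max_ideals_iff)
    then obtain u where u: "u \<in> \<U>" "M \<in> u" using U by blast
    then have "openin \<X> u" using U by blast
    then obtain A where A: "finite A" "A \<subseteq> M" "basic_open A \<subseteq> u"
      using u(2) unfolding openin_mSpec_iff by blast
    have "cov (W A)" unfolding cov_def by (rule exI[of _ "{u}"]) (use A u in \<open>auto simp: W_def\<close>)
    then show False using Mn A by blast
  qed
  then show "\<exists>\<F>. finite \<F> \<and> \<F> \<subseteq> \<U> \<and> fibre p \<subseteq> \<Union>\<F>" by (simp add: cov_def)
qed

definition fibres :: "'a set set \<Rightarrow> 'a set set" where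
  "fibres F = {P \<in> spec. P \<inter> \<oo> \<in> F}"

lemma compactin_fibres:
  assumes "finite F" "F \<subseteq> base_primes"
  shows "compactin \<X> (fibres F)"
proof -
  have "fibres F = \<Union>(fibre ` F)" by (auto simp: fibres_def fibre_def)
  moreover have "compactin \<X> (\<Union>(fibre ` F))"
    by (rule compactin_Union) (use assms compactin_fibre in auto)
  ultimately show ?thesis by simp
qed

lemma compactin_imp_fibres:
  assumes "compactin \<X> Y"
  obtains F where "finite F" "F \<subseteq> base_primes" "Y \<subseteq> fibres F"
proof -
  have "Y \<subseteq> \<Union>(fibre ` base_primes)"
    using compactin_subset_topspace[OF assms] below_base_primes
    by (force simp: topspace_mSpec fibre_def)
  moreover have "\<forall>u\<in>fibre ` base_primes. openin \<X> u" using openin_fibre by auto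
  ultimately obtain G where "finite G" "G \<subseteq> fibre ` base_primes" "Y \<subseteq> \<Union>G"
    using assms unfolding compactin_def by meson
  moreover from this obtain F where "F \<subseteq> base_primes" "finite F" "G = fibre ` F"
    by (meson finite_subset_image)
  moreover have "\<Union>(fibre ` F) = fibres F" by (auto simp: fibres_def fibre_def)
  ultimately show thesis using that[of F] by simp
qed

subsection \<open>Values as functions on the spectrum\<close>

lemma openin_vv_nonneg:
  assumes y: "y \<noteq> 0"
  shows "openin \<X> {P \<in> spec. 0 \<le> vv P y}" (is "openin _ ?S")
  unfolding openin_subopen[of _ ?S]
proof
  fix P assume "P \<in> ?S"
  then have P: "P \<in> spec" "y \<in> loc P" using vv_nonneg_iff y by auto
  then obtain a s where as: "a \<in> \<OO>" "s \<in> \<OO> - P" "y = a / s" by (auto simp: localization_def)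
  have "0 \<le> vv Q y" if "Q \<in> spec" "s \<notin> Q" for Q
    using that as vv_nonneg_iff[OF that(1) y] by (auto simp: localization_def)
  then show "\<exists>T. openin \<X> T \<and> P \<in> T \<and> T \<subseteq> ?S"
    using openin_notin[of s] as P by (intro exI[of _ "{Q \<in> spec. s \<notin> Q}"]) auto
qed

lemma vv_zero_outside:
  assumes P: "P \<in> spec" and a: "a \<in> \<OO> - P"
  shows "vv P a = 0"
proof -
  have "a \<noteq> 0" using a maximal_simps(2) P by (auto simp: max_ideals_iff)
  then show ?thesis using vv_pos_iff[OF P, of a] vv_nonneg[OF P, of a] a by auto
qed

text \<open>
  Both sides are the exponent from \<open>pole_power\<close>.
\<close>

lemma vv_base_fibre:
  assumes PQ: "P \<in> spec" "Q \<in> spec" "P \<inter> \<oo> = Q \<inter> \<oo>" and x: "x \<in> \<oo>" "x \<noteq> 0"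
  shows "vv P x = vv Q x"
proof -
  have mb: "maximalideal (P \<inter> \<oo>) (ring_on \<oo>)" "P \<inter> \<oo> \<noteq> {0}" 
    using maximal_below PQ(1) by (auto simp: max_ideals_iff)
  obtain n where n: "x * spole P ^ n \<in> \<oo> - (P \<inter> \<oo>)" using pole_power[OF mb x] by blast
  have c0: "spole P \<noteq> 0" using pole(4)[OF mb] .
  have "vv R x = n" if R: "R \<in> spec" "R \<inter> \<oo> = P \<inter> \<oo>" for R
  proof -
    have "x * spole R ^ n \<in> \<OO> - R" using n R base_subset by auto
    then have "vv R (x * spole R ^ n) = 0" using vv_zero_outside R by blast
    then show ?thesis
      using c0 x R(2) vv_spole[OF R(1)] by (simp add: vv_mult[OF R(1)] vv_power[OF R(1)])
  qed
  then show ?thesis using PQ by metis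
qed

text \<open>
  If \<open>y\<close> has value \<open>m / n\<close> at \<open>P\<close> and \<open>c\<close> is the
  pole of the fibre of \<open>P\<close>, then on this fibre \<open>y\<close> has the same value
  exactly where \<open>y ^ n * c powi m\<close> has value 0, an open condition.
\<close>

lemma vv_locally_constant:
  assumes P: "P \<in> spec" and y: "y \<noteq> 0"
  shows "\<exists>T. openin \<X> T \<and> P \<in> T \<and> (\<forall>Q\<in>T. vv Q y = vv P y)"
proof -
  define c where "c = spole P"
  have c0: "c \<noteq> 0" using pole(4) maximal_below P by (auto simp: c_def max_ideals_iff)
  obtain n m where nm: "n > (0::nat)" "vv P y = of_int m / of_nat n" using vv_rational[OF P y] by blast
  define z where "z = y ^ n * c powi m"
  have z0: "z \<noteq> 0" using y c0 by (simp add: z_def)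
  have vz: "vv Q z = n * vv Q y - m" if "Q \<in> fibre (P \<inter> \<oo>)" for Q
  proof -
    have Q: "Q \<in> spec" "spole Q = c" using that by (auto simp: fibre_def c_def)
    show ?thesis using y c0 vv_spole[OF Q(1)] Q by (simp add: z_def vv_mult vv_power vv_powi)
  qed
  define T where "T = fibre (P \<inter> \<oo>) \<inter> {Q \<in> spec. 0 \<le> vv Q z} \<inter> {Q \<in> spec. 0 \<le> vv Q (inverse z)}"
  have "openin \<X> T"
    unfolding T_def
    by (intro openin_Int openin_fibre below_base_primes P openin_vv_nonneg) (use z0 in auto)
  moreover have PT: "P \<in> fibre (P \<inter> \<oo>)" using P by (simp add: fibre_def)
  have "vv P z = 0" using vz[OF PT] nm by simp
  then have "P \<in> T" using PT P z0 by (simp add: T_def vv_inverse)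
  moreover have "vv Q y = vv P y" if "Q \<in> T" for Q
  proof -
    have "vv Q z = 0" using that z0 by (auto simp: T_def vv_inverse)
    then have "n * vv Q y = m" using vz[of Q] that by (simp add: T_def)
    then have "n * vv Q y = n * vv P y" using nm by simp
    then show ?thesis using nm(1) by simp
  qed
  ultimately show ?thesis by blast
qed

lemma openin_vv:
  assumes y: "y \<noteq> 0"
  shows "openin \<X> {P \<in> spec. \<phi> (vv P y)}" (is "openin _ ?S")
  unfolding openin_subopen[of _ ?S]
proof
  fix P assume P: "P \<in> ?S"
  then have "P \<in> spec" by simp
  from vv_locally_constant[OF this y]
  obtain T where T: "openin \<X> T \<and> P \<in> T \<and> (\<forall>Q\<in>T. vv Q y = vv P y)" ..
  have "T \<subseteq> ?S"
  proof
    fix Q assume Q: "Q \<in> T"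
    then have "Q \<in> spec" using T openin_subset[of "\<X>" T] unfolding topspace_mSpec by blast
    moreover have "vv Q y = vv P y" using T Q by metis
    ultimately show "Q \<in> ?S" using P by simp
  qed
  then show "\<exists>T. openin \<X> T \<and> P \<in> T \<and> T \<subseteq> ?S" using T by blast
qed

text \<open>
  Choose \<open>d\<close> in \<open>\<oo>\<close> with \<open>d * y\<close> integral and a common
  multiple \<open>n\<close> in \<open>\<oo>\<close> of \<open>d\<close> and \<open>d * y\<close>. The
  value of \<open>y\<close> is 0 unless \<open>P\<close> contains \<open>n\<close>, and only finitely
  many primes of \<open>\<oo>\<close> do.
\<close>

lemma vv_finite_support:
  assumes y: "y \<noteq> 0"
  obtains F where "finite F" "F \<subseteq> base_primes" "\<And>P. P \<in> spec - fibres F \<Longrightarrow> vv P y = 0"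
proof -
  obtain d where d: "d \<in> \<oo>" "d \<noteq> 0" "d * y \<in> \<OO>" using ex_denominator by blast
  obtain z where z: "z \<in> \<OO>" "d * y * z \<in> \<oo>" "d * y * z \<noteq> 0"
    using multiple_in_base[of "d * y"] d y by auto
  define n where "n = d * (d * y * z)"
  have n: "n \<in> \<oo>" "n \<noteq> 0" using d z by (auto simp: n_def)
  define I where "I = {r * n | r. r \<in> \<oo>}"
  have I: "ideal I (ring_on \<oo>)"
    unfolding base.ideal_iff
  proof (intro conjI ballI)
    show "I \<subseteq> \<oo>" using n by (auto simp: I_def)
    show "0 \<in> I" by (auto simp: I_def intro!: exI[of _ 0])
    show "x + y \<in> I" if "x \<in> I" "y \<in> I" for x y
      using that unfolding I_def by (auto simp flip: distrib_right)
    show "r * x \<in> I" if "r \<in> \<oo>" "x \<in> I" for r x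
      using that unfolding I_def by (auto simp flip: mult.assoc)
  qed
  have nI: "n \<in> I" unfolding I_def by (auto intro!: exI[of _ 1])
  then have I0: "I \<noteq> {0}" using n by auto
  define F where "F = {p. maximalideal p (ring_on \<oo>) \<and> I \<subseteq> p}"
  have "finite F" unfolding F_def by (rule finite_primes_containing[OF I I0])
  moreover have "F \<subseteq> base_primes" using nI n by (auto simp: F_def base_primes_def)
  moreover have "vv P y = 0" if P: "P \<in> spec - fibres F" for P
  proof -
    have Pm: "P \<in> spec" "maximalideal P (ring_on \<OO>)" using P by (auto simp: max_ideals_iff)
    have "n \<notin> P"
    proof
      assume nP: "n \<in> P"
      have "I \<subseteq> P \<inter> \<oo>"
      proof
        fix x assume "x \<in> I"
        then obtain r where "r \<in> \<oo>" "x = r * n" by (auto simp: I_def)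
        then show "x \<in> P \<inter> \<oo>" using nP n maximal_simps(4)[OF Pm(2), of r n] base_subset by auto
      qed
      then have "P \<in> fibres F" using Pm maximal_below(1)[OF Pm(2)] by (simp add: fibres_def F_def)
      then show False using P by simp
    qed
    then have "d \<notin> P" "d * y \<notin> P"
      using maximal_simps(4)[OF Pm(2), of "d * y * z" d] maximal_simps(4)[OF Pm(2), of "d * z" "d * y"] d z base_subset
      by (auto simp: n_def mult_ac)
    then have "vv P d = 0" "vv P (d * y) = 0"
      using vv_zero_outside[OF Pm(1)] d base_subset by auto
    then show ?thesis using vv_mult[OF Pm(1) d(2) y] by simp
  qed
  ultimately show thesis using that by blast
qed

lemma vv_base_bounded:
  assumes n: "n \<in> \<oo>" "n \<noteq> 0"
  shows "\<exists>B. \<forall>P\<in>spec. vv P n \<le> B"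
proof -
  obtain F where F: "finite F" "F \<subseteq> base_primes" "\<And>P. P \<in> spec - fibres F \<Longrightarrow> vv P n = 0"
    by (rule vv_finite_support[OF n(2)], rule that, assumption, assumption, blast)
  define g where "g p = vv (SOME P. P \<in> fibre p) n" for p
  have "vv P n \<in> insert 0 (g ` F)" if P: "P \<in> spec" for P
  proof (cases "P \<in> fibres F")
    case True
    have "(SOME Q. Q \<in> fibre (P \<inter> \<oo>)) \<in> fibre (P \<inter> \<oo>)"
      by (rule someI[of _ P]) (use P in \<open>simp add: fibre_def\<close>)
    then have "vv P n = g (P \<inter> \<oo>)" using P n unfolding g_def by (intro vv_base_fibre) (auto simp: fibre_def)
    then show ?thesis using True by (auto simp: fibres_def)
  next
    case False
    then show ?thesis using F(3) P by simp
  qed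
  moreover have "finite (insert 0 (g ` F))" using F by simp
  ultimately show ?thesis by (meson Max_ge)
qed

lemma vv_bounded:
  assumes y: "y \<noteq> 0"
  obtains B where "\<And>P. P \<in> spec \<Longrightarrow> \<bar>vv P y\<bar> \<le> B"
proof -
  obtain d where d: "d \<in> \<oo>" "d \<noteq> 0" "d * y \<in> \<OO>" using ex_denominator by blast
  obtain z where z: "z \<in> \<OO>" "d * y * z \<in> \<oo>" "d * y * z \<noteq> 0"
    using multiple_in_base[of "d * y"] d y by auto
  obtain B B' where B: "\<And>P. P \<in> spec \<Longrightarrow> vv P d \<le> B" "\<And>P. P \<in> spec \<Longrightarrow> vv P (d * y * z) \<le> B'"
    using vv_base_bounded[OF d(1,2)] vv_base_bounded[OF z(2,3)] by blast
  have "\<bar>vv P y\<bar> \<le> \<bar>B\<bar> + \<bar>B'\<bar>" if P: "P \<in> spec" for P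
  proof -
    have z0: "z \<noteq> 0" using z by auto
    have "vv P (d * y * z) = vv P (d * y) + vv P z" "vv P (d * y) = vv P d + vv P y"
      using vv_mult[OF P] d y z0 by auto
    moreover have "0 \<le> vv P d" "0 \<le> vv P (d * y)" "0 \<le> vv P z"
      using vv_nonneg[OF P] d y z z0 base_subset by auto
    ultimately show ?thesis using B[OF P] by linarith
  qed
  then show thesis using that by blast
qed

end

section \<open>Fractional ideals and semicontinuous functions\<close>

lemma RT_less_eq: "RT a s \<le> RT b t \<longleftrightarrow> a < b \<or> (a = b \<and> s \<le> t)"
  by (auto simp: less_eq_rtilde_def)

lemma RT_less: "RT a s < RT b t \<longleftrightarrow> a < b \<or> (a = b \<and> \<not> s \<and> t)"
  by auto

lemma rtilde_add_mono: "a \<le> b \<Longrightarrow> c \<le> d \<Longrightarrow> a + c \<le> b + (d::rtilde)"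
  by (cases a; cases b; cases c; cases d) (auto simp: RT_less_eq max_def)

declare less_rtilde.simps [simp del]

context dedekind_extension
begin

abbreviation ft where "ft \<equiv> f_tilde K \<OO>"

definition rv :: "'a set \<Rightarrow> 'a \<Rightarrow> rtilde" where "rv P x = RT (vv P x) False"

text \<open>
  In a linear order, the second condition says that nothing above \<open>t\<close> is a lower bound.
\<close>

definition is_glb :: "'a set \<Rightarrow> 'a set \<Rightarrow> rtilde \<Rightarrow> bool" where
  "is_glb P I t \<longleftrightarrow> (\<forall>x\<in>I - {0}. t \<le> rv P x) \<and> (\<forall>a>t. \<exists>x\<in>I - {0}. rv P x < a)"

lemma is_glb_unique: "is_glb P I t \<Longrightarrow> is_glb P I u \<Longrightarrow> t = u"
  unfolding is_glb_def by (metis leD linorder_less_linear)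

lemma rv_mult: "P \<in> spec \<Longrightarrow> x \<noteq> 0 \<Longrightarrow> y \<noteq> 0 \<Longrightarrow> rv P (x * y) = rv P x + rv P y"
  by (simp add: rv_def vv_mult)

lemma rv_nonneg: "P \<in> spec \<Longrightarrow> r \<in> \<OO> \<Longrightarrow> r \<noteq> 0 \<Longrightarrow> 0 \<le> rv P r"
  using vv_nonneg by (auto simp: rv_def zero_rtilde_def RT_less_eq less_eq_real_def)

lemma rv_add:
  assumes "P \<in> spec" "x \<noteq> 0" "y \<noteq> 0" "x + y \<noteq> 0" "t \<le> rv P x" "t \<le> rv P y"
  shows "t \<le> rv P (x + y)"
  using vv_add[OF assms(1-4)] assms(5,6) by (cases t) (auto simp: rv_def RT_less_eq min_def split: if_splits)

context
  fixes I assumes I: "fractional_ideal \<OO> I"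
begin

lemma frac_nonzero: "\<exists>x\<in>I - {0}. True"
  using I by (auto simp: fractional_ideal_def)

lemma frac_mult: "r \<in> \<OO> \<Longrightarrow> x \<in> I \<Longrightarrow> r * x \<in> I"
  using I by (auto simp: fractional_ideal_def)

lemma frac_add: "x \<in> I \<Longrightarrow> y \<in> I \<Longrightarrow> x + y \<in> I"
  using I by (auto simp: fractional_ideal_def)

lemma frac_zero: "0 \<in> I"
  using I by (auto simp: fractional_ideal_def)

lemma frac_bounded: "\<exists>d. d \<noteq> 0 \<and> (\<forall>x\<in>I. d * x \<in> \<OO>)"
  using I by (simp add: fractional_ideal_def)

lemma frac_denominator: "\<exists>d. d \<noteq> 0 \<and> (\<forall>P\<in>spec. \<forall>x\<in>I - {0}. - vv P d \<le> vv P x)"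
proof -
  obtain d where d: "d \<noteq> 0" "\<And>x. x \<in> I \<Longrightarrow> d * x \<in> \<OO>"
    using frac_bounded by auto
  have "- vv P d \<le> vv P x" if P: "P \<in> spec" and x: "x \<in> I - {0}" for P x
    using vv_nonneg[OF P, of "d * x"] vv_mult[OF P d(1), of x] d x by auto
  then show ?thesis using d(1) by blast
qed

text \<open>
  An attained infimum \<open>f\<close> is the value \<open>(f, 0)\<close> itself. If it is not
  attained, all values exceed \<open>f\<close> and come arbitrarily close to it, so the lower bounds
  are those up to \<open>(f, 1)\<close>.
\<close>

lemma is_glb_f_tilde:
  assumes P: "P \<in> spec"
  shows "is_glb P I (ft I P)"
proof -
  obtain x0 where x0: "x0 \<in> I" "x0 \<noteq> 0" using frac_nonzero by blast
  obtain d where d: "d \<noteq> 0" "\<And>x. x \<in> I - {0} \<Longrightarrow> - vv P d \<le> vv P x"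
    using frac_denominator P by blast
  define F where "F = f_ideal K \<OO> I P"
  have le: "F \<le> val K \<OO> P x" if "x \<in> I" for x
    unfolding F_def f_ideal_def by (rule INF_lower[OF that])
  have "ereal (- vv P d) \<le> F"
    unfolding F_def f_ideal_def
  proof (rule INF_greatest)
    fix x assume "x \<in> I"
    then show "ereal (- vv P d) \<le> val K \<OO> P x" using d(2)[of x] by (simp add: val_eq[OF P])
  qed
  moreover have "F \<le> ereal (vv P x0)" using le[OF x0(1)] x0 by (simp add: val_eq[OF P])
  ultimately obtain f where f: "F = ereal f" by (cases F) auto
  have mx: "P \<in> Max_ideal K \<OO> I \<longleftrightarrow> (\<exists>x\<in>I - {0}. vv P x = f)"
    using P by (auto simp: Max_ideal_def F_def[symmetric] f val_eq[OF P] split: if_splits)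
  have ft: "ft I P = RT f (P \<notin> Max_ideal K \<OO> I)"
    using P by (simp add: f_tilde_def F_def[symmetric] f)
  have lef: "f \<le> vv P x" if "x \<in> I - {0}" for x
    using le[of x] that by (simp add: f val_eq[OF P])
  have near: "\<exists>x\<in>I - {0}. vv P x < \<alpha>" if "f < \<alpha>" for \<alpha>
  proof -
    have "F < ereal \<alpha>" using that f by simp
    then obtain x where "x \<in> I" "val K \<OO> P x < ereal \<alpha>"
      unfolding F_def f_ideal_def INF_less_iff by blast
    then show ?thesis by (intro bexI[of _ x]) (auto simp: val_eq[OF P] split: if_splits)
  qed
  show ?thesis
    unfolding is_glb_def ft
  proof (intro conjI ballI allI impI)
    fix x assume "x \<in> I - {0}"
    then show "RT f (P \<notin> Max_ideal K \<OO> I) \<le> rv P x"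
      using lef[of x] mx by (auto simp: rv_def RT_less_eq less_eq_real_def)
  next
    fix a assume a: "RT f (P \<notin> Max_ideal K \<OO> I) < a"
    obtain \<alpha> s where as: "a = RT \<alpha> s" by (cases a)
    show "\<exists>x\<in>I - {0}. rv P x < a"
    proof (cases "f < \<alpha>")
      case True
      then show ?thesis using near by (auto simp: rv_def as RT_less)
    next
      case False
      then have "f = \<alpha>" "s" "P \<in> Max_ideal K \<OO> I" using a by (auto simp: as RT_less)
      then show ?thesis using mx by (auto simp: rv_def as RT_less)
    qed
  qed
qed

lemma f_tilde_le: "P \<in> spec \<Longrightarrow> x \<in> I \<Longrightarrow> x \<noteq> 0 \<Longrightarrow> ft I P \<le> rv P x"
  using is_glb_f_tilde unfolding is_glb_def by blast

lemma f_tilde_less_iff: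
  assumes "P \<in> spec"
  shows "ft I P < a \<longleftrightarrow> (\<exists>x\<in>I - {0}. rv P x < a)"
  using is_glb_f_tilde[OF assms] unfolding is_glb_def by (meson le_less_trans)

text \<open>A fractional ideal is the intersection of its localizations, which are determined
  by the greatest lower bounds of the values.\<close>

lemma mem_frac_iff:
  assumes x: "x \<noteq> 0"
  shows "x \<in> I \<longleftrightarrow> (\<forall>P\<in>spec. ft I P \<le> rv P x)"
proof
  show "x \<in> I \<Longrightarrow> \<forall>P\<in>spec. ft I P \<le> rv P x" using f_tilde_le x by blast
  assume le: "\<forall>P\<in>spec. ft I P \<le> rv P x"
  define J where "J = {s \<in> \<OO>. s * x \<in> I}"
  have J: "ideal J (ring_on \<OO>)"
    unfolding big.ideal_iff
  proof (intro conjI ballI)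
    show "0 \<in> J" using frac_zero by (auto simp: J_def)
    show "s + t \<in> J" if "s \<in> J" "t \<in> J" for s t
      using that frac_add by (auto simp: J_def distrib_right)
    show "r * s \<in> J" if "r \<in> \<OO>" "s \<in> J" for r s
      using that frac_mult by (auto simp: J_def mult.assoc)
  qed (auto simp: J_def)
  have "1 \<in> J"
  proof (rule ccontr)
    assume "1 \<notin> J"
    then obtain P where P: "maximalideal P (ring_on \<OO>)" "J \<subseteq> P"
      using big.exists_maximal_ideal[OF J] by blast
    then have Pm: "P \<in> spec" by (simp add: max_ideals_iff)
    \<comment> \<open>Passing from flag 0 to flag 1 makes the inequality strict, so the bound yields some \<open>y\<close>.\<close>
    have "ft I P < RT (vv P x) True"
      using le Pm by (cases "ft I P") (auto simp: rv_def RT_less_eq RT_less)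
    then obtain y where y: "y \<in> I" "y \<noteq> 0" "vv P y \<le> vv P x"
      using f_tilde_less_iff[OF Pm] by (auto simp: rv_def RT_less less_eq_real_def)
    have "0 \<le> vv P (x * inverse y)" using y x vv_mult[OF Pm] vv_inverse[OF Pm] by simp
    then have "x * inverse y \<in> loc P" using vv_nonneg_iff[OF Pm, of "x * inverse y"] x y by simp
    then obtain a s where as: "a \<in> \<OO>" "s \<in> \<OO> - P" "x * inverse y = a / s" by (auto simp: localization_def)
    have "s \<noteq> 0" using as maximal_simps(2)[OF P(1)] by auto
    then have "s * x = a * y" using as(3) y by (simp add: field_simps)
    then have "s \<in> J" using as y frac_mult by (simp add: J_def)
    then show False using as P by blast
  qed
  then show "x \<in> I" by (simp add: J_def)
qed

end

lemma f_tilde_inj: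
  assumes "fractional_ideal \<OO> I" "fractional_ideal \<OO> J" "ft I = ft J"
  shows "I = J"
proof -
  have "x \<in> I \<longleftrightarrow> x \<in> J" for x
    using mem_frac_iff[OF assms(1), of x] mem_frac_iff[OF assms(2), of x] assms(3)
      frac_zero[OF assms(1)] frac_zero[OF assms(2)] by (cases "x = 0") auto
  then show ?thesis by blast
qed

lemma f_tilde_eqI:
  assumes "fractional_ideal \<OO> I" "g \<in> extensional (spec)"
    "\<And>P. P \<in> spec \<Longrightarrow> is_glb P I (g P)"
  shows "ft I = g"
proof (rule extensionalityI[of _ "spec"])
  show "ft I \<in> extensional (spec)" by (simp add: f_tilde_def)
qed (use assms is_glb_unique is_glb_f_tilde in blast)+

subsection \<open>Products\<close>

lemma ambient_prod_closed: "x \<in> I \<Longrightarrow> y \<in> J \<Longrightarrow> x * y \<in> ideal_prod ambient I J"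
  using ideal_prod.prod[of x I y J ambient] by simp

lemma ambient_sum_closed: "x \<in> ideal_prod ambient I J \<Longrightarrow> y \<in> ideal_prod ambient I J \<Longrightarrow> x + y \<in> ideal_prod ambient I J"
  using ideal_prod.sum[of x ambient I J y] by simp

lemma fractional_ideal_prod:
  assumes I: "fractional_ideal \<OO> I" and J: "fractional_ideal \<OO> J"
  shows "fractional_ideal \<OO> (ideal_prod ambient I J)" (is "fractional_ideal _ ?IJ")
proof -
  obtain x y where xy: "x \<in> I" "x \<noteq> 0" "y \<in> J" "y \<noteq> 0"
    using frac_nonzero[OF I] frac_nonzero[OF J] by auto
  obtain d where d: "d \<noteq> 0" "\<And>x. x \<in> I \<Longrightarrow> d * x \<in> \<OO>"
    using frac_bounded[OF I] by auto
  obtain e where e: "e \<noteq> 0" "\<And>x. x \<in> J \<Longrightarrow> e * x \<in> \<OO>"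
    using frac_bounded[OF J] by auto
  have "0 * y \<in> ?IJ" using frac_zero[OF I] xy by (intro ambient_prod_closed)
  moreover have "x * y \<in> ?IJ" using xy by (intro ambient_prod_closed)
  moreover have "r * z \<in> ?IJ" if "z \<in> ?IJ" "r \<in> \<OO>" for r z
    using that
  proof (induction rule: ideal_prod.induct)
    case (prod i j)
    then have "(r * i) * j \<in> ?IJ" using frac_mult[OF I] by (intro ambient_prod_closed)
    then show ?case by (simp add: mult.assoc)
  next
    case (sum s t) then show ?case using ambient_sum_closed by (simp add: distrib_left)
  qed
  moreover have "(d * e) * z \<in> \<OO>" if "z \<in> ?IJ" for z
    using that
  proof (induction rule: ideal_prod.induct)
    case (prod i j)
    then have "(d * i) * (e * j) \<in> \<OO>" using d e by blast
    then show ?case by (simp add: mult_ac)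
  next
    case (sum s t) then show ?case by (auto simp: distrib_left)
  qed
  ultimately show ?thesis
    unfolding fractional_ideal_def using xy d e ambient_sum_closed
    by (intro conjI ballI exI[of _ "d * e"]) auto
qed

text \<open>
  The values of \<open>I J\<close> lie above the sum of the two bounds, by the ultrametric inequality.
  Conversely, products of elements whose values are close to the two bounds come close to the sum; if
  neither flag is set, both bounds are attained and so is their sum.
\<close>

lemma f_tilde_prod:
  assumes I: "fractional_ideal \<OO> I" and J: "fractional_ideal \<OO> J" and P: "P \<in> spec"
  shows "ft (ideal_prod ambient I J) P = ft I P + ft J P"
proof -
  define t u where "t = ft I P" and "u = ft J P"
  have t: "is_glb P I t" and u: "is_glb P J u" using is_glb_f_tilde I J P by (auto simp: t_def u_def)
  have low: "z = 0 \<or> t + u \<le> rv P z" if "z \<in> ideal_prod ambient I J" for z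
    using that
  proof (induction rule: ideal_prod.induct)
    case (prod i j)
    have "t + u \<le> rv P i + rv P j" if "i \<noteq> 0" "j \<noteq> 0"
      using t u prod that by (intro rtilde_add_mono) (auto simp: is_glb_def)
    then show ?case using rv_mult[OF P, of i j] by (cases "i = 0 \<or> j = 0") auto
  next
    case (sum a b)
    then show ?case
      using rv_add[OF P, of a b "t + u"] by (cases "a = 0 \<or> b = 0 \<or> a + b = 0") auto
  qed
  have "is_glb P (ideal_prod ambient I J) (t + u)"
    unfolding is_glb_def
  proof (intro conjI ballI allI impI)
    show "t + u \<le> rv P x" if "x \<in> ideal_prod ambient I J - {0}" for x using low that by blast
    fix a assume a: "t + u < a"
    obtain f s where tf: "t = RT f s" by (cases t)
    obtain g r where ug: "u = RT g r" by (cases u)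
    obtain \<alpha> q where aq: "a = RT \<alpha> q" by (cases a)
    have "\<exists>x\<in>I - {0}. \<exists>y\<in>J - {0}. rv P x + rv P y < a"
    proof (cases "f + g < \<alpha>")
      case True
      define e where "e = (\<alpha> - (f + g)) / 2"
      have e: "e > 0" "f + e + (g + e) = \<alpha>" using True by (simp_all add: e_def field_simps)
      have "t < RT (f + e) False" "u < RT (g + e) False" using e by (simp_all add: tf ug RT_less)
      then obtain x y where "x \<in> I - {0}" "y \<in> J - {0}" "rv P x < RT (f + e) False" "rv P y < RT (g + e) False"
        using t u unfolding is_glb_def by blast
      then show ?thesis using e by (intro bexI[of _ x] bexI[of _ y]) (auto simp: rv_def RT_less aq)
    next
      case False
      then have *: "f + g = \<alpha>" "q" "\<not> s" "\<not> r" using a by (auto simp: tf ug aq RT_less max_def split: if_splits)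
      then have "t < RT f True" "u < RT g True" by (auto simp: tf ug RT_less)
      then obtain x y where "x \<in> I - {0}" "y \<in> J - {0}" "rv P x < RT f True" "rv P y < RT g True"
        using t u unfolding is_glb_def by blast
      then show ?thesis using * by (intro bexI[of _ x] bexI[of _ y]) (auto simp: rv_def RT_less aq)
    qed
    then obtain x y where "x \<in> I - {0}" "y \<in> J - {0}" "rv P x + rv P y < a" by blast
    then show "\<exists>x\<in>ideal_prod ambient I J - {0}. rv P x < a"
      using rv_mult[OF P, of x y] by (intro bexI[of _ "x * y"]) (auto intro: ambient_prod_closed)
  qed
  then show ?thesis
    using is_glb_unique is_glb_f_tilde[OF fractional_ideal_prod[OF I J] P] by (simp add: t_def u_def)
qed

lemma fractional_ideal_one: "fractional_ideal \<OO> \<OO>"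
  unfolding fractional_ideal_def
proof (intro conjI)
  show "\<OO> \<noteq> {0}" using big.one_mem by (metis singletonD zero_neq_one)
  show "\<exists>d. d \<noteq> 0 \<and> (\<forall>x\<in>\<OO>. d * x \<in> \<OO>)" by (rule exI[of _ 1]) simp
qed auto

lemma f_tilde_one:
  assumes P: "P \<in> spec"
  shows "ft \<OO> P = 0"
proof (rule is_glb_unique[OF is_glb_f_tilde[OF fractional_ideal_one P]])
  show "is_glb P \<OO> 0"
    unfolding is_glb_def
  proof (intro conjI ballI allI impI)
    show "0 \<le> rv P x" if "x \<in> \<OO> - {0}" for x using that rv_nonneg[OF P] by auto
    show "\<exists>x\<in>\<OO> - {0}. rv P x < a" if "0 < a" for a
      using that vv_one[OF P] by (intro bexI[of _ 1]) (auto simp: rv_def zero_rtilde_def)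
  qed
qed

subsection \<open>The function of a fractional ideal\<close>

lemma dense_value_group:
  assumes P: "P \<in> spec" and small: "\<And>\<epsilon>. \<epsilon> > 0 \<Longrightarrow> \<exists>x. x \<noteq> 0 \<and> 0 < vv P x \<and> vv P x < \<epsilon>"
  shows "closure (value_group K \<OO> P) = UNIV"
proof -
  have "r \<in> closure (value_group K \<OO> P)" for r
    unfolding closure_approachable
  proof (intro allI impI)
    fix \<epsilon> :: real assume "\<epsilon> > 0"
    then obtain x where x: "x \<noteq> 0" "0 < vv P x" "vv P x < \<epsilon>" using small by blast
    define k where "k = \<lfloor>r / vv P x\<rfloor>"
    have "k \<le> r / vv P x" "r / vv P x < k + 1" unfolding k_def by linarith+
    then have "k * vv P x \<le> r" "r < k * vv P x + vv P x" using x by (simp_all add: field_simps)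
    then have "dist (k * vv P x) r < \<epsilon>" using x by (simp add: dist_real_def)
    moreover have "k * vv P x \<in> value_group K \<OO> P"
      unfolding value_group_eq[OF P] using x vv_powi[OF P x(1), of k]
      by (intro image_eqI[of _ _ "x powi k"]) auto
    ultimately show "\<exists>y\<in>value_group K \<OO> P. dist y r < \<epsilon>" by blast
  qed
  then show ?thesis by blast
qed

text \<open>
  If the infimum is not attained, differences of values are arbitrarily small.
\<close>

lemma f_tilde_in_V_tilde:
  assumes I: "fractional_ideal \<OO> I" and P: "P \<in> spec"
  shows "ft I P \<in> V_tilde K \<OO> P"
proof -
  obtain f s where t: "ft I P = RT f s" by (cases "ft I P")
  have glb: "is_glb P I (RT f s)" using is_glb_f_tilde[OF I P] by (simp add: t)
  show ?thesis
  proof (cases s)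
    case False
    then have "RT f s < RT f True" by (simp add: RT_less)
    then obtain x where x: "x \<in> I - {0}" "rv P x < RT f True" using glb unfolding is_glb_def by blast
    moreover have "RT f s \<le> rv P x" using glb x unfolding is_glb_def by blast
    ultimately have "vv P x = f" by (auto simp: rv_def RT_less RT_less_eq)
    then have "f \<in> value_group K \<OO> P" using x by (auto simp: value_group_eq[OF P])
    then show ?thesis using False by (auto simp: t V_tilde_def val_tilde_def)
  next
    case True
    have gt: "f < vv P x" if "x \<in> I - {0}" for x
      using glb that True unfolding is_glb_def by (auto simp: rv_def RT_less_eq)
    have near: "\<exists>x\<in>I - {0}. vv P x < \<alpha>" if "f < \<alpha>" for \<alpha>
    proof -
      have "RT f s < RT \<alpha> False" using that by (simp add: RT_less)
      then obtain x where "x \<in> I - {0}" "rv P x < RT \<alpha> False" using glb unfolding is_glb_def by blast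
      then show ?thesis by (auto simp: rv_def RT_less)
    qed
    have "closure (value_group K \<OO> P) = UNIV"
    proof (rule dense_value_group[OF P])
      fix \<epsilon> :: real assume "\<epsilon> > 0"
      then obtain x where x: "x \<in> I - {0}" "vv P x < f + \<epsilon>" using near[of "f + \<epsilon>"] by auto
      then obtain y where y: "y \<in> I - {0}" "vv P y < vv P x" using near[of "vv P x"] gt by auto
      have "vv P (x * inverse y) = vv P x - vv P y"
        using x y vv_mult[OF P, of x "inverse y"] vv_inverse[OF P, of y] by simp
      then show "\<exists>x. x \<noteq> 0 \<and> 0 < vv P x \<and> vv P x < \<epsilon>"
        using x y gt[of y] by (intro exI[of _ "x * inverse y"]) auto
    qed
    then show ?thesis using True by (simp add: t V_tilde_def)
  qed
qed

lemma f_tilde_in_S_b_V: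
  assumes I: "fractional_ideal \<OO> I"
  shows "ft I \<in> S_b_V K \<OO>"
proof -
  let ?f = "ft I"
  obtain x0 where x0: "x0 \<in> I" "x0 \<noteq> 0" using frac_nonzero[OF I] by blast
  obtain d where d: "d \<noteq> 0" "\<And>P x. P \<in> spec \<Longrightarrow> x \<in> I - {0} \<Longrightarrow> - vv P d \<le> vv P x"
    using frac_denominator[OF I] by blast
  have upper: "?f P \<le> RT (vv P x0) False" if "P \<in> spec" for P
    using f_tilde_le[OF I that x0] by (simp add: rv_def)
  have lower: "RT (- vv P d) False \<le> ?f P" if P: "P \<in> spec" for P
  proof (rule ccontr)
    assume "\<not> ?thesis"
    then obtain x where "x \<in> I - {0}" "rv P x < RT (- vv P d) False"
      using f_tilde_less_iff[OF I P] by (auto simp: not_le)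
    then show False using d(2)[OF P, of x] by (auto simp: rv_def RT_less)
  qed
  have "?f \<in> topspace \<X> \<rightarrow>\<^sub>E UNIV"
    by (auto simp: f_tilde_def topspace_mSpec)
  moreover have "bounded_rt \<X> ?f"
  proof -
    obtain B where B: "\<And>P. P \<in> spec \<Longrightarrow> \<bar>vv P x0\<bar> \<le> B" by (rule vv_bounded[OF x0(2)], rule that, blast)
    obtain B' where B': "\<And>P. P \<in> spec \<Longrightarrow> \<bar>vv P d\<bar> \<le> B'" by (rule vv_bounded[OF d(1)], rule that, blast)
    have "RT (- B') False \<le> ?f P \<and> ?f P \<le> RT B False" if P: "P \<in> spec" for P
    proof
      have "RT (vv P x0) False \<le> RT B False" using B[OF P] by (auto simp: RT_less_eq)
      then show "?f P \<le> RT B False" using upper[OF P] by (rule order_trans[rotated])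
      have "RT (- B') False \<le> RT (- vv P d) False" using B'[OF P] by (auto simp: RT_less_eq)
      then show "RT (- B') False \<le> ?f P" using lower[OF P] by (rule order_trans)
    qed
    then show ?thesis unfolding bounded_rt_def topspace_mSpec by blast
  qed
  moreover have "compactly_supported \<X> ?f"
  proof -
    obtain F where F: "finite F" "F \<subseteq> base_primes" "\<And>P. P \<in> spec - fibres F \<Longrightarrow> vv P x0 = 0"
      by (rule vv_finite_support[OF x0(2)], rule that, assumption, assumption, blast)
    obtain G where G: "finite G" "G \<subseteq> base_primes" "\<And>P. P \<in> spec - fibres G \<Longrightarrow> vv P d = 0"
      by (rule vv_finite_support[OF d(1)], rule that, assumption, assumption, blast)
    have "?f P = 0" if P: "P \<in> spec - fibres (F \<union> G)" for P
    proof -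
      have Pm: "P \<in> spec" and "vv P x0 = 0" "vv P d = 0"
        using P F(3)[of P] G(3)[of P] by (auto simp: fibres_def)
      then show ?thesis using upper[OF Pm] lower[OF Pm] by (auto simp: zero_rtilde_def)
    qed
    moreover have "compactin \<X> (fibres (F \<union> G))" using F G by (intro compactin_fibres) auto
    ultimately show ?thesis unfolding compactly_supported_def topspace_mSpec by blast
  qed
  moreover have "upper_semicont \<X> ?f"
    unfolding upper_semicont_def topspace_mSpec
  proof
    fix a
    have "{P \<in> spec. ?f P < a} = (\<Union>x\<in>I - {0}. {P \<in> spec. RT (vv P x) False < a})"
      using f_tilde_less_iff[OF I] by (auto simp: rv_def)
    also have "openin \<X> \<dots>" using openin_vv[of _ "\<lambda>t. RT t False < a"] by (intro openin_Union) auto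
    finally show "openin \<X> {P \<in> spec. ?f P < a}" .
  qed
  ultimately show ?thesis
    using f_tilde_in_V_tilde[OF I] by (auto simp: S_b_V_def S_b_def)
qed

subsection \<open>Every admissible function comes from an ideal\<close>

text \<open>
  The points of the fibres outside the basic open set of \<open>A\<close> form a compact set. Each of
  them, \<open>Q\<close> say, differs from \<open>P\<close> and so contains some \<open>z\<close>
  outside \<open>P\<close>; a power of \<open>z\<close> has value at least \<open>M\<close> at
  \<open>Q\<close>, and the same holds near \<open>Q\<close>. The product of finitely many such powers
  will do.
\<close>

lemma separating_element:
  assumes P: "P \<in> spec" and A: "finite A" "A \<subseteq> P" and F: "finite F" "F \<subseteq> base_primes"
  obtains z where "z \<in> \<OO>" "z \<notin> P" "\<And>Q. Q \<in> fibres F \<Longrightarrow> \<not> A \<subseteq> Q \<Longrightarrow> M \<le> vv Q z"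
proof -
  have Pm: "maximalideal P (ring_on \<OO>)" using P by (simp add: max_ideals_iff)
  define C where "C = fibres F \<inter> (topspace \<X> - basic_open A)"
  have "openin \<X> (basic_open A)" using A maximal_simps(1)[OF Pm] by (intro openin_basic) auto
  then have "compactin \<X> C"
    unfolding C_def by (intro compact_Int_closedin compactin_fibres F) auto
  define N where "N z = {Q \<in> spec. M \<le> vv Q z}" for z
  define \<U> where "\<U> = N ` (\<OO> - P)"
  have nonzero: "z \<noteq> 0" if "z \<notin> P" for z using that maximal_simps(2)[OF Pm] by auto
  have "C \<subseteq> \<Union>\<U>"
  proof
    fix Q assume "Q \<in> C"
    then have Q: "Q \<in> spec" "\<not> A \<subseteq> Q" by (auto simp: C_def topspace_mSpec)
    then have Qm: "maximalideal Q (ring_on \<OO>)" by (simp add: max_ideals_iff)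
    have "\<not> Q \<subseteq> P"
    proof
      assume "Q \<subseteq> P"
      then have "P = Q \<or> P = \<OO>"
        using maximalideal.I_maximal[OF Qm, of P] Pm by (auto simp: big.maximal_iff big.ideal_iff)
      then show False using Q A maximal_simps(5)[OF Pm] by auto
    qed
    then obtain z where z: "z \<in> Q" "z \<notin> P" by blast
    have zO: "z \<in> \<OO>" "z \<noteq> 0" using z nonzero maximal_simps(1)[OF Qm] by auto
    then have pos: "vv Q z > 0" using vv_pos_iff[OF Q(1)] z by blast
    obtain n :: nat where n: "M \<le> n * vv Q z" using pos by (metis ex_less_of_nat_mult less_eq_real_def)
    have "z ^ n \<notin> P"
    proof (induction n)
      case 0 then show ?case using maximal_simps(5)[OF Pm] by simp
    next
      case (Suc n)
      then show ?case using maximal_simps(6)[OF Pm, of z "z ^ n"] zO z by auto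
    qed
    moreover have "Q \<in> N (z ^ n)" using Q n zO by (simp add: N_def vv_power[OF Q(1)])
    ultimately show "Q \<in> \<Union>\<U>" using zO by (auto simp: \<U>_def)
  qed
  moreover have "\<forall>u\<in>\<U>. openin \<X> u"
    using openin_vv[of _ "\<lambda>t. M \<le> t"] nonzero by (auto simp: \<U>_def N_def)
  ultimately obtain G where G: "finite G" "G \<subseteq> \<U>" "C \<subseteq> \<Union>G"
    using \<open>compactin \<X> C\<close> unfolding compactin_def by meson
  then obtain Z where Z: "Z \<subseteq> \<OO> - P" "finite Z" "G = N ` Z"
    unfolding \<U>_def by (meson finite_subset_image)
  have prod: "prod id Z' \<in> \<OO> - P" if "finite Z'" "Z' \<subseteq> \<OO> - P" for Z'
    using that
  proof (induction Z' rule: finite_induct)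
    case empty then show ?case using maximal_simps(5)[OF Pm] by simp
  next
    case (insert z Z')
    then show ?case using maximal_simps(6)[OF Pm, of z "prod id Z'"] by auto
  qed
  have "M \<le> vv Q (prod id Z)" if Q: "Q \<in> fibres F" "\<not> A \<subseteq> Q" for Q
  proof -
    have "Q \<in> C" using Q by (auto simp: C_def fibres_def topspace_mSpec)
    then obtain z where z: "z \<in> Z" "Q \<in> N z" using G(3) Z(3) by auto
    then have Qm: "Q \<in> spec" by (simp add: N_def)
    have eq: "prod id Z = z * prod id (Z - {z})" using prod.remove[OF Z(2) z(1), of id] by simp
    have rest: "prod id (Z - {z}) \<in> \<OO> - P" using Z by (intro prod) auto
    have "vv Q (prod id Z) = vv Q z + vv Q (prod id (Z - {z}))"
      unfolding eq using vv_mult[OF Qm] nonzero rest z Z by auto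
    moreover have "0 \<le> vv Q (prod id (Z - {z}))" using vv_nonneg[OF Qm] rest nonzero by auto
    ultimately show ?thesis using z(2) by (simp add: N_def)
  qed
  then show thesis using that[of "prod id Z"] prod[OF Z(2,1)] by auto
qed

lemma base_element_in_primes:
  assumes F: "finite F" "F \<subseteq> base_primes"
  obtains d where "d \<in> \<oo>" "d \<noteq> 0" "\<And>Q. Q \<in> fibres F \<Longrightarrow> 1 \<le> vv Q d"
proof -
  have "\<exists>d\<in>\<oo>. d \<noteq> 0 \<and> (\<forall>p\<in>F. d \<in> p)"
    using F
  proof (induction F rule: finite_induct)
    case empty show ?case by (intro bexI[of _ 1]) auto
  next
    case (insert p F)
    then obtain d where d: "d \<in> \<oo>" "d \<noteq> 0" "\<forall>p\<in>F. d \<in> p" by auto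
    have ids: "ideal q (ring_on \<oo>)" if "q \<in> insert p F" for q
      using insert.prems that by (auto simp: base_primes_def base.maximal_iff)
    have "p \<noteq> {0}" "0 \<in> p" using insert.prems ids[of p] by (auto simp: base_primes_def base.ideal_iff)
    then obtain e where e: "e \<in> p" "e \<noteq> 0" by blast
    have eo: "e \<in> \<oo>" using e ids[of p] by (auto simp: base.ideal_iff)
    have "e * d \<in> q" if "q \<in> insert p F" for q
    proof (cases "q = p")
      case True
      then have "d * e \<in> q" using ids[OF that] d(1) e by (auto simp: base.ideal_iff)
      then show ?thesis by (simp add: mult.commute)
    next
      case False
      then show ?thesis using ids[OF that] that d(3) eo by (auto simp: base.ideal_iff)
    qed
    then show ?case using e d eo by (intro bexI[of _ "e * d"]) auto
  qed
  then obtain d where d: "d \<in> \<oo>" "d \<noteq> 0" "\<And>p. p \<in> F \<Longrightarrow> d \<in> p" by blast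
  have "1 \<le> vv Q d" if Q: "Q \<in> fibres F" for Q
  proof -
    have Qm: "Q \<in> spec" "d \<in> Q" using Q d(3)[of "Q \<inter> \<oo>"] by (auto simp: fibres_def)
    then have "0 < vv Q d" using vv_pos_iff[OF Qm(1), of d] d base_subset by auto
    moreover have "vv Q d \<in> \<int>" using vv_K_Ints[OF Qm(1)] d base_subset_K by blast
    ultimately show ?thesis by (auto elim!: Ints_cases)
  qed
  then show thesis using that d by blast
qed

definition ideal_of :: "('a set \<Rightarrow> rtilde) \<Rightarrow> 'a set" where
  "ideal_of g = {x. x \<noteq> 0 \<longrightarrow> (\<forall>P\<in>spec. g P \<le> rv P x)}"

text \<open>
  The bounds and the compact support of \<open>g\<close> give an element \<open>e\<close> that is both
  in the ideal and a denominator of it. The construction of elements with prescribed values is the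
  heart of the proof.
\<close>

lemma f_tilde_surj:
  assumes g: "g \<in> S_b_V K \<OO>"
  shows "fractional_ideal \<OO> (ideal_of g)" "ft (ideal_of g) = g"
proof -
  let ?I = "ideal_of g"
  have gV: "\<And>P. P \<in> spec \<Longrightarrow> g P \<in> V_tilde K \<OO> P"
    and ext: "g \<in> extensional (spec)"
    and usc: "\<And>a. openin \<X> {P \<in> spec. g P < a}"
    and bd: "bounded_rt \<X> g" and cs: "compactly_supported \<X> g"
    using g by (auto simp: S_b_V_def S_b_def upper_semicont_def topspace_mSpec PiE_def)
  obtain Y where Y: "compactin \<X> Y" "\<And>P. P \<in> spec - Y \<Longrightarrow> g P = 0"
    using cs unfolding compactly_supported_def topspace_mSpec by blast
  obtain F where F: "finite F" "F \<subseteq> base_primes" "Y \<subseteq> fibres F" by (rule compactin_imp_fibres[OF Y(1)])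
  have g0: "g P = 0" if "P \<in> spec - fibres F" for P using Y(2) F(3) that by blast
  obtain a b where ab: "\<And>P. P \<in> spec \<Longrightarrow> a \<le> g P \<and> g P \<le> b"
    using bd unfolding bounded_rt_def topspace_mSpec by blast
  obtain \<alpha> s where as: "a = RT \<alpha> s" by (cases a)
  obtain \<beta> t where bt: "b = RT \<beta> t" by (cases b)
  obtain N :: nat where N: "\<bar>\<alpha>\<bar> + \<bar>\<beta>\<bar> < N" using reals_Archimedean2 by blast
  have gup: "g P < RT N False" if "P \<in> spec" for P
  proof -
    have "b < RT N False" using N by (auto simp: bt RT_less)
    then show ?thesis using ab[OF that] by (meson le_less_trans)
  qed
  have glow: "- N \<le> vv P x" if "P \<in> spec" "g P \<le> rv P x" for P x
  proof -
    have "a \<le> rv P x" using ab[OF that(1)] that(2) by (meson order_trans)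
    then show ?thesis using N by (auto simp: as rv_def RT_less_eq)
  qed
  obtain d where d: "d \<in> \<oo>" "d \<noteq> 0" "\<And>Q. Q \<in> fibres F \<Longrightarrow> 1 \<le> vv Q d"
    by (rule base_element_in_primes[OF F(1,2)], rule that, assumption, assumption, blast)
  define e where "e = d ^ N"
  have e: "e \<in> \<OO>" "e \<noteq> 0" using d base_subset by (auto simp: e_def)
  have ve: "N \<le> vv Q e" if "Q \<in> fibres F" for Q
  proof -
    have "Q \<in> spec" using that by (simp add: fibres_def)
    then have "vv Q e = N * vv Q d" using d by (simp add: e_def vv_power)
    also have "\<dots> \<ge> real N * 1" using d(3)[OF that] by (intro mult_left_mono) auto
    finally show ?thesis by simp
  qed
  show frac: "fractional_ideal \<OO> ?I"
    unfolding fractional_ideal_def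
  proof (intro conjI ballI exI[of _ e])
    show "0 \<in> ?I" by (simp add: ideal_of_def)
    have "g P \<le> rv P e" if P: "P \<in> spec" for P
    proof (cases "P \<in> fibres F")
      case True
      have "RT N False \<le> rv P e" using ve[OF True] by (auto simp: rv_def RT_less_eq)
      then show ?thesis using gup[OF P] by (meson less_imp_le order_trans)
    next
      case False
      then show ?thesis using g0[of P] P rv_nonneg[OF P] e by simp
    qed
    then have "e \<in> ?I" by (simp add: ideal_of_def)
    then show "?I \<noteq> {0}" using e by blast
    show "x + y \<in> ?I" if "x \<in> ?I" "y \<in> ?I" for x y
      using that rv_add[of _ x y] by (cases "x = 0 \<or> y = 0") (auto simp: ideal_of_def)
    show "r * x \<in> ?I" if rx: "r \<in> \<OO>" "x \<in> ?I" for r x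
      unfolding ideal_of_def
    proof (intro CollectI impI ballI)
      fix P assume nz: "r * x \<noteq> 0" and P: "P \<in> spec"
      then have "0 + g P \<le> rv P r + rv P x"
        using rx rv_nonneg[OF P] by (intro rtilde_add_mono) (auto simp: ideal_of_def)
      then show "g P \<le> rv P (r * x)" using nz rv_mult[OF P] by simp
    qed
    show "e \<noteq> 0" by (rule e)
    show "e * x \<in> \<OO>" if x: "x \<in> ?I" for x
    proof (cases "x = 0")
      case False
      have "e * x \<noteq> 0" using False e by simp
      moreover have "ft \<OO> P \<le> rv P (e * x)" if P: "P \<in> spec" for P
      proof -
        have gx: "g P \<le> rv P x" using x False P by (simp add: ideal_of_def)
        have "0 \<le> vv P e + vv P x"
        proof (cases "P \<in> fibres F")
          case True
          then show ?thesis using ve[OF True] glow[OF P gx] by linarith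
        next
          case out: False
          then have "0 \<le> rv P x" using g0[of P] P gx by simp
          then have "0 \<le> vv P x" by (auto simp: rv_def zero_rtilde_def RT_less_eq)
          then show ?thesis using vv_nonneg[OF P e] by simp
        qed
        then show ?thesis
          using P e False by (auto simp: f_tilde_one rv_def vv_mult[OF P] zero_rtilde_def RT_less_eq)
      qed
      ultimately show ?thesis using mem_frac_iff[OF fractional_ideal_one, of "e * x"] by blast
    qed simp
  qed
  have glb: "is_glb P ?I (g P)" if P: "P \<in> spec" for P
    unfolding is_glb_def
  proof (intro conjI ballI allI impI)
    show "g P \<le> rv P x" if "x \<in> ?I - {0}" for x using that P by (simp add: ideal_of_def)
    fix c assume c: "g P < c"
    obtain y where y: "y \<noteq> 0" "g P \<le> rv P y" "rv P y < c"
    proof (cases "g P \<in> val_tilde K \<OO> P")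
      case True
      then obtain y where "y \<noteq> 0" "g P = rv P y"
        by (auto simp: val_tilde_def value_group_eq[OF P] rv_def)
      then show thesis using that c by auto
    next
      case False
      then obtain \<gamma> where \<gamma>: "g P = RT \<gamma> True" "closure (value_group K \<OO> P) = UNIV"
        using gV[OF P] by (auto simp: V_tilde_def split: if_splits)
      obtain \<delta> q where \<delta>: "c = RT \<delta> q" by (cases c)
      have "\<gamma> < \<delta>" using c by (auto simp: \<gamma> \<delta> RT_less)
      have "(\<gamma> + \<delta>) / 2 \<in> closure (value_group K \<OO> P)" using \<gamma> by simp
      then obtain v where v: "v \<in> value_group K \<OO> P" "dist v ((\<gamma> + \<delta>) / 2) < (\<delta> - \<gamma>) / 2"
        unfolding closure_approachable using \<open>\<gamma> < \<delta>\<close> by (meson half_gt_zero diff_gt_0_iff_gt)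
      then have "\<gamma> < v" "v < \<delta>" by (auto simp: dist_real_def abs_less_iff field_simps)
      moreover obtain y where "y \<noteq> 0" "v = vv P y" using v by (auto simp: value_group_eq[OF P])
      ultimately show thesis using that[of y] by (auto simp: \<gamma> \<delta> rv_def RT_less RT_less_eq)
    qed
    \<comment> \<open>On the neighbourhood \<open>W\<close> of \<open>P\<close> the element \<open>y\<close> has value \<open>\<alpha>'\<close> and satisfies the conditions.\<close>
    define \<alpha>' where "\<alpha>' = vv P y"
    have "g P < RT \<alpha>' True" using y(2) by (cases "g P") (auto simp: \<alpha>'_def rv_def RT_less RT_less_eq)
    define W where "W = {Q \<in> spec. g Q < RT \<alpha>' True} \<inter> {Q \<in> spec. vv Q y = \<alpha>'}"
    have "openin \<X> W"
      unfolding W_def using usc openin_vv[OF y(1), of "\<lambda>t. t = \<alpha>'"] by (rule openin_Int)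
    moreover have "P \<in> W" using P \<open>g P < RT \<alpha>' True\<close> by (simp add: W_def \<alpha>'_def)
    ultimately obtain A where A: "finite A" "A \<subseteq> P" "basic_open A \<subseteq> W"
      unfolding openin_mSpec_iff by blast
    obtain G where G: "finite G" "G \<subseteq> base_primes" "\<And>P. P \<in> spec - fibres G \<Longrightarrow> vv P y = 0"
      by (rule vv_finite_support[OF y(1)], rule that, assumption, assumption, blast)
    obtain B where B: "\<And>P. P \<in> spec \<Longrightarrow> \<bar>vv P y\<bar> \<le> B" by (rule vv_bounded[OF y(1)], rule that, blast)
    have FG: "finite (F \<union> G)" "F \<union> G \<subseteq> base_primes" using F G by auto
    \<comment> \<open>\<open>N\<close> exceeds \<open>g\<close>, and \<open>B\<close> makes up for negative values of \<open>y\<close>; outside these fibres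
      \<open>g\<close> and the value of \<open>y\<close> are 0.\<close>
    obtain z where z: "z \<in> \<OO>" "z \<notin> P" "\<And>Q. Q \<in> fibres (F \<union> G) \<Longrightarrow> \<not> A \<subseteq> Q \<Longrightarrow> N + B \<le> vv Q z"
      by (rule separating_element[OF P A(1,2) FG, of "N + B"], rule that, assumption, assumption, blast)
    have z0: "z \<noteq> 0" using z maximal_simps(2) P by (auto simp: max_ideals_iff)
    have "vv P z = 0" using vv_zero_outside[OF P] z by blast
    then have "rv P (y * z) = rv P y" using y z0 by (simp add: rv_def vv_mult[OF P])
    moreover have "y * z \<in> ?I"
      unfolding ideal_of_def
    proof (intro CollectI impI ballI)
      fix Q assume Q: "Q \<in> spec"
      have v: "vv Q (y * z) = vv Q y + vv Q z" using vv_mult[OF Q] y z0 by simp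
      have vz: "0 \<le> vv Q z" using vv_nonneg[OF Q z(1) z0] .
      show "g Q \<le> rv Q (y * z)"
      proof (cases "A \<subseteq> Q")
        case True
        then have "g Q < RT \<alpha>' True" "vv Q y = \<alpha>'" using A(3) Q by (auto simp: W_def)
        then have "g Q \<le> RT (vv Q y) False" by (cases "g Q") (auto simp: RT_less RT_less_eq)
        also have "\<dots> \<le> rv Q (y * z)" using v vz by (auto simp: rv_def RT_less_eq)
        finally show ?thesis .
      next
        case nA: False
        show ?thesis
        proof (cases "Q \<in> fibres (F \<union> G)")
          case True
          then have "N \<le> vv Q (y * z)" using z(3)[OF True nA] B[OF Q] v by linarith
          then have "RT N False \<le> rv Q (y * z)" by (auto simp: rv_def RT_less_eq)
          then show ?thesis using gup[OF Q] by (meson less_imp_le order_trans)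
        next
          case False
          then have "g Q = 0" "vv Q y = 0" using g0[of Q] G(3)[of Q] Q by (auto simp: fibres_def)
          then show ?thesis using v vz by (auto simp: rv_def zero_rtilde_def RT_less_eq)
        qed
      qed
    qed
    ultimately show "\<exists>x\<in>?I - {0}. rv P x < c" using y z0 by (intro bexI[of _ "y * z"]) auto
  qed
  show "ft ?I = g" by (rule f_tilde_eqI[OF frac ext glb])
qed

end

section \<open>The quotient monoids\<close>

lemma rtilde_add_eq_zero:
  assumes "a + b = (0::rtilde)"
  shows "b = rt_iota a" "\<exists>\<alpha>. a = RT \<alpha> False"
  using assms by (cases a; cases b; auto simp: zero_rtilde_def max_def split: if_splits)+

lemma rtilde_add_iota: "a + rt_iota a + a = a"
  by (cases a) auto

lemma rtilde_regular:
  assumes "a = a + b + (a::rtilde)"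
  shows "rt_iota a = a + b + b"
  using assms by (cases a; cases b) (auto simp: max_def split: if_splits)

context dedekind_extension
begin

abbreviation mult_ideals (infixl \<open>\<odot>\<close> 70) where "I \<odot> J \<equiv> ideal_prod ambient I J"
abbreviation frac where "frac \<equiv> {I. fractional_ideal \<OO> I}"
abbreviation MS where "MS \<equiv> fun_monoid \<X> (S_b_V K \<OO>)"

lemma frac_closed: "I \<in> frac \<Longrightarrow> J \<in> frac \<Longrightarrow> I \<odot> J \<in> frac"
  using fractional_ideal_prod by simp

lemma ft_eqI:
  assumes "I \<in> frac" "J \<in> frac" "\<And>P. P \<in> spec \<Longrightarrow> ft I P = ft J P"
  shows "I = J"
proof (rule f_tilde_inj)
  show "ft I = ft J"
    by (rule extensionalityI[of _ "spec"]) (use assms(3) in \<open>auto simp: f_tilde_def\<close>)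
qed (use assms in auto)

lemma ft_prod: "I \<in> frac \<Longrightarrow> J \<in> frac \<Longrightarrow> P \<in> spec \<Longrightarrow> ft (I \<odot> J) P = ft I P + ft J P"
  using f_tilde_prod by simp

lemma one_frac: "\<OO> \<in> frac" using fractional_ideal_one by simp

text \<open>
  The laws of ideal multiplication are read off from the values, by injectivity.
\<close>

lemma prod_assoc: "I \<in> frac \<Longrightarrow> J \<in> frac \<Longrightarrow> L \<in> frac \<Longrightarrow> I \<odot> J \<odot> L = I \<odot> (J \<odot> L)"
  by (rule ft_eqI) (simp_all only: frac_closed ft_prod add.assoc)

lemma prod_comm: "I \<in> frac \<Longrightarrow> J \<in> frac \<Longrightarrow> I \<odot> J = J \<odot> I"
  by (rule ft_eqI) (simp_all only: frac_closed ft_prod add.commute)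

lemma prod_one: "I \<in> frac \<Longrightarrow> \<OO> \<odot> I = I"
  by (rule ft_eqI) (simp_all only: frac_closed ft_prod one_frac f_tilde_one add_0)

lemma Frac_simps [simp]:
  "carrier (Frac_Ideals \<OO>) = frac" "\<one>\<^bsub>Frac_Ideals \<OO>\<^esub> = \<OO>" "I \<otimes>\<^bsub>Frac_Ideals \<OO>\<^esub> J = I \<odot> J"
  by (simp_all add: Frac_Ideals_def)

lemma comm_monoid_Frac: "comm_monoid (Frac_Ideals \<OO>)"
proof (rule comm_monoidI, unfold Frac_simps)
  show "I \<odot> J \<in> frac" if "I \<in> frac" "J \<in> frac" for I J using that by (rule frac_closed)
  show "I \<odot> J \<odot> L = I \<odot> (J \<odot> L)" if "I \<in> frac" "J \<in> frac" "L \<in> frac" for I J L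
    using that by (rule prod_assoc)
  show "I \<odot> J = J \<odot> I" if "I \<in> frac" "J \<in> frac" for I J using that by (rule prod_comm)
qed (rule one_frac, rule prod_one)

lemma ft_prod_fun: "I \<in> frac \<Longrightarrow> J \<in> frac \<Longrightarrow> ft (I \<odot> J) = restrict (\<lambda>P. ft I P + ft J P) (spec)"
  by (rule extensionalityI[of _ "spec"]) (auto simp: f_tilde_def[of _ _ "_ \<odot> _"] simp flip: ft_prod)

lemma ft_surj:
  assumes "g \<in> S_b_V K \<OO>"
  obtains I where "I \<in> frac" "ft I = g"
  using f_tilde_surj[OF assms] by auto

lemma ft_image: "ft ` frac = S_b_V K \<OO>"
  using f_tilde_in_S_b_V ft_surj by blast

lemma ft_inj_on: "inj_on ft frac"
  using f_tilde_inj by (auto intro: inj_onI)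

lemma MS_simps [simp]:
  "carrier MS = S_b_V K \<OO>"
  "f \<otimes>\<^bsub>MS\<^esub> g = restrict (\<lambda>P. f P + g P) (spec)"
  by (simp_all add: fun_monoid_def topspace_mSpec)

lemma ft_mult: "I \<in> frac \<Longrightarrow> J \<in> frac \<Longrightarrow> ft (I \<odot> J) = ft I \<otimes>\<^bsub>MS\<^esub> ft J"
  by (simp add: ft_prod_fun)

lemma ft_one: "ft \<OO> = \<one>\<^bsub>MS\<^esub>"
proof (rule extensionalityI[of _ "spec"])
  show "ft \<OO> \<in> extensional (spec)" by (simp add: f_tilde_def)
  show "\<one>\<^bsub>MS\<^esub> \<in> extensional (spec)" by (simp add: fun_monoid_def topspace_mSpec)
  show "ft \<OO> P = \<one>\<^bsub>MS\<^esub> P" if "P \<in> spec" for P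
    using f_tilde_one[OF that] that by (simp add: fun_monoid_def topspace_mSpec)
qed

abbreviation SV where "SV \<equiv> S_ref_val K \<OO>"

definition inv_ideals where "inv_ideals = {I \<in> frac. \<exists>J\<in>frac. I \<odot> J = \<OO>}"
definition reg_ideals where "reg_ideals = {I \<in> frac. \<exists>B\<in>frac. I \<odot> B \<odot> I = I}"

lemma value_group_uminus:
  assumes P: "P \<in> spec" and "a \<in> value_group K \<OO> P"
  shows "- a \<in> value_group K \<OO> P"
proof -
  obtain x where "x \<noteq> 0" "a = vv P x" using assms by (auto simp: value_group_eq[OF P])
  then show ?thesis using vv_inverse[OF P, of x] by (auto simp: value_group_eq[OF P] intro!: image_eqI[of _ _ "inverse x"])
qed

lemma iota_val_tilde: "P \<in> spec \<Longrightarrow> a \<in> val_tilde K \<OO> P \<Longrightarrow> rt_iota a \<in> val_tilde K \<OO> P"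
  using value_group_uminus by (auto simp: val_tilde_def)

lemma iota_V_tilde: "P \<in> spec \<Longrightarrow> a \<in> V_tilde K \<OO> P \<Longrightarrow> rt_iota a \<in> V_tilde K \<OO> P"
  using iota_val_tilde by (auto simp: V_tilde_def split: if_splits)

abbreviation iota_fun where "iota_fun f \<equiv> restrict (rt_iota \<circ> f) (spec)"

lemma S_ref_V_iff: "f \<in> S_ref_V K \<OO> \<longleftrightarrow> f \<in> S_b_V K \<OO> \<and> iota_fun f \<in> S_b_V K \<OO>"
  using iota_V_tilde by (auto simp: S_ref_V_def S_ref_def S_b_V_def topspace_mSpec)

lemma S_ref_val_iff:
  "f \<in> SV \<longleftrightarrow> f \<in> S_ref_V K \<OO> \<and> (\<forall>P\<in>spec. f P \<in> val_tilde K \<OO> P)"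
  by (auto simp: S_ref_V_def S_ref_val_def V_tilde_def)

text \<open>
  If \<open>I J = \<OO>\<close>, the functions of \<open>I\<close> and \<open>J\<close> add up to 0,
  so their flags are 0 and they are negatives of each other. Conversely, the negative of a function in
  \<open>S_ref_val\<close> comes from an ideal, which is the inverse.
\<close>

lemma ft_inv_image: "ft ` inv_ideals = SV"
proof (intro equalityI subsetI)
  fix f assume "f \<in> ft ` inv_ideals"
  then obtain I J where IJ: "I \<in> frac" "J \<in> frac" "I \<odot> J = \<OO>" "f = ft I" by (auto simp: inv_ideals_def)
  have sum: "ft I P + ft J P = 0" if "P \<in> spec" for P
    using ft_prod[OF IJ(1,2) that] IJ(3) f_tilde_one[OF that] by simp
  have "iota_fun f = ft J"
  proof (rule extensionalityI[of _ "spec"])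
    show "ft J \<in> extensional (spec)" by (simp add: f_tilde_def)
    show "iota_fun f P = ft J P" if "P \<in> spec" for P
      using rtilde_add_eq_zero(1)[OF sum[OF that]] that by (simp add: IJ(4))
  qed simp
  then have "f \<in> S_ref_V K \<OO>" using ft_image IJ by (auto simp: S_ref_V_iff)
  moreover have "f P \<in> val_tilde K \<OO> P" if P: "P \<in> spec" for P
  proof -
    have "ft I P \<in> V_tilde K \<OO> P" using f_tilde_in_V_tilde IJ(1) P by simp
    then show ?thesis
      using rtilde_add_eq_zero(2)[OF sum[OF P]] by (auto simp: IJ(4) V_tilde_def split: if_splits)
  qed
  ultimately show "f \<in> SV" by (simp add: S_ref_val_iff)
next
  fix f assume f: "f \<in> SV"
  then have "f \<in> S_b_V K \<OO>" "iota_fun f \<in> S_b_V K \<OO>" by (auto simp: S_ref_val_iff S_ref_V_iff)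
  then obtain I J where IJ: "I \<in> frac" "J \<in> frac" "ft I = f" "ft J = iota_fun f"
    by (metis ft_surj)
  have "I \<odot> J = \<OO>"
  proof (rule ft_eqI)
    fix P assume P: "P \<in> spec"
    have "f P \<in> val_tilde K \<OO> P" using f P by (simp add: S_ref_val_iff)
    then have "f P + rt_iota (f P) = 0" by (auto simp: val_tilde_def zero_rtilde_def)
    then show "ft (I \<odot> J) P = ft \<OO> P" using ft_prod[OF IJ(1,2) P] f_tilde_one[OF P] P by (simp add: IJ(3,4))
  qed (use IJ frac_closed one_frac in auto)
  then show "f \<in> ft ` inv_ideals" using IJ by (auto simp: inv_ideals_def)
qed

text \<open>
  If \<open>f\<close> belongs to \<open>I = I B I\<close>, then \<open>\<iota> f\<close> is admissible
  because it is the function of \<open>I B B\<close>. Conversely, the ideal of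
  \<open>\<iota> f\<close> serves as \<open>B\<close>.
\<close>

lemma ft_reg_image: "ft ` reg_ideals = S_ref_V K \<OO>"
proof (intro equalityI subsetI)
  fix f assume "f \<in> ft ` reg_ideals"
  then obtain I B where IB: "I \<in> frac" "B \<in> frac" "I \<odot> B \<odot> I = I" "f = ft I" by (auto simp: reg_ideals_def)
  note cl = frac_closed[OF frac_closed[OF IB(1,2)] IB(2)]
  have "iota_fun f = ft (I \<odot> B \<odot> B)"
  proof (rule extensionalityI[of _ "spec"])
    show "ft (I \<odot> B \<odot> B) \<in> extensional (spec)" by (simp add: f_tilde_def)
    fix P assume P: "P \<in> spec"
    have "ft I P = ft I P + ft B P + ft I P"
      using ft_prod[OF frac_closed[OF IB(1,2)] IB(1) P] ft_prod[OF IB(1,2) P] by (simp add: IB(3))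
    from rtilde_regular[OF this] show "iota_fun f P = ft (I \<odot> B \<odot> B) P"
      using ft_prod[OF frac_closed[OF IB(1,2)] IB(2) P] ft_prod[OF IB(1,2) P] P by (simp add: IB(4))
  qed simp
  then show "f \<in> S_ref_V K \<OO>" using ft_image cl IB(1,4) by (auto simp: S_ref_V_iff)
next
  fix f assume f: "f \<in> S_ref_V K \<OO>"
  then have "f \<in> S_b_V K \<OO>" "iota_fun f \<in> S_b_V K \<OO>" by (auto simp: S_ref_V_iff)
  then obtain I J where IJ: "I \<in> frac" "J \<in> frac" "ft I = f" "ft J = iota_fun f"
    by (metis ft_surj)
  have "I \<odot> J \<odot> I = I"
  proof (rule ft_eqI)
    fix P assume P: "P \<in> spec"
    show "ft (I \<odot> J \<odot> I) P = ft I P"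
      using ft_prod[OF frac_closed[OF IJ(1,2)] IJ(1) P] ft_prod[OF IJ(1,2) P] P rtilde_add_iota[of "f P"]
      by (simp add: IJ(3,4))
  qed (use IJ frac_closed in auto)
  then show "f \<in> ft ` reg_ideals" using IJ by (auto simp: reg_ideals_def)
qed

lemma comm_monoid_MS: "comm_monoid MS"
proof (rule comm_monoidI)
  fix f g h assume "f \<in> carrier MS" "g \<in> carrier MS" "h \<in> carrier MS"
  then obtain I J L where IJL: "I \<in> frac" "J \<in> frac" "L \<in> frac" and eq: "f = ft I" "g = ft J" "h = ft L"
    using ft_surj unfolding MS_simps by metis
  show "f \<otimes>\<^bsub>MS\<^esub> g \<in> carrier MS"
    unfolding eq using IJL ft_mult[of I J, symmetric] ft_image frac_closed[of I J] by auto
  show "f \<otimes>\<^bsub>MS\<^esub> g \<otimes>\<^bsub>MS\<^esub> h = f \<otimes>\<^bsub>MS\<^esub> (g \<otimes>\<^bsub>MS\<^esub> h)"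
    unfolding eq using IJL by (simp only: ft_mult[symmetric] frac_closed prod_assoc)
  show "f \<otimes>\<^bsub>MS\<^esub> g = g \<otimes>\<^bsub>MS\<^esub> f"
    unfolding eq using IJL by (simp only: ft_mult[symmetric] prod_comm)
  show "\<one>\<^bsub>MS\<^esub> \<otimes>\<^bsub>MS\<^esub> f = f"
    unfolding eq using IJL by (simp only: ft_one[symmetric] ft_mult[symmetric] one_frac prod_one)
next
  show "\<one>\<^bsub>MS\<^esub> \<in> carrier MS"
    using ft_image one_frac by (auto simp flip: ft_one)
qed

lemma inv_frac: "inv_ideals \<subseteq> frac" by (auto simp: inv_ideals_def)

lemma inv_one: "\<OO> \<in> inv_ideals"
  unfolding inv_ideals_def using one_frac prod_one[OF one_frac] by auto

lemma inv_closed: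
  assumes "I \<in> inv_ideals" "J \<in> inv_ideals"
  shows "I \<odot> J \<in> inv_ideals"
proof -
  obtain I' J' where *: "I \<in> frac" "I' \<in> frac" "I \<odot> I' = \<OO>" "J \<in> frac" "J' \<in> frac" "J \<odot> J' = \<OO>"
    using assms by (auto simp: inv_ideals_def)
  have "J \<odot> (J' \<odot> I') = J \<odot> J' \<odot> I'" using * by (intro prod_assoc[symmetric])
  also have "\<dots> = I'" using * prod_one by simp
  finally have "I \<odot> J \<odot> (J' \<odot> I') = I \<odot> I'"
    using * prod_assoc[of I J "J' \<odot> I'"] frac_closed[of J' I'] by simp
  also have "\<dots> = \<OO>" using * by simp
  finally show ?thesis using * frac_closed unfolding inv_ideals_def by blast
qed

lemma principal_prod:
  assumes "I \<in> frac"
  shows "((*) a ` \<OO>) \<odot> I = (*) a ` I"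
proof (intro equalityI subsetI)
  have I: "fractional_ideal \<OO> I" using assms by simp
  fix z assume "z \<in> ((*) a ` \<OO>) \<odot> I"
  then show "z \<in> (*) a ` I"
  proof (induction rule: ideal_prod.induct)
    case (prod i j)
    then obtain r where "r \<in> \<OO>" "i = a * r" by blast
    then show ?case using frac_mult[OF I _ prod(2)] by (auto simp: mult.assoc)
  next
    case (sum s t)
    then show ?case using frac_add[OF I] by (auto simp flip: distrib_left)
  qed
next
  fix z assume "z \<in> (*) a ` I"
  then obtain x where x: "x \<in> I" "z = (a * 1) * x" by auto
  show "z \<in> ((*) a ` \<OO>) \<odot> I"
    unfolding x(2) using x(1) by (intro ambient_prod_closed) auto
qed

lemma principal_frac: "a \<noteq> 0 \<Longrightarrow> (*) a ` \<OO> \<in> frac"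
proof -
  assume a: "a \<noteq> 0"
  have "a * 1 \<in> (*) a ` \<OO>" by blast
  moreover have "\<exists>d. d \<noteq> 0 \<and> (\<forall>x\<in>(*) a ` \<OO>. d * x \<in> \<OO>)"
    using a by (intro exI[of _ "inverse a"]) (auto simp flip: mult.assoc)
  moreover have "x + y \<in> (*) a ` \<OO>" if "x \<in> (*) a ` \<OO>" "y \<in> (*) a ` \<OO>" for x y
    using that by (auto simp flip: distrib_left)
  moreover have "r * x \<in> (*) a ` \<OO>" if "r \<in> \<OO>" "x \<in> (*) a ` \<OO>" for r x
    using that by (auto simp: mult.left_commute[of r])
  moreover have "0 \<in> (*) a ` \<OO>" by (auto intro!: image_eqI[of _ _ 0])
  ultimately show ?thesis using a unfolding fractional_ideal_def by auto
qed

lemma principal_prod_principal: "b \<noteq> 0 \<Longrightarrow> ((*) a ` \<OO>) \<odot> ((*) b ` \<OO>) = (*) (a * b) ` \<OO>"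
  using principal_prod[OF principal_frac, of b a] by (simp add: image_image mult.assoc)

abbreviation prin where "prin \<equiv> principal_ideals \<OO>"

lemma prin_one: "\<OO> \<in> prin"
  unfolding principal_ideals_def by (auto intro!: exI[of _ 1])

lemma prin_closed:
  assumes "I \<in> prin" "J \<in> prin" shows "I \<odot> J \<in> prin"
proof -
  obtain a b where "a \<noteq> 0" "I = (*) a ` \<OO>" "b \<noteq> 0" "J = (*) b ` \<OO>" using assms by (auto simp: principal_ideals_def)
  then show ?thesis using principal_prod_principal[of b a] unfolding principal_ideals_def by auto
qed

lemma prin_inv: "prin \<subseteq> inv_ideals"
proof
  fix I assume "I \<in> prin"
  then obtain a where a: "a \<noteq> 0" "I = (*) a ` \<OO>" by (auto simp: principal_ideals_def)
  have "I \<odot> ((*) (inverse a) ` \<OO>) = (*) 1 ` \<OO>"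
    using principal_prod_principal[of "inverse a" a] a by simp
  then have "I \<odot> ((*) (inverse a) ` \<OO>) = \<OO>" by simp
  then show "I \<in> inv_ideals"
    using principal_frac[of a] principal_frac[of "inverse a"] a by (auto simp: inv_ideals_def)
qed

lemma prin_frac: "prin \<subseteq> frac" using prin_inv inv_frac by blast

lemma submonoid_prin: "submonoid prin (Frac_Ideals \<OO>)"
  by (rule submonoid.intro) (use prin_frac prin_one prin_closed in \<open>auto simp only: Frac_simps\<close>)

abbreviation cls where "cls \<equiv> ideal_class \<OO>"

lemma cls_eq: "cls I = {A \<odot> I | A. A \<in> prin}"
  by (auto simp: ideal_class_def r_coset_def)

lemma self_in_cls: "I \<in> frac \<Longrightarrow> I \<in> cls I"
  unfolding cls_eq using prin_one prod_one by blast

lemma carrier_Cl: "carrier (Cl \<OO>) = cls ` frac"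
  by (auto simp: Cl_def FactGroup_def RCOSETS_def ideal_class_def)

lemma Cl_mult: "I \<in> frac \<Longrightarrow> J \<in> frac \<Longrightarrow> cls I \<otimes>\<^bsub>Cl \<OO>\<^esub> cls J = cls (I \<odot> J)"
  unfolding Cl_def ideal_class_def
  using mult_Mod_monoid[OF comm_monoid_Frac submonoid_prin, of I J] by simp

lemma Cl_one: "\<one>\<^bsub>Cl \<OO>\<^esub> = cls \<OO>"
proof -
  have "A \<odot> \<OO> = A" if "A \<in> prin" for A using that prin_frac prod_comm[of A \<OO>] prod_one one_frac by auto
  then have "cls \<OO> = prin" by (auto simp: cls_eq)
  then show ?thesis by (simp add: Cl_def FactGroup_def)
qed

lemma comm_monoid_Cl: "comm_monoid (Cl \<OO>)"
proof (rule comm_monoidI)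
  fix c d e assume "c \<in> carrier (Cl \<OO>)" "d \<in> carrier (Cl \<OO>)" "e \<in> carrier (Cl \<OO>)"
  then obtain I J L where IJL: "I \<in> frac" "J \<in> frac" "L \<in> frac" and eq: "c = cls I" "d = cls J" "e = cls L"
    unfolding carrier_Cl by blast
  show "c \<otimes>\<^bsub>Cl \<OO>\<^esub> d \<in> carrier (Cl \<OO>)"
    unfolding eq carrier_Cl using IJL Cl_mult frac_closed by blast
  show "c \<otimes>\<^bsub>Cl \<OO>\<^esub> d \<otimes>\<^bsub>Cl \<OO>\<^esub> e = c \<otimes>\<^bsub>Cl \<OO>\<^esub> (d \<otimes>\<^bsub>Cl \<OO>\<^esub> e)"
    unfolding eq using IJL by (simp only: Cl_mult frac_closed prod_assoc)
  show "c \<otimes>\<^bsub>Cl \<OO>\<^esub> d = d \<otimes>\<^bsub>Cl \<OO>\<^esub> c"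
    unfolding eq using IJL by (simp only: Cl_mult prod_comm)
  show "\<one>\<^bsub>Cl \<OO>\<^esub> \<otimes>\<^bsub>Cl \<OO>\<^esub> c = c"
    unfolding eq Cl_one using IJL by (simp only: Cl_mult one_frac prod_one)
next
  show "\<one>\<^bsub>Cl \<OO>\<^esub> \<in> carrier (Cl \<OO>)" unfolding carrier_Cl Cl_one using one_frac by blast
qed

abbreviation pic where "pic \<equiv> carrier (Pic \<OO>)"

lemma pic_eq: "pic = cls ` inv_ideals"
proof -
  have "carrier (Inv_Ideals \<OO>) = inv_ideals" by (auto simp: Inv_Ideals_def inv_ideals_def)
  moreover have "prin #>\<^bsub>Inv_Ideals \<OO>\<^esub> I = cls I" for I
    by (simp add: ideal_class_def r_coset_def Inv_Ideals_def)
  ultimately show ?thesis by (auto simp: Pic_def FactGroup_def RCOSETS_def)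
qed

lemma submonoid_pic: "submonoid pic (Cl \<OO>)"
proof
  show "pic \<subseteq> carrier (Cl \<OO>)" unfolding pic_eq carrier_Cl using inv_frac by blast
  show "\<one>\<^bsub>Cl \<OO>\<^esub> \<in> pic" unfolding pic_eq Cl_one using inv_one by blast
  show "x \<otimes>\<^bsub>Cl \<OO>\<^esub> y \<in> pic" if "x \<in> pic" "y \<in> pic" for x y
    using that unfolding pic_eq using Cl_mult inv_closed inv_frac by (auto simp: subset_iff)
qed

text \<open>This is the union of the coset of the class of \<open>I\<close> modulo the Picard group.\<close>

definition orb where "orb I = {J \<odot> I | J. J \<in> inv_ideals}"

lemma coset_eq: "I \<in> frac \<Longrightarrow> pic #>\<^bsub>Cl \<OO>\<^esub> cls I = cls ` orb I"
proof -
  assume I: "I \<in> frac"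
  have "pic #>\<^bsub>Cl \<OO>\<^esub> cls I = (\<Union>J\<in>inv_ideals. {cls J \<otimes>\<^bsub>Cl \<OO>\<^esub> cls I})"
    by (simp add: r_coset_def pic_eq)
  also have "\<dots> = (\<Union>J\<in>inv_ideals. {cls (J \<odot> I)})"
    using Cl_mult I inv_frac by (intro SUP_cong) auto
  finally show ?thesis by (auto simp: orb_def)
qed

lemma orb_frac: "I \<in> frac \<Longrightarrow> orb I \<subseteq> frac"
  unfolding orb_def using inv_frac frac_closed by blast

lemma Union_orb: "I \<in> frac \<Longrightarrow> \<Union>(cls ` orb I) = orb I"
proof (intro equalityI subsetI)
  assume I: "I \<in> frac"
  fix A assume "A \<in> \<Union>(cls ` orb I)"
  then obtain p J where pJ: "p \<in> prin" "J \<in> inv_ideals" "A = p \<odot> (J \<odot> I)"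
    by (auto simp: cls_eq orb_def)
  then have "A = (p \<odot> J) \<odot> I" using prod_assoc[of p J I] prin_frac inv_frac I by blast
  moreover have "p \<odot> J \<in> inv_ideals" using inv_closed prin_inv pJ by blast
  ultimately show "A \<in> orb I" unfolding orb_def by blast
next
  assume I: "I \<in> frac"
  fix A assume "A \<in> orb I"
  then show "A \<in> \<Union>(cls ` orb I)" using self_in_cls orb_frac[OF I] by blast
qed

lemma ft_orb: "I \<in> frac \<Longrightarrow> ft ` orb I = SV #>\<^bsub>MS\<^esub> ft I"
proof -
  assume I: "I \<in> frac"
  have "ft ` orb I = (\<Union>J\<in>inv_ideals. {ft (J \<odot> I)})" by (auto simp: orb_def)
  also have "\<dots> = (\<Union>J\<in>inv_ideals. {ft J \<otimes>\<^bsub>MS\<^esub> ft I})"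
    using ft_mult[OF _ I] inv_frac by (intro SUP_cong) (auto simp del: MS_simps)
  also have "\<dots> = SV #>\<^bsub>MS\<^esub> ft I"
    unfolding r_coset_def ft_inv_image[symmetric] by simp
  finally show ?thesis .
qed

lemma submonoid_S_ref_val: "submonoid (SV) MS"
proof
  show "SV \<subseteq> carrier MS" by (auto simp: S_ref_val_iff S_ref_V_iff)
  show "\<one>\<^bsub>MS\<^esub> \<in> SV"
    unfolding ft_one[symmetric] ft_inv_image[symmetric] using inv_one by blast
  show "x \<otimes>\<^bsub>MS\<^esub> y \<in> SV" if xy: "x \<in> SV" "y \<in> SV" for x y
  proof -
    obtain I J where IJ: "I \<in> inv_ideals" "J \<in> inv_ideals" "x = ft I" "y = ft J"
      using xy unfolding ft_inv_image[symmetric] by blast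
    then have "I \<in> frac" "J \<in> frac" using inv_frac by blast+
    then have "x \<otimes>\<^bsub>MS\<^esub> y = ft (I \<odot> J)" by (simp only: IJ(3,4) ft_mult)
    then show ?thesis using inv_closed IJ unfolding ft_inv_image[symmetric] by blast
  qed
qed

text \<open>
  A description without representatives, so that independence of their choice needs no proof.
\<close>

definition class_iso where "class_iso C = ft ` \<Union>C"

lemma class_iso_coset: "I \<in> frac \<Longrightarrow> class_iso (pic #>\<^bsub>Cl \<OO>\<^esub> cls I) = SV #>\<^bsub>MS\<^esub> ft I"
  by (simp only: class_iso_def coset_eq Union_orb ft_orb)

lemma carrier_quot: "carrier (Cl \<OO> Mod pic) = (\<lambda>I. pic #>\<^bsub>Cl \<OO>\<^esub> cls I) ` frac"
  unfolding FactGroup_def RCOSETS_def by (auto simp: carrier_Cl)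

lemma carrier_MS_quot: "carrier (MS Mod SV) = (\<lambda>I. SV #>\<^bsub>MS\<^esub> ft I) ` frac"
proof -
  have "carrier (MS Mod SV) = (\<lambda>f. SV #>\<^bsub>MS\<^esub> f) ` carrier MS"
    unfolding FactGroup_def RCOSETS_def by auto
  also have "\<dots> = (\<lambda>f. SV #>\<^bsub>MS\<^esub> f) ` ft ` frac" by (simp add: ft_image)
  finally show ?thesis by (simp add: image_image)
qed

lemma class_iso_iso: "class_iso \<in> Group.iso (Cl \<OO> Mod pic) (MS Mod SV)"
  unfolding iso_def
proof (intro CollectI conjI)
  show "class_iso \<in> hom (Cl \<OO> Mod pic) (MS Mod SV)"
    unfolding hom_def
  proof (intro CollectI conjI ballI)
    show "class_iso \<in> carrier (Cl \<OO> Mod pic) \<rightarrow> carrier (MS Mod SV)"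
      unfolding carrier_quot carrier_MS_quot using class_iso_coset by auto
    fix C D assume "C \<in> carrier (Cl \<OO> Mod pic)" "D \<in> carrier (Cl \<OO> Mod pic)"
    then obtain I J where IJ: "I \<in> frac" "J \<in> frac" and eq: "C = pic #>\<^bsub>Cl \<OO>\<^esub> cls I" "D = pic #>\<^bsub>Cl \<OO>\<^esub> cls J"
      unfolding carrier_quot by blast
    have c: "cls I \<in> carrier (Cl \<OO>)" "cls J \<in> carrier (Cl \<OO>)" using IJ by (auto simp: carrier_Cl)
    have f: "ft I \<in> carrier MS" "ft J \<in> carrier MS" using IJ ft_image by auto
    have "C \<otimes>\<^bsub>Cl \<OO> Mod pic\<^esub> D = pic #>\<^bsub>Cl \<OO>\<^esub> cls (I \<odot> J)"
      unfolding eq mult_Mod_monoid[OF comm_monoid_Cl submonoid_pic c] using IJ by (simp only: Cl_mult)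
    then have "class_iso (C \<otimes>\<^bsub>Cl \<OO> Mod pic\<^esub> D) = SV #>\<^bsub>MS\<^esub> (ft I \<otimes>\<^bsub>MS\<^esub> ft J)"
      using IJ by (simp only: class_iso_coset frac_closed ft_mult)
    also have "\<dots> = class_iso C \<otimes>\<^bsub>MS Mod SV\<^esub> class_iso D"
      unfolding eq class_iso_coset[OF IJ(1)] class_iso_coset[OF IJ(2)]
        mult_Mod_monoid[OF comm_monoid_MS submonoid_S_ref_val f] ..
    finally show "class_iso (C \<otimes>\<^bsub>Cl \<OO> Mod pic\<^esub> D) = class_iso C \<otimes>\<^bsub>MS Mod SV\<^esub> class_iso D" .
  qed
  show "bij_betw class_iso (carrier (Cl \<OO> Mod pic)) (carrier (MS Mod SV))"
    unfolding bij_betw_def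
  proof
    show "class_iso ` carrier (Cl \<OO> Mod pic) = carrier (MS Mod SV)"
      unfolding carrier_quot carrier_MS_quot image_image using class_iso_coset by (intro image_cong) auto
    show "inj_on class_iso (carrier (Cl \<OO> Mod pic))"
    proof (rule inj_onI)
      fix C D assume "C \<in> carrier (Cl \<OO> Mod pic)" "D \<in> carrier (Cl \<OO> Mod pic)" and CD: "class_iso C = class_iso D"
      then obtain I J where IJ: "I \<in> frac" "J \<in> frac" and eq: "C = pic #>\<^bsub>Cl \<OO>\<^esub> cls I" "D = pic #>\<^bsub>Cl \<OO>\<^esub> cls J"
        unfolding carrier_quot by blast
      have "ft ` orb I = ft ` orb J"
        using CD class_iso_coset IJ by (simp only: eq ft_orb)
      then have "orb I = orb J"
        using inj_on_image_eq_iff[OF ft_inj_on] orb_frac IJ by blast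
      then show "C = D" using IJ by (simp only: eq coset_eq)
    qed
  qed
qed

lemma class_iso_one: "class_iso \<one>\<^bsub>Cl \<OO> Mod pic\<^esub> = \<one>\<^bsub>MS Mod SV\<^esub>"
proof -
  have "J \<odot> \<OO> = J" if "J \<in> inv_ideals" for J
    using that inv_frac prod_comm[of J \<OO>] prod_one one_frac by auto
  then have "orb \<OO> = inv_ideals" by (auto simp: orb_def)
  then have "\<Union>pic = inv_ideals" using Union_orb[OF one_frac] by (simp add: pic_eq)
  then show ?thesis by (simp add: class_iso_def FactGroup_def ft_inv_image)
qed

text \<open>
  If the class of \<open>I\<close> is regular, then \<open>I = A (I B I)\<close> with a principal
  ideal \<open>A\<close>, which can be absorbed into \<open>B\<close>.
\<close>

lemma Reg_Cl: "Reg (Cl \<OO>) = cls ` reg_ideals"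
proof (intro equalityI subsetI)
  fix c assume "c \<in> Reg (Cl \<OO>)"
  then obtain I B where IB: "I \<in> frac" "B \<in> frac" "c = cls I" "cls I = cls I \<otimes>\<^bsub>Cl \<OO>\<^esub> cls B \<otimes>\<^bsub>Cl \<OO>\<^esub> cls I"
    by (auto simp: Reg_def carrier_Cl)
  then have "cls I = cls (I \<odot> B \<odot> I)" by (simp only: Cl_mult frac_closed)
  then have "I \<in> cls (I \<odot> B \<odot> I)" using self_in_cls[OF IB(1)] by simp
  then obtain A where A: "A \<in> prin" "I = A \<odot> (I \<odot> B \<odot> I)" by (auto simp: cls_eq)
  have Af: "A \<in> frac" using A prin_frac by blast
  have "A \<odot> (I \<odot> B \<odot> I) = I \<odot> (A \<odot> B) \<odot> I"
    by (rule ft_eqI) (simp_all only: frac_closed ft_prod Af IB(1,2) add_ac)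
  then have "I \<in> reg_ideals" using A(2) IB(1) frac_closed[OF Af IB(2)] unfolding reg_ideals_def by auto
  then show "c \<in> cls ` reg_ideals" using IB(3) by blast
next
  fix c assume "c \<in> cls ` reg_ideals"
  then obtain I B where IB: "I \<in> frac" "B \<in> frac" "c = cls I" "I \<odot> B \<odot> I = I" by (auto simp: reg_ideals_def)
  then have "cls I = cls I \<otimes>\<^bsub>Cl \<OO>\<^esub> cls B \<otimes>\<^bsub>Cl \<OO>\<^esub> cls I" by (simp only: Cl_mult frac_closed)
  then show "c \<in> Reg (Cl \<OO>)" using IB by (auto simp: Reg_def carrier_Cl)
qed

lemma class_iso_Reg:
  "class_iso ` carrier ((Cl \<OO>)\<lparr>carrier := Reg (Cl \<OO>)\<rparr> Mod pic) =
     carrier (fun_monoid \<X> (S_ref_V K \<OO>) Mod SV)"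
proof -
  have "carrier ((Cl \<OO>)\<lparr>carrier := Reg (Cl \<OO>)\<rparr> Mod pic) = (\<lambda>I. pic #>\<^bsub>Cl \<OO>\<^esub> cls I) ` reg_ideals"
    by (auto simp: FactGroup_def RCOSETS_def r_coset_def Reg_Cl)
  moreover have "reg_ideals \<subseteq> frac" by (auto simp: reg_ideals_def)
  ultimately have "class_iso ` carrier ((Cl \<OO>)\<lparr>carrier := Reg (Cl \<OO>)\<rparr> Mod pic) =
      (\<lambda>I. SV #>\<^bsub>MS\<^esub> ft I) ` reg_ideals"
    using class_iso_coset by (simp only: image_image) (intro image_cong, auto)
  also have "\<dots> = (\<lambda>f. SV #>\<^bsub>MS\<^esub> f) ` S_ref_V K \<OO>"
    by (simp only: ft_reg_image[symmetric] image_image)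
  also have "\<dots> = carrier (fun_monoid \<X> (S_ref_V K \<OO>) Mod SV)"
    by (auto simp: FactGroup_def RCOSETS_def r_coset_def fun_monoid_def)
  finally show ?thesis .
qed

end

theorem corollary2p7:
  fixes \<oo> K \<OO> :: "'a::field set"
  assumes "dedekind_domain \<oo>"
    and "\<not> field (ring_on \<oo>)"
    and "K = frac_field \<oo>"
    and "\<And>x::'a. algebraic_over K x"
    and "\<OO> = integral_closure \<oo>"
  shows "\<exists>\<Phi> \<in> iso (Cl \<OO> Mod carrier (Pic \<OO>))
                  (fun_monoid (mSpec \<OO>) (S_b_V K \<OO>) Mod S_ref_val K \<OO>).
     \<Phi> \<one>\<^bsub>Cl \<OO> Mod carrier (Pic \<OO>)\<^esub> =
       \<one>\<^bsub>fun_monoid (mSpec \<OO>) (S_b_V K \<OO>) Mod S_ref_val K \<OO>\<^esub> \<and>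
     (\<forall>I. fractional_ideal \<OO> I \<longrightarrow>
        \<Phi> (carrier (Pic \<OO>) #>\<^bsub>Cl \<OO>\<^esub> ideal_class \<OO> I) =
          S_ref_val K \<OO> #>\<^bsub>fun_monoid (mSpec \<OO>) (S_b_V K \<OO>)\<^esub> f_tilde K \<OO> I) \<and>
     \<Phi> ` carrier ((Cl \<OO>)\<lparr>carrier := Reg (Cl \<OO>)\<rparr> Mod carrier (Pic \<OO>)) =
       carrier (fun_monoid (mSpec \<OO>) (S_ref_V K \<OO>) Mod S_ref_val K \<OO>)"
proof -
  interpret dedekind_extension \<oo>
    using assms(1,2,4) by unfold_locales (simp_all add: assms(3))
  show ?thesis
    unfolding assms(3,5)
    by (rule bexI[OF _ class_iso_iso], intro conjI allI impI)
      (rule class_iso_one, rule class_iso_coset, simp, rule class_iso_Reg)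
qed

end
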